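(* Let $\omega$ be a germ of integrable holomorphic $1$-form at $(\mathbb{C}^3,0)$ with $\mathrm{codim}\,\mathrm{Sing}(\omega)\geq 2$. Suppose that $\omega$ is invariant by a strongly diagonalizable germ of holomorphic vector field $X$ at $(\mathbb{C}^3,0)$. Then, in formal diagonalizing coordinates $(x_1,x_2,x_3)$ for $X$ (suitably ordered) and up to multiplication of $\omega$ by a unit in $\hat{\mathcal{O}}_3$, we have either $$\omega=x_1x_2\left(b_1\frac{dx_1}{x_1}+b_2\frac{dx_2}{x_2}\right)$$ or $$\omega=x_1x_2x_3\left(b_1\frac{dx_1}{x_1}+b_2\frac{dx_2}{x_2}+b_3\frac{dx_3}{x_3}\right),$$ where $b_1,b_2,b_3\in\mathbb{C}^*$.
   Context: $\hat{\mathcal{O}}_3$ is the ring of formal power series in three variables over $\mathbb{C}$. $\omega$ is integrable if $\omega\wedge d\omega=0$; $\mathrm{Sing}(\omega)$ is its zero set; $\omega$ is invariant by $X$ if $i_X\omega=0$. A germ of holomorphic vector field at $(\mathbb{C}^3,0)$ with a singularity at $0$ is strongly diagonalizable if the eigenvalues $\alpha_1,\alpha_2,\alpha_3$ of its linear part satisfy no non-trivial relation $\ell_1\alpha_1+\ell_2\alpha_2+\ell_3\alpha_3=0$ with $\ell_1,\ell_2,\ell_3\in\mathbb{Z}$. Such an $X$ is formally linearizable: formal diagonalizing coordinates are formal coordinates $(x_1,x_2,x_3)$ at $0$ in which $X=\alpha_1x_1\frac{\partial}{\partial x_1}+\alpha_2x_2\frac{\partial}{\partial x_2}+\alpha_3x_3\frac{\partial}{\partial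 x_3}$. *)

theory Defs
  imports
    "HOL-Analysis.Analysis"
    "HOL-Computational_Algebra.Formal_Power_Series"
    "HOL-Combinatorics.Permutations"
begin

section \<open>Formal power series in three variables\<close>

text \<open>
  The ring of formal power series in \<open>z\<^sub>1, z\<^sub>2, z\<^sub>3\<close> is realised as the iterated ring
  \<open>\<complex>[[z\<^sub>1]][[z\<^sub>2]][[z\<^sub>3]]\<close>, so that the ring structure is the one of the library.
  Note that in the index type \<^typ>\<open>3\<close> one has \<open>3 = 0\<close>; the three coordinates
  are the elements \<open>1\<close>, \<open>2\<close>, \<open>3\<close> of this type.
\<close>

type_synonym fps3 = "complex fps fps fps"

definition coeff3 :: "fps3 \<Rightarrow> nat^3 \<Rightarrow> complex" where
  "coeff3 F m = fps_nth (fps_nth (fps_nth F (m $ 3)) (m $ 2)) (m $ 1)"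

definition Abs_fps3 :: "(nat^3 \<Rightarrow> complex) \<Rightarrow> fps3" where
  "Abs_fps3 c = Abs_fps (\<lambda>k. Abs_fps (\<lambda>j. Abs_fps (\<lambda>i. c (vector [i, j, k]))))"

definition const3 :: "complex \<Rightarrow> fps3" where
  "const3 c = fps_const (fps_const (fps_const c))"

definition fps3_deriv :: "3 \<Rightarrow> fps3 \<Rightarrow> fps3" where
  "fps3_deriv i F = Abs_fps3 (\<lambda>m. of_nat (m $ i + 1) * coeff3 F (m + axis i 1))"


section \<open>Holomorphic germs\<close>

definition monom3 :: "complex^3 \<Rightarrow> nat^3 \<Rightarrow> complex" where
  "monom3 z m = (\<Prod>i\<in>UNIV. (z $ i) ^ (m $ i))"

text \<open>
  \<open>F\<close> converges on a neighbourhood of the origin and its sum there is \<open>f\<close>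
  (unconditional, hence absolute, convergence).
\<close>

definition has_fps3_expansion :: "(complex^3 \<Rightarrow> complex) \<Rightarrow> fps3 \<Rightarrow> bool" where
  "has_fps3_expansion f F \<longleftrightarrow>
     (\<forall>\<^sub>F z in nhds 0. ((\<lambda>m. coeff3 F m * monom3 z m) has_sum f z) UNIV)"

text \<open>
  A map \<open>v :: complex^3 \<Rightarrow> complex^3\<close> serves as a representative of a germ at \<open>0\<close> both of
  the vector field \<open>\<Sum>i. v\<^sub>i \<partial>/\<partial>z\<^sub>i\<close> and of the 1-form \<open>\<Sum>i. v\<^sub>i dz\<^sub>i\<close>; its values away
  from \<open>0\<close> are irrelevant. In the same way an element of \<open>fps3^3\<close> is a formal
  vector field or a formal 1-form.
\<close>

definition holomorphic_at :: "(complex^3 \<Rightarrow> complex^3) \<Rightarrow> complex^3 \<Rightarrow> bool" where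
  "holomorphic_at v p \<longleftrightarrow> (\<forall>i. \<exists>F. has_fps3_expansion (\<lambda>z. v (p + z) $ i) F)"

text \<open>The Taylor expansion at \<open>0\<close>; meaningful if \<open>holomorphic_at v 0\<close>.\<close>

definition taylor :: "(complex^3 \<Rightarrow> complex^3) \<Rightarrow> fps3^3" where
  "taylor v = (\<chi> i. THE F. has_fps3_expansion (\<lambda>z. v z $ i) F)"

definition partial :: "3 \<Rightarrow> (complex^3 \<Rightarrow> complex) \<Rightarrow> complex^3 \<Rightarrow> complex" where
  "partial j f z = deriv (\<lambda>t. f (z + axis j t)) 0"


section \<open>Integrable 1-forms, invariance, singular set\<close>

definition ext_deriv :: "(complex^3 \<Rightarrow> complex^3) \<Rightarrow> complex^3 \<Rightarrow> 3 \<Rightarrow> 3 \<Rightarrow> complex" where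
  "ext_deriv \<omega> z i j = partial i (\<lambda>y. \<omega> y $ j) z - partial j (\<lambda>y. \<omega> y $ i) z"

text \<open>The components of the wedge product of a 1-form with a 2-form at a point.\<close>

definition wedge12 :: "complex^3 \<Rightarrow> (3 \<Rightarrow> 3 \<Rightarrow> complex) \<Rightarrow> 3 \<Rightarrow> 3 \<Rightarrow> 3 \<Rightarrow> complex" where
  "wedge12 a \<eta> i j k = a $ i * \<eta> j k + a $ j * \<eta> k i + a $ k * \<eta> i j"

definition integrable_form :: "(complex^3 \<Rightarrow> complex^3) \<Rightarrow> bool" where
  "integrable_form \<omega> \<longleftrightarrow>
     (\<forall>\<^sub>F z in nhds 0. \<forall>i j k. wedge12 (\<omega> z) (ext_deriv \<omega> z) i j k = 0)"

definition invariant_by :: "(complex^3 \<Rightarrow> complex^3) \<Rightarrow> (complex^3 \<Rightarrow> complex^3) \<Rightarrow> bool" where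
  "invariant_by \<omega> X \<longleftrightarrow> (\<forall>\<^sub>F z in nhds 0. (\<Sum>i\<in>UNIV. \<omega> z $ i * X z $ i) = 0)"

definition Sing :: "(complex^3 \<Rightarrow> complex^3) \<Rightarrow> (complex^3) set" where
  "Sing \<omega> = {z. \<omega> z = 0}"

text \<open>
  Complex submanifolds of \<open>\<complex>\<^sup>3\<close>, flattened locally by biholomorphic maps \<open>\<phi>\<close> onto a
  coordinate subspace of dimension \<open>k\<close>.
\<close>

definition complex_submanifold :: "nat \<Rightarrow> (complex^3) set \<Rightarrow> bool" where
  "complex_submanifold k M \<longleftrightarrow>
     (\<forall>p\<in>M. \<exists>U V \<phi> \<psi> S.
        open U \<and> open V \<and> p \<in> U \<and>
        (\<forall>z\<in>U. holomorphic_at \<phi> z) \<and> (\<forall>w\<in>V. holomorphic_at \<psi> w) \<and>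
        \<phi> ` U = V \<and> \<psi> ` V = U \<and> (\<forall>z\<in>U. \<psi> (\<phi> z) = z) \<and> (\<forall>w\<in>V. \<phi> (\<psi> w) = w) \<and>
        card S = k \<and> \<phi> ` (M \<inter> U) = {w \<in> V. \<forall>i. i \<notin> S \<longrightarrow> w $ i = 0})"

text \<open>
  The dimension of the germ of \<open>A\<close> at \<open>p\<close> is the largest \<open>k\<close> such that every neighbourhood
  of \<open>p\<close> contains a non-empty \<open>k\<close>-dimensional complex submanifold inside \<open>A\<close> (the empty
  germ has infinite codimension). So the codimension is at least \<open>c\<close> iff, near \<open>p\<close>, all
  submanifolds inside \<open>A\<close> have dimension at most \<open>3 - c\<close>.
\<close>

definition codim_at_least :: "nat \<Rightarrow> (complex^3) set \<Rightarrow> complex^3 \<Rightarrow> bool" where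
  "codim_at_least c A p \<longleftrightarrow>
     (\<exists>W. open W \<and> p \<in> W \<and>
        (\<forall>k M. complex_submanifold k M \<and> M \<noteq> {} \<and> M \<subseteq> A \<inter> W \<longrightarrow> k + c \<le> 3))"


section \<open>Strongly diagonalizable vector fields\<close>

definition linear_part :: "(complex^3 \<Rightarrow> complex^3) \<Rightarrow> complex^3^3" where
  "linear_part X = (\<chi> i j. partial j (\<lambda>z. X z $ i) 0)"

text \<open>\<open>\<alpha>\<^sub>1, \<alpha>\<^sub>2, \<alpha>\<^sub>3\<close> are the eigenvalues of \<open>A\<close>, listed with multiplicity.\<close>

definition eigenvalues_of :: "complex^3^3 \<Rightarrow> complex^3 \<Rightarrow> bool" where
  "eigenvalues_of A \<alpha> \<longleftrightarrow> (\<forall>t. det (mat t - A) = (\<Prod>i\<in>UNIV. (t - \<alpha> $ i)))"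

definition strongly_diagonalizable :: "(complex^3 \<Rightarrow> complex^3) \<Rightarrow> bool" where
  "strongly_diagonalizable X \<longleftrightarrow>
     holomorphic_at X 0 \<and> X 0 = 0 \<and>
     (\<exists>\<alpha>. eigenvalues_of (linear_part X) \<alpha> \<and>
          (\<forall>l :: int^3. (\<Sum>i\<in>UNIV. of_int (l $ i) * \<alpha> $ i) = 0 \<longrightarrow> l = 0))"


section \<open>Formal coordinates\<close>

definition differential :: "fps3 \<Rightarrow> fps3^3" where
  "differential F = (\<chi> j. fps3_deriv j F)"

definition contract :: "fps3^3 \<Rightarrow> fps3^3 \<Rightarrow> fps3" where
  "contract \<xi> \<eta> = (\<Sum>j\<in>UNIV. \<xi> $ j * \<eta> $ j)"

text \<open>
  Formal coordinates are given by the coordinate functions \<open>x\<^sub>1, x\<^sub>2, x\<^sub>3\<close>, as series in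
  \<open>z\<^sub>1, z\<^sub>2, z\<^sub>3\<close>. All formal vector fields and 1-forms below are written in the
  frames \<open>\<partial>/\<partial>z\<^sub>j\<close> and \<open>dz\<^sub>j\<close>, so no composition of series is needed.
\<close>

definition formal_coordinates :: "fps3^3 \<Rightarrow> bool" where
  "formal_coordinates x \<longleftrightarrow>
     (\<forall>i. coeff3 (x $ i) 0 = 0) \<and>
     det (\<chi> i j. coeff3 (fps3_deriv j (x $ i)) 0 :: complex^3^3) \<noteq> 0"

text \<open>The vector fields \<open>e\<^sub>i = \<partial>/\<partial>x\<^sub>i\<close>: the frame dual to \<open>dx\<^sub>1, dx\<^sub>2, dx\<^sub>3\<close>.\<close>

definition coordinate_frame :: "fps3^3 \<Rightarrow> (3 \<Rightarrow> fps3^3) \<Rightarrow> bool" where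
  "coordinate_frame x e \<longleftrightarrow>
     (\<forall>i j. contract (e i) (differential (x $ j)) = (if i = j then 1 else 0))"

definition diagonalizing_coordinates :: "(complex^3 \<Rightarrow> complex^3) \<Rightarrow> fps3^3 \<Rightarrow> bool" where
  "diagonalizing_coordinates X x \<longleftrightarrow>
     formal_coordinates x \<and>
     (\<exists>\<alpha> e. eigenvalues_of (linear_part X) \<alpha> \<and> coordinate_frame x e \<and>
        taylor X = (\<Sum>i\<in>UNIV. (const3 (\<alpha> $ i) * x $ i) *s e i))"

text \<open>
  The 1-form \<open>(\<Prod>i\<in>S. x\<^sub>i) * (\<Sum>i\<in>S. b\<^sub>i dx\<^sub>i / x\<^sub>i)\<close>, with denominators cleared.
\<close>

definition log_form :: "3 set \<Rightarrow> complex^3 \<Rightarrow> fps3^3 \<Rightarrow> fps3^3" where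
  "log_form S b x =
     (\<Sum>i\<in>S. (const3 (b $ i) * (\<Prod>j\<in>S - {i}. x $ j)) *s differential (x $ i))"

end

theory Submission
  imports Defs "HOL-Complex_Analysis.Complex_Singularities" "HOL-Computational_Algebra.Polynomial"
begin

text \<open>
  The form of \<open>\<omega>\<close> comes from linear algebra over the ring of power series. In the absence of
  resonances the monomials \<open>x\<^sup>m\<close> are eigenvectors of \<open>X\<close> with pairwise distinct eigenvalues
  \<open>weight \<alpha> m = m\<^sub>1\<alpha>\<^sub>1 + m\<^sub>2\<alpha>\<^sub>2 + m\<^sub>3\<alpha>\<^sub>3\<close>, so \<open>X\<close> can be linearised degree by degree
  (\<open>formal_linearisation\<close>). Let \<open>e\<^sub>i = \<partial>/\<partial>x\<^sub>i\<close> be the frame of linearising coordinates, and let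
  \<open>f\<^sub>i\<close> be the contraction of \<open>\<omega>\<close> with \<open>e\<^sub>i\<close>. Integrability and \<open>i\<^sub>X\<omega> = 0\<close> give
  \<open>\<omega> \<and> L\<^sub>X\<omega> = 0\<close> (\<open>lie_deriv_parallel\<close>), and \<open>L\<^sub>X\<omega>\<close> has the coefficients
  \<open>X(f\<^sub>i) + \<alpha>\<^sub>i f\<^sub>i\<close>. Hence the series \<open>g\<^sub>i = x\<^sub>i f\<^sub>i\<close> satisfy \<open>g\<^sub>i X(g\<^sub>j) = g\<^sub>j X(g\<^sub>i)\<close>: they have the
  same logarithmic derivative along \<open>X\<close>. Comparing lexicographically lowest terms, where \<open>X\<close> acts by
  distinct eigenvalues, shows that such series are constant multiples of one series
  (\<open>euler_wronskian_eq_0\<close>): \<open>g\<^sub>i = b\<^sub>i F\<close>. The series \<open>F\<close> is divisible by each \<open>x\<^sub>i\<close> with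
  \<open>b\<^sub>i \<noteq> 0\<close>, so \<open>\<omega>\<close> is a series \<open>G\<close> times the logarithmic form of the statement
  (\<open>formal_normal_form\<close>). Moreover \<open>i\<^sub>X\<omega> = 0\<close> becomes \<open>\<alpha>\<^sub>1b\<^sub>1 + \<alpha>\<^sub>2b\<^sub>2 + \<alpha>\<^sub>3b\<^sub>3 = 0\<close>, so at least two
  of the \<open>b\<^sub>i\<close> are nonzero.

  It remains to see that \<open>G\<close> is a unit, and this is where the codimension of the singular set enters.
  The series \<open>G\<close> need not converge, so it has no zero set of its own. Suppose nevertheless that \<open>G\<close>
  has no constant term. Choose a direction \<open>v\<close> along which some coefficient \<open>a\<close> of \<open>\<omega>\<close> does not
  vanish identically. Zeros of high truncations of \<open>G\<close> show that for small \<open>x\<close> the line through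
  \<open>x\<close> with direction \<open>v\<close> contains a point near \<open>0\<close> at which all coefficients of \<open>\<omega>\<close> are bounded by
  a multiple of any prescribed power of \<open>\<bar>x\<bar>\<close> (\<open>approximate_common_zeros\<close>). For \<open>x = s z\<close>, the product
  of the values of another combination of the coefficients over the zeros of \<open>a\<close> on this line (a
  resultant) is holomorphic in \<open>s\<close> and flat at \<open>s = 0\<close>, hence zero (\<open>common_root_of_flat\<close>). So all coefficients of \<open>\<omega>\<close> have a common
  zero on every such line close to \<open>0\<close> (\<open>common_zeros_on_lines\<close>). These common zeros lie on
  countably many pieces of hypersurfaces transversal to \<open>v\<close>. By Baire's theorem the common zeros on
  one of the pieces project along \<open>v\<close> onto a set with interior, so \<open>Sing \<omega>\<close> contains a
  nonempty submanifold of dimension 2 (\<open>formal_factor_imp_codim_1\<close>). This contradicts the assumption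
  on the codimension.
\<close>

section \<open>Coefficients and orders of formal series\<close>

lemma vector3_nth_eta: "vector [m $ 1, m $ 2, m $ 3] = (m :: 'a::zero^3)"
  by (simp add: vec_eq_iff forall_3 vector_3)

lemma coeff3_Abs_fps3 [simp]: "coeff3 (Abs_fps3 c) m = c m"
  by (simp add: coeff3_def Abs_fps3_def vector3_nth_eta)

lemma fps3_eqI:
  assumes "\<And>m. coeff3 F m = coeff3 G m"
  shows "F = G"
proof (intro fps_ext)
  fix k j i
  show "fps_nth (fps_nth (fps_nth F k) j) i = fps_nth (fps_nth (fps_nth G k) j) i"
    using assms[of "vector [i, j, k]"] by (simp add: coeff3_def vector_3)
qed

lemma coeff3_add [simp]: "coeff3 (F + G) m = coeff3 F m + coeff3 G m"
  and coeff3_diff [simp]: "coeff3 (F - G) m = coeff3 F m - coeff3 G m"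
  and coeff3_uminus [simp]: "coeff3 (- F) m = - coeff3 F m"
  and coeff3_0 [simp]: "coeff3 0 m = 0"
  by (simp_all add: coeff3_def)

lemma coeff3_sum [simp]: "coeff3 (sum f A) m = (\<Sum>a\<in>A. coeff3 (f a) m)"
  by (induction A rule: infinite_finite_induct) auto

lemma fps_nth_vec_zero_iff: "m = (0 :: nat^3) \<longleftrightarrow> m $ 1 = 0 \<and> m $ 2 = 0 \<and> m $ 3 = 0"
  by (simp add: vec_eq_iff forall_3)

lemma coeff3_1: "coeff3 1 m = (if m = 0 then 1 else 0)"
  by (auto simp: coeff3_def fps_nth_vec_zero_iff)

lemma coeff3_const3_mult [simp]: "coeff3 (const3 c * F) m = c * coeff3 F m"
  by (simp add: coeff3_def const3_def fps_mult_left_const_nth)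

lemma coeff3_const3: "coeff3 (const3 c) m = (if m = 0 then c else 0)"
  using coeff3_const3_mult[of c 1 m] by (simp add: coeff3_1)

lemma const3_1 [simp]: "const3 1 = 1" and const3_0 [simp]: "const3 0 = 0"
  by (simp_all add: const3_def)

lemma const3_add: "const3 (a + b) = const3 a + const3 b"
  and const3_mult: "const3 (a * b) = const3 a * const3 b"
  by (simp_all add: const3_def)

lemma const3_sum: "const3 (sum f A) = (\<Sum>a\<in>A. const3 (f a))"
  by (induction A rule: infinite_finite_induct) (auto simp: const3_add)

lemma finite_le_multiindex [simp]: "finite {n. n \<le> (m :: nat^3)}"
proof -
  have "{n. n \<le> m} \<subseteq> (\<lambda>(i, j, k). vector [i, j, k]) ` ({..m $ 1} \<times> {..m $ 2} \<times> {..m $ 3})"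
  proof
    fix n assume "n \<in> {n. n \<le> m}"
    then show "n \<in> (\<lambda>(i, j, k). vector [i, j, k]) ` ({..m $ 1} \<times> {..m $ 2} \<times> {..m $ 3})"
      by (intro image_eqI[of _ _ "(n $ 1, n $ 2, n $ 3)"])
         (auto simp: vector3_nth_eta less_eq_vec_def)
  qed
  then show ?thesis by (rule finite_subset) auto
qed

text \<open>
  The ring structure is that of the iterated one-variable rings; this is the Cauchy product
  over multiindices to which all later computations with coefficients refer.
\<close>

lemma coeff3_mult: "coeff3 (F * G) m = (\<Sum>n | n \<le> m. coeff3 F n * coeff3 G (m - n))"
proof -
  have "coeff3 (F * G) m =
    (\<Sum>k = 0..m $ 3. \<Sum>j = 0..m $ 2. \<Sum>i = 0..m $ 1.
       fps_nth (fps_nth (fps_nth F k) j) i *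
       fps_nth (fps_nth (fps_nth G (m $ 3 - k)) (m $ 2 - j)) (m $ 1 - i))"
    by (simp add: coeff3_def fps_mult_nth fps_sum_nth)
  also have "\<dots> = (\<Sum>(k, j, i)\<in>{0..m $ 3} \<times> {0..m $ 2} \<times> {0..m $ 1}.
       fps_nth (fps_nth (fps_nth F k) j) i *
       fps_nth (fps_nth (fps_nth G (m $ 3 - k)) (m $ 2 - j)) (m $ 1 - i))"
    by (simp add: sum.cartesian_product case_prod_unfold)
  also have "\<dots> = (\<Sum>n | n \<le> m. coeff3 F n * coeff3 G (m - n))"
    by (rule sum.reindex_bij_witness[of _ "\<lambda>n. (n $ 3, n $ 2, n $ 1)" "\<lambda>(k, j, i). vector [i, j, k]"])
       (auto simp: vector3_nth_eta less_eq_vec_def forall_3 vector_3 coeff3_def)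
  finally show ?thesis .
qed

lemma coeff3_0_mult: "coeff3 (F * G) 0 = coeff3 F 0 * coeff3 G 0"
  by (simp add: coeff3_def)

definition mdeg :: "nat^3 \<Rightarrow> nat" where "mdeg m = (\<Sum>i\<in>UNIV. m $ i)"

lemma mdeg_add: "mdeg (m + n) = mdeg m + mdeg n"
  by (simp add: mdeg_def sum.distrib)

lemma mdeg_axis [simp]: "mdeg (axis i 1) = 1"
  by (simp add: mdeg_def axis_def)

lemma mdeg_0 [simp]: "mdeg 0 = 0"
  by (simp add: mdeg_def)

lemma mdeg_eq_0_iff: "mdeg m = 0 \<longleftrightarrow> m = 0"
  by (auto simp: mdeg_def vec_eq_iff)

lemma diff_add_multiindex: "n \<le> m \<Longrightarrow> m - n + n = (m :: nat^3)"
  by (auto simp: vec_eq_iff less_eq_vec_def)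

lemma mdeg_diff: "n \<le> m \<Longrightarrow> mdeg n + mdeg (m - n) = mdeg m"
  by (metis add.commute diff_add_multiindex mdeg_add)

lemma finite_mdeg_le [simp]: "finite {m. mdeg m \<le> k}"
proof -
  have "m $ i \<le> mdeg m" for m i
    unfolding mdeg_def by (rule member_le_sum) auto
  then have "{m. mdeg m \<le> k} \<subseteq> {m. m \<le> (\<chi> i. k)}"
    by (auto simp: less_eq_vec_def intro: order_trans)
  then show ?thesis by (rule finite_subset) simp
qed

lemma finite_mdeg_less [simp]: "finite {m. mdeg m < k}"
  by (rule finite_subset[OF _ finite_mdeg_le[of k]]) auto

text \<open>
  Membership in the \<open>N\<close>-th power of the maximal ideal. These powers are the neighbourhoods of \<open>0\<close>
  in the topology in which formal limits are taken below.
\<close>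

definition order_ge :: "nat \<Rightarrow> fps3 \<Rightarrow> bool" where
  "order_ge N F \<longleftrightarrow> (\<forall>m. mdeg m < N \<longrightarrow> coeff3 F m = 0)"

lemma order_ge_0 [simp]: "order_ge 0 F" and order_ge_zero [simp]: "order_ge N 0"
  by (auto simp: order_ge_def)

lemma order_ge_add: "order_ge N F \<Longrightarrow> order_ge N G \<Longrightarrow> order_ge N (F + G)"
  and order_ge_diff: "order_ge N F \<Longrightarrow> order_ge N G \<Longrightarrow> order_ge N (F - G)"
  by (auto simp: order_ge_def)

lemma order_ge_sum: "(\<And>a. a \<in> A \<Longrightarrow> order_ge N (f a)) \<Longrightarrow> order_ge N (sum f A)"
  by (auto simp: order_ge_def)

lemma order_ge_mono: "order_ge N F \<Longrightarrow> M \<le> N \<Longrightarrow> order_ge M F"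
  by (auto simp: order_ge_def)

lemma order_ge_mult:
  assumes "order_ge a F" "order_ge b G"
  shows "order_ge (a + b) (F * G)"
  unfolding order_ge_def coeff3_mult
proof (intro allI impI sum.neutral ballI)
  fix m n assume m: "mdeg m < a + b" and "n \<in> {n. n \<le> m}"
  then have "mdeg n < a \<or> mdeg (m - n) < b" using mdeg_diff[of n m] by auto
  then show "coeff3 F n * coeff3 G (m - n) = 0" using assms by (auto simp: order_ge_def)
qed

lemma order_ge_mult_left: "order_ge N G \<Longrightarrow> order_ge N (F * G)"
  using order_ge_mult[of 0 F N G] by simp

lemma order_ge_mult_right: "order_ge N F \<Longrightarrow> order_ge N (F * G)"
  using order_ge_mult[of N F 0 G] by simp

lemma order_ge_1_iff: "order_ge 1 F \<longleftrightarrow> coeff3 F 0 = 0"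
  by (auto simp: order_ge_def mdeg_eq_0_iff)

lemma order_ge_power: "order_ge N F \<Longrightarrow> order_ge (k * N) (F ^ k)"
  by (induction k) (auto intro: order_ge_mult)

lemma order_ge_all_imp_0: "(\<And>N. order_ge N F) \<Longrightarrow> F = 0"
  by (rule fps3_eqI) (metis coeff3_0 lessI order_ge_def)

definition monom_fps3 :: "nat^3 \<Rightarrow> fps3" where
  "monom_fps3 m = Abs_fps3 (\<lambda>n. if n = m then 1 else 0)"

lemma coeff3_monom_fps3: "coeff3 (monom_fps3 m) n = (if n = m then 1 else 0)"
  by (simp add: monom_fps3_def)

lemma monom_fps3_0: "monom_fps3 0 = 1"
  by (rule fps3_eqI) (simp add: coeff3_monom_fps3 coeff3_1)

lemma coeff3_monom_mult:
  "coeff3 (monom_fps3 m * F) n = (if m \<le> n then coeff3 F (n - m) else 0)"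
proof -
  have "coeff3 (monom_fps3 m * F) n = (\<Sum>k | k \<le> n. if k = m then coeff3 F (n - m) else 0)"
    unfolding coeff3_mult by (rule sum.cong) (auto simp: coeff3_monom_fps3)
  also have "\<dots> = (if m \<le> n then coeff3 F (n - m) else 0)"
    by simp
  finally show ?thesis .
qed

lemma monom_fps3_mult: "monom_fps3 m * monom_fps3 n = monom_fps3 (m + n)"
  by (rule fps3_eqI)
     (auto simp: coeff3_monom_mult coeff3_monom_fps3 vec_eq_iff less_eq_vec_def,
       metis le_add_diff_inverse)

definition trunc3 :: "nat \<Rightarrow> fps3 \<Rightarrow> fps3" where
  "trunc3 N F = (\<Sum>m | mdeg m < N. const3 (coeff3 F m) * monom_fps3 m)"

lemma coeff3_trunc3: "coeff3 (trunc3 N F) m = (if mdeg m < N then coeff3 F m else 0)"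
proof -
  have "coeff3 (trunc3 N F) m = (\<Sum>n | mdeg n < N. if n = m then coeff3 F n else 0)"
    unfolding trunc3_def coeff3_sum by (rule sum.cong) (auto simp: coeff3_monom_fps3)
  also have "\<dots> = (if mdeg m < N then coeff3 F m else 0)" by simp
  finally show ?thesis .
qed

lemma order_ge_diff_trunc3: "order_ge N (F - trunc3 N F)"
  by (auto simp: order_ge_def coeff3_trunc3)

text \<open>
  Truncations approximate every series and are finite sums of monomials, so an additive map that is
  continuous for the order filtration is determined by its values on monomials. The loss of one order
  that is allowed here accommodates derivations.
\<close>

lemma continuous_additive_ext:
  fixes S T :: "fps3 \<Rightarrow> fps3"
  assumes "\<And>F G. S (F + G) = S F + S G" "\<And>F G. T (F + G) = T F + T G"
    and "\<And>N F. order_ge (Suc N) F \<Longrightarrow> order_ge N (S F)"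
    and "\<And>N F. order_ge (Suc N) F \<Longrightarrow> order_ge N (T F)"
    and eq: "\<And>c m. S (const3 c * monom_fps3 m) = T (const3 c * monom_fps3 m)"
  shows "S F = T F"
proof -
  interpret S: Modules.additive S by unfold_locales (fact assms)
  interpret T: Modules.additive T by unfold_locales (fact assms)
  have "order_ge N (S F - T F)" for N
  proof -
    let ?R = "F - trunc3 (Suc N) F"
    have "S (trunc3 (Suc N) F) = T (trunc3 (Suc N) F)"
      unfolding trunc3_def S.sum T.sum by (simp add: eq)
    then have "S F - T F = S ?R - T ?R" by (simp add: S.diff T.diff)
    then show ?thesis
      using assms(3,4)[OF order_ge_diff_trunc3, of N F] by (simp add: order_ge_diff)
  qed
  then have "S F - T F = 0" by (rule order_ge_all_imp_0)
  then show ?thesis by simp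
qed

text \<open>
  Successive approximation: correct the error of order \<open>N\<close> by a term of order \<open>N\<close>, which leaves an
  error of order \<open>N + 1\<close>. The corrections add up because their orders tend to infinity. Both the
  surjectivity of substitutions and the formal linearisation are instances.
\<close>

lemma graded_surj_imp_surj:
  fixes T :: "fps3 \<Rightarrow> fps3"
  assumes add: "\<And>F G. T (F + G) = T F + T G"
    and filt: "\<And>N F. order_ge N F \<Longrightarrow> order_ge N (T F)"
    and graded: "\<And>N F. N0 \<le> N \<Longrightarrow> order_ge N F \<Longrightarrow> \<exists>G. order_ge N G \<and> order_ge (Suc N) (F - T G)"
    and F: "order_ge N0 F"
  shows "\<exists>G. order_ge N0 G \<and> T G = F"
proof -
  interpret T: Modules.additive T by unfold_locales (fact add)
  obtain s where s: "\<And>N H. N0 \<le> N \<Longrightarrow> order_ge N H \<Longrightarrow> order_ge N (s N H) \<and> order_ge (Suc N) (H - T (s N H))"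
    using graded by metis
  \<comment> \<open>the partial sums of the corrections\<close>
  define g where "g = rec_nat (0::fps3) (\<lambda>k G. G + s (N0 + k) (F - T G))"
  have g0: "g 0 = 0" and gS: "g (Suc k) = g k + s (N0 + k) (F - T (g k))" for k
    by (simp_all add: g_def)
  have err: "order_ge (N0 + k) (F - T (g k))" for k
  proof (induction k)
    case 0
    then show ?case using F by (simp add: g0 T.zero)
  next
    case (Suc k)
    have "F - T (g (Suc k)) = (F - T (g k)) - T (s (N0 + k) (F - T (g k)))"
      by (simp add: gS add)
    moreover have "order_ge (Suc (N0 + k)) ((F - T (g k)) - T (s (N0 + k) (F - T (g k))))"
      using s[OF _ Suc] by simp
    ultimately show ?case by (simp only: add_Suc_right)
  qed
  have step: "order_ge (N0 + k) (g (Suc k) - g k)" for k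
    using s[OF _ err, of k] by (simp add: gS)
  have stab: "order_ge (N0 + k) (g l - g k)" if "k \<le> l" for k l
    using that
  proof (induction l rule: dec_induct)
    case (step l)
    then have "order_ge (N0 + k) (g (Suc l) - g l)"
      using \<open>\<And>k. order_ge (N0 + k) (g (Suc k) - g k)\<close>[of l] by (auto intro: order_ge_mono)
    from order_ge_add[OF this step.IH] show ?case by simp
  qed simp
  \<comment> \<open>the limit: the coefficient at \<open>m\<close> does not change any more after step \<open>mdeg m + 1\<close>\<close>
  define G where "G = Abs_fps3 (\<lambda>m. coeff3 (g (Suc (mdeg m))) m)"
  have lim: "order_ge k (G - g k)" for k
    unfolding order_ge_def
  proof (intro allI impI)
    fix m assume "mdeg m < k"
    then have "order_ge (N0 + Suc (mdeg m)) (g k - g (Suc (mdeg m)))" by (intro stab) simp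
    then have "coeff3 (g k) m = coeff3 (g (Suc (mdeg m))) m"
      by (auto simp: order_ge_def)
    then show "coeff3 (G - g k) m = 0" by (simp add: G_def)
  qed
  have "order_ge N (F - T G)" for N
  proof -
    have "F - T G = (F - T (g N)) - T (G - g N)" by (simp add: T.diff)
    moreover have "order_ge N (F - T (g N))" by (rule order_ge_mono[OF err]) simp
    ultimately show ?thesis using filt[OF lim[of N]] by (simp only: order_ge_diff)
  qed
  then have "F - T G = 0" by (rule order_ge_all_imp_0)
  moreover have "order_ge N0 G"
  proof -
    have "order_ge N0 (g N0)" using stab[of 0 N0] by (simp add: g0)
    from order_ge_add[OF lim[of N0] this] show ?thesis by simp
  qed
  ultimately show ?thesis by auto
qed

section \<open>Derivations and substitution of formal series\<close>

text \<open>
  The derivatives with respect to the inner variables act on coefficients, so the product rule in all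
  three variables reduces to the rule for one variable.
\<close>

definition map_coeffs :: "('a::comm_ring_1 \<Rightarrow> 'a) \<Rightarrow> 'a fps \<Rightarrow> 'a fps" where
  "map_coeffs \<delta> F = Abs_fps (\<lambda>k. \<delta> (fps_nth F k))"

lemma map_coeffs_mult:
  assumes add: "\<And>a b. \<delta> (a + b) = \<delta> a + \<delta> b"
    and mult: "\<And>a b. \<delta> (a * b) = \<delta> a * b + a * \<delta> b"
  shows "map_coeffs \<delta> (F * G) = map_coeffs \<delta> F * G + F * map_coeffs \<delta> G"
proof (rule fps_ext)
  interpret Modules.additive \<delta> by unfold_locales (rule add)
  show "fps_nth (map_coeffs \<delta> (F * G)) k = fps_nth (map_coeffs \<delta> F * G + F * map_coeffs \<delta> G) k" for k
    by (simp add: map_coeffs_def fps_mult_nth sum mult sum.distrib)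
qed

lemma map_coeffs_add:
  assumes add: "\<And>a b. \<delta> (a + b) = \<delta> a + \<delta> b"
  shows "map_coeffs \<delta> (F + G) = map_coeffs \<delta> F + map_coeffs \<delta> G"
  by (rule fps_ext) (simp add: map_coeffs_def add)

lemma coeff3_deriv [simp]:
  "coeff3 (fps3_deriv i F) m = of_nat (m $ i + 1) * coeff3 F (m + axis i 1)"
  by (simp add: fps3_deriv_def)

lemma fps_nth_of_nat_mult: "fps_nth (of_nat k * F) j = of_nat k * fps_nth F j"
  by (metis fps_of_nat fps_mult_left_const_nth)

lemma fps3_deriv_eq:
  "fps3_deriv 3 F = fps_deriv F"
  "fps3_deriv 2 F = map_coeffs fps_deriv F"
  "fps3_deriv 1 F = map_coeffs (map_coeffs fps_deriv) F"
proof -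
  have *: "of_nat (n + 1) = (1 + of_nat n :: 'a :: comm_ring_1)" for n by simp
  show "fps3_deriv 3 F = fps_deriv F"
    "fps3_deriv 2 F = map_coeffs fps_deriv F"
    "fps3_deriv 1 F = map_coeffs (map_coeffs fps_deriv) F"
    by (rule fps3_eqI, unfold coeff3_deriv, simp only: coeff3_def fps_deriv_nth map_coeffs_def
        fps_nth_Abs_fps fps_nth_of_nat_mult, simp add: axis_def)+
qed

lemma fps3_deriv_add: "fps3_deriv i (F + G) = fps3_deriv i F + fps3_deriv i G"
  by (rule fps3_eqI) (simp add: algebra_simps)

lemma fps3_deriv_diff: "fps3_deriv i (F - G) = fps3_deriv i F - fps3_deriv i G"
  by (rule fps3_eqI) (simp add: algebra_simps)

lemma fps3_deriv_0 [simp]: "fps3_deriv i 0 = 0"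
  by (rule fps3_eqI) simp

lemma fps3_deriv_sum: "fps3_deriv i (sum f A) = (\<Sum>a\<in>A. fps3_deriv i (f a))"
  by (induction A rule: infinite_finite_induct) (auto simp: fps3_deriv_add)

lemma fps3_deriv_mult: "fps3_deriv i (F * G) = fps3_deriv i F * G + F * fps3_deriv i G"
proof -
  have 1: "map_coeffs fps_deriv (F * G) = map_coeffs fps_deriv F * G + F * map_coeffs fps_deriv G"
    for F G :: "'a :: comm_ring_1 fps fps"
    by (rule map_coeffs_mult) (simp_all add: algebra_simps)
  have 2: "map_coeffs fps_deriv (F + G) = map_coeffs fps_deriv F + map_coeffs fps_deriv G"
    for F G :: "'a :: comm_ring_1 fps fps"
    by (rule map_coeffs_add) simp
  have 3: "map_coeffs (map_coeffs fps_deriv) (F * G) =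
      map_coeffs (map_coeffs fps_deriv) F * G + F * map_coeffs (map_coeffs fps_deriv) G"
    for F G :: "'a :: comm_ring_1 fps fps fps"
    by (rule map_coeffs_mult) (simp_all add: 1 2)
  have "i = 1 \<or> i = 2 \<or> i = 3" by (rule exhaust_3)
  then show ?thesis
    by (auto simp only: fps3_deriv_eq 1 3 fps_deriv_mult add.commute)
qed

lemma fps3_deriv_const_mult: "fps3_deriv i (const3 c * F) = const3 c * fps3_deriv i F"
  by (rule fps3_eqI) simp

lemma fps3_deriv_const [simp]: "fps3_deriv i (const3 c) = 0"
  by (rule fps3_eqI) (auto simp: coeff3_const3 vec_eq_iff axis_def)

lemma fps3_deriv_commute: "fps3_deriv i (fps3_deriv j F) = fps3_deriv j (fps3_deriv i F)"
  by (rule fps3_eqI) (cases "i = j"; simp add: axis_def add.assoc add.commute add.left_commute)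

lemmas mdeg_axis_Suc [simp] = mdeg_axis[unfolded One_nat_def]

lemma order_ge_deriv: "order_ge (Suc N) F \<Longrightarrow> order_ge N (fps3_deriv i F)"
  by (auto simp: order_ge_def mdeg_add)

definition var :: "3 \<Rightarrow> fps3" where "var i = monom_fps3 (axis i 1)"

definition xmon :: "fps3^3 \<Rightarrow> nat^3 \<Rightarrow> fps3" where
  "xmon x m = (\<Prod>i\<in>UNIV. (x $ i) ^ (m $ i))"

lemma axis_add: "axis i (a + b) = axis i a + axis i (b :: 'a :: comm_monoid_add)"
  by (auto simp: vec_eq_iff axis_def)

lemma var_power: "var i ^ k = monom_fps3 (axis i k)"
proof (induction k)
  case 0
  have "axis i 0 = (0 :: nat^3)" by (simp add: vec_eq_iff axis_def)
  then show ?case by (simp only: power_0 monom_fps3_0)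
next
  case (Suc k)
  have "var i ^ Suc k = monom_fps3 (axis i 1 + axis i k)"
    by (simp only: power_Suc Suc) (simp only: var_def monom_fps3_mult)
  also have "axis i 1 + axis i k = axis i (Suc k)"
    by (simp only: axis_add[symmetric] plus_1_eq_Suc)
  finally show ?case .
qed

lemma monom_fps3_eq_prod: "monom_fps3 m = (\<Prod>i\<in>UNIV. var i ^ (m $ i))"
proof -
  have "monom_fps3 (\<Sum>i\<in>A. axis i (m $ i)) = (\<Prod>i\<in>A. var i ^ (m $ i))" for A
    by (induction A rule: infinite_finite_induct)
       (auto simp: monom_fps3_0 var_power monom_fps3_mult[symmetric])
  moreover have "(\<Sum>i\<in>UNIV. axis i (m $ i)) = m"
    by (simp add: vec_eq_iff axis_def)
  ultimately show ?thesis by metis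
qed

lemma xmon_add: "xmon x (m + n) = xmon x m * xmon x n"
  by (simp add: xmon_def power_add prod.distrib)

lemma order_ge_prod:
  "(\<And>i. i \<in> A \<Longrightarrow> order_ge (k i) (f i)) \<Longrightarrow> order_ge (sum k A) (prod f A)"
  by (induction A rule: infinite_finite_induct) (auto intro: order_ge_mult)

lemma order_ge_xmon:
  assumes "\<And>i. coeff3 (x $ i) 0 = 0"
  shows "order_ge (mdeg m) (xmon x m)"
  unfolding mdeg_def xmon_def
  by (rule order_ge_prod) (use order_ge_power[of 1] assms in \<open>simp add: order_ge_1_iff del: One_nat_def\<close>)

text \<open>
  Substitution of \<open>x\<close> for the variables, meaningful if the \<open>x\<^sub>i\<close> have no constant term: then the
  monomial \<open>xmon x m\<close> has order at least \<open>mdeg m\<close>, so the restriction to \<open>mdeg m \<le> mdeg n\<close> omits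
  only zero terms and makes the sum finite.
\<close>

definition subst3 :: "fps3^3 \<Rightarrow> fps3 \<Rightarrow> fps3" where
  "subst3 x F = Abs_fps3 (\<lambda>n. \<Sum>m | mdeg m \<le> mdeg n. coeff3 F m * coeff3 (xmon x m) n)"

lemma subst3_add: "subst3 x (F + G) = subst3 x F + subst3 x G"
  by (rule fps3_eqI) (simp add: subst3_def sum.distrib algebra_simps)

lemma subst3_0 [simp]: "subst3 x 0 = 0"
  by (rule fps3_eqI) (simp add: subst3_def)

lemma subst3_diff: "subst3 x (F - G) = subst3 x F - subst3 x G"
  by (rule fps3_eqI) (simp add: subst3_def sum_subtractf algebra_simps)

lemma subst3_sum: "subst3 x (sum f A) = (\<Sum>a\<in>A. subst3 x (f a))"
  by (induction A rule: infinite_finite_induct) (auto simp: subst3_add)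

lemma subst3_const_mult: "subst3 x (const3 c * F) = const3 c * subst3 x F"
  by (rule fps3_eqI) (simp add: subst3_def sum_distrib_left mult.assoc)

lemma coeff3_subst3_0: "coeff3 (subst3 x F) 0 = coeff3 F 0"
  by (simp add: subst3_def mdeg_eq_0_iff xmon_def coeff3_1)

lemma order_ge_subst3: "order_ge N F \<Longrightarrow> order_ge N (subst3 x F)"
  by (auto simp: order_ge_def subst3_def intro!: sum.neutral)

lemma subst3_monom:
  assumes "\<And>i. coeff3 (x $ i) 0 = 0"
  shows "subst3 x (monom_fps3 m) = xmon x m"
proof (rule fps3_eqI)
  fix n
  have "coeff3 (subst3 x (monom_fps3 m)) n = (\<Sum>k | mdeg k \<le> mdeg n. if k = m then coeff3 (xmon x m) n else 0)"
    unfolding subst3_def coeff3_Abs_fps3 by (rule sum.cong) (auto simp: coeff3_monom_fps3)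
  also have "\<dots> = (if mdeg m \<le> mdeg n then coeff3 (xmon x m) n else 0)" by simp
  also have "\<dots> = coeff3 (xmon x m) n"
    using order_ge_xmon[OF assms, of m] by (auto simp: order_ge_def)
  finally show "coeff3 (subst3 x (monom_fps3 m)) n = coeff3 (xmon x m) n" .
qed

lemma subst3_var:
  assumes "\<And>i. coeff3 (x $ i) 0 = 0"
  shows "subst3 x (var i) = x $ i"
proof -
  have "xmon x (axis i 1) = (\<Prod>j\<in>UNIV. if j = i then x $ j else 1)"
    unfolding xmon_def by (rule prod.cong) (auto simp: axis_def)
  then show ?thesis unfolding var_def subst3_monom[OF assms] by simp
qed

text \<open>
  Both sides are additive and continuous in either factor, so it is enough to compare them on
  monomials, where they agree by the rule for exponents.
\<close>

lemma subst3_mult: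
  assumes x: "\<And>i. coeff3 (x $ i) 0 = 0"
  shows "subst3 x (F * G) = subst3 x F * subst3 x G"
proof -
  have filt: "order_ge N F" if "order_ge (Suc N) F" for N F
    by (rule order_ge_mono[OF that]) simp
  have mono: "subst3 x (const3 c * monom_fps3 m * G) = subst3 x (const3 c * monom_fps3 m) * subst3 x G" for c m G
  proof (rule continuous_additive_ext[where F = G
        and S = "\<lambda>H. subst3 x (const3 c * monom_fps3 m * H)"
        and T = "\<lambda>H. subst3 x (const3 c * monom_fps3 m) * subst3 x H"])
    show "subst3 x (const3 c * monom_fps3 m * (const3 d * monom_fps3 n)) =
        subst3 x (const3 c * monom_fps3 m) * subst3 x (const3 d * monom_fps3 n)" for d n
    proof -
      have "const3 c * monom_fps3 m * (const3 d * monom_fps3 n) = const3 c * (const3 d * monom_fps3 (m + n))"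
        by (simp only: monom_fps3_mult[symmetric] mult_ac)
      then show ?thesis
        by (simp only: subst3_const_mult subst3_monom[OF x] xmon_add mult_ac)
    qed
  next
    fix N F assume F: "order_ge (Suc N) F"
    show "order_ge N (subst3 x (const3 c * monom_fps3 m * F))"
      by (intro order_ge_subst3 order_ge_mult_left filt[OF F])
    show "order_ge N (subst3 x (const3 c * monom_fps3 m) * subst3 x F)"
      by (intro order_ge_subst3 order_ge_mult_left filt[OF F])
  qed (simp_all add: distrib_left subst3_add)
  show ?thesis
  proof (rule continuous_additive_ext[where F = F
        and S = "\<lambda>H. subst3 x (H * G)" and T = "\<lambda>H. subst3 x H * subst3 x G"])
    fix N F assume F: "order_ge (Suc N) F"
    show "order_ge N (subst3 x (F * G))"
      by (intro order_ge_subst3 order_ge_mult_right filt[OF F])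
    show "order_ge N (subst3 x F * subst3 x G)"
      by (intro order_ge_subst3 order_ge_mult_right filt[OF F])
  qed (simp_all add: distrib_right subst3_add mono)
qed

lemma subst3_const: "subst3 x (const3 c) = const3 c"
proof -
  have "subst3 x 1 = 1"
    by (rule fps3_eqI) (auto simp: subst3_def coeff3_1 xmon_def if_distrib[of "\<lambda>t. t * _"] cong: if_cong)
  then show ?thesis using subst3_const_mult[of x c 1] by simp
qed

lemma subst3_1 [simp]: "subst3 x 1 = 1"
  using subst3_const[of x 1] by simp

lemma subst3_prod:
  assumes "\<And>i. coeff3 (x $ i) 0 = 0"
  shows "subst3 x (prod f A) = (\<Prod>a\<in>A. subst3 x (f a))"
  by (induction A rule: infinite_finite_induct) (auto simp: subst3_mult[OF assms])

lemma fps3_deriv_var: "fps3_deriv i (var j) = (if i = j then 1 else 0)"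
  by (rule fps3_eqI)
     (auto simp: var_def coeff3_monom_fps3 coeff3_1 axis_def vec_eq_iff)

text \<open>
  The rule holds for constants and variables and is stable under products, hence it holds for
  monomials. Both sides are continuous with the loss of one order.
\<close>

lemma chain_rule_subst3:
  assumes x: "\<And>i. coeff3 (x $ i) 0 = 0"
  shows "fps3_deriv j (subst3 x F) = (\<Sum>i\<in>UNIV. subst3 x (fps3_deriv i F) * fps3_deriv j (x $ i))"
proof -
  define C where "C F \<longleftrightarrow>
    fps3_deriv j (subst3 x F) = (\<Sum>i\<in>UNIV. subst3 x (fps3_deriv i F) * fps3_deriv j (x $ i))" for F
  have C_mult: "C (F * G)" if "C F" "C G" for F G
    using that unfolding C_def
    by (simp add: subst3_mult[OF x] fps3_deriv_mult subst3_add sum_distrib_left sum_distrib_right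
        sum.distrib[symmetric] algebra_simps)
  have C_const: "C (const3 c)" for c
    by (simp add: C_def subst3_const)
  have "C (var k)" for k
  proof -
    have "(\<Sum>i\<in>UNIV. subst3 x (fps3_deriv i (var k)) * fps3_deriv j (x $ i)) =
      (\<Sum>i\<in>UNIV. if i = k then fps3_deriv j (x $ i) else 0)"
      by (rule sum.cong) (auto simp: fps3_deriv_var)
    then show ?thesis by (simp add: C_def subst3_var[OF x])
  qed
  then have C_power: "C (var k ^ n)" for k n
    using C_const[of 1] by (induction n) (auto intro: C_mult)
  have "C (\<Prod>i\<in>A. var i ^ (m $ i))" for A and m :: "nat^3"
    using C_const[of 1] by (induction A rule: infinite_finite_induct) (auto intro: C_mult C_power)
  then have C_monom: "C (const3 c * monom_fps3 m)" for c m
    unfolding monom_fps3_eq_prod by (intro C_mult C_const)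
  show ?thesis
  proof (rule continuous_additive_ext[where F = F
        and S = "\<lambda>H. fps3_deriv j (subst3 x H)"
        and T = "\<lambda>H. \<Sum>i\<in>UNIV. subst3 x (fps3_deriv i H) * fps3_deriv j (x $ i)"])
    fix N F assume F: "order_ge (Suc N) F"
    show "order_ge N (fps3_deriv j (subst3 x F))"
      by (intro order_ge_deriv order_ge_subst3 F)
    show "order_ge N (\<Sum>i\<in>UNIV. subst3 x (fps3_deriv i F) * fps3_deriv j (x $ i))"
      by (intro order_ge_sum order_ge_mult_right order_ge_subst3 order_ge_deriv F)
  qed (simp_all add: subst3_add fps3_deriv_add distrib_right sum.distrib C_monom[unfolded C_def])
qed

section \<open>Vector fields, frames and formal coordinates\<close>

lemma fps_dvd_1I:
  fixes f :: "'a::comm_ring_1 fps"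
  assumes "fps_nth f 0 dvd 1"
  shows "f dvd 1"
proof -
  obtain y where "1 = fps_nth f 0 * y" using assms by (auto elim: dvdE)
  then have "f * fps_right_inverse f y = 1" by (intro fps_right_inverse) simp
  then show ?thesis by (metis dvd_triv_left)
qed

lemma unit_fps3:
  assumes "coeff3 F 0 \<noteq> 0"
  shows "F dvd 1"
  using assms by (intro fps_dvd_1I) (simp add: coeff3_def dvd_field_iff)

lemma contract_3: "contract a b = a $ 1 * b $ 1 + a $ 2 * b $ 2 + a $ 3 * b $ 3"
  by (simp add: contract_def sum_3)

definition vderiv :: "fps3^3 \<Rightarrow> fps3 \<Rightarrow> fps3" where
  "vderiv \<xi> F = contract \<xi> (differential F)"

lemma vderiv_eq: "vderiv \<xi> F = (\<Sum>j\<in>UNIV. \<xi> $ j * fps3_deriv j F)"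
  by (simp add: vderiv_def contract_def differential_def)

lemma vderiv_add: "vderiv \<xi> (F + G) = vderiv \<xi> F + vderiv \<xi> G"
  by (simp add: vderiv_eq fps3_deriv_add distrib_left sum.distrib)

lemma vderiv_0 [simp]: "vderiv \<xi> 0 = 0"
  by (simp add: vderiv_eq)

lemma vderiv_sum: "vderiv \<xi> (sum f A) = (\<Sum>a\<in>A. vderiv \<xi> (f a))"
  by (induction A rule: infinite_finite_induct) (auto simp: vderiv_add)

lemma vderiv_mult: "vderiv \<xi> (F * G) = vderiv \<xi> F * G + F * vderiv \<xi> G"
  by (simp add: vderiv_eq fps3_deriv_mult distrib_left sum.distrib sum_distrib_left sum_distrib_right
      mult_ac)

lemma vderiv_subst3:
  assumes x: "\<And>i. coeff3 (x $ i) 0 = 0"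
  shows "vderiv \<xi> (subst3 x F) = (\<Sum>i\<in>UNIV. subst3 x (fps3_deriv i F) * vderiv \<xi> (x $ i))"
  unfolding vderiv_eq chain_rule_subst3[OF x] sum_distrib_left
  by (subst sum.swap) (simp add: mult_ac)

lemma order_ge_vderiv:
  assumes "\<And>j. coeff3 (\<xi> $ j) 0 = 0" and F: "order_ge N F"
  shows "order_ge N (vderiv \<xi> F)"
proof (cases N)
  case (Suc M)
  have "order_ge (1 + M) (\<xi> $ j * fps3_deriv j F)" for j
    using assms Suc by (intro order_ge_mult order_ge_deriv) (auto simp: order_ge_1_iff simp del: One_nat_def)
  then show ?thesis unfolding vderiv_eq Suc by (intro order_ge_sum) simp
qed simp

text \<open>
  Cramer's rule, in the form that is valid over an integral domain, where the matrix need not be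
  invertible.
\<close>

lemma det_nonzero_kernel:
  fixes A :: "'a::idom^3^3" and v :: "'a^3"
  assumes "det A \<noteq> 0" and eq: "\<And>i. A $ i $ 1 * v $ 1 + A $ i $ 2 * v $ 2 + A $ i $ 3 * v $ 3 = 0"
  shows "v = 0"
proof -
  let ?e = "\<lambda>i. A $ i $ 1 * v $ 1 + A $ i $ 2 * v $ 2 + A $ i $ 3 * v $ 3"
  have "det A * v $ 1 = (A$2$2 * A$3$3 - A$2$3 * A$3$2) * ?e 1 + (A$1$3 * A$3$2 - A$1$2 * A$3$3) * ?e 2
      + (A$1$2 * A$2$3 - A$1$3 * A$2$2) * ?e 3"
    "det A * v $ 2 = (A$2$3 * A$3$1 - A$2$1 * A$3$3) * ?e 1 + (A$1$1 * A$3$3 - A$1$3 * A$3$1) * ?e 2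
      + (A$1$3 * A$2$1 - A$1$1 * A$2$3) * ?e 3"
    "det A * v $ 3 = (A$2$1 * A$3$2 - A$2$2 * A$3$1) * ?e 1 + (A$1$2 * A$3$1 - A$1$1 * A$3$2) * ?e 2
      + (A$1$1 * A$2$2 - A$1$2 * A$2$1) * ?e 3"
    by (simp_all add: det_3 algebra_simps)
  then have "det A * v $ 1 = 0" "det A * v $ 2 = 0" "det A * v $ 3 = 0"
    by (simp_all only: eq mult_zero_right add_0_right)
  then show ?thesis using assms(1) by (simp add: vec_eq_iff forall_3)
qed

lemma frame_det_nonzero:
  assumes "coordinate_frame x e"
  shows "det (\<chi> i. e i) \<noteq> 0" "det (\<chi> i. differential (x $ i)) \<noteq> 0"
proof -
  let ?E = "\<chi> i. e i" and ?J = "\<chi> i. differential (x $ i)"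
  have "?E ** transpose ?J = mat 1"
    using assms by (simp add: coordinate_frame_def matrix_matrix_mult_def transpose_def mat_def
        contract_def vec_eq_iff)
  then have "det ?E * det ?J = 1" by (metis det_mul det_transpose det_I)
  then show "det ?E \<noteq> 0" "det ?J \<noteq> 0" by auto
qed

lemma frame_contract_eq_0:
  assumes "coordinate_frame x e" "\<And>i. contract (e i) v = 0"
  shows "v = 0"
  by (rule det_nonzero_kernel[OF frame_det_nonzero(1)[OF assms(1)]])
     (use assms(2) in \<open>simp add: contract_3\<close>)

lemma coframe_contract_eq_0:
  assumes "coordinate_frame x e" "\<And>i. contract v (differential (x $ i)) = 0"
  shows "v = 0"
  by (rule det_nonzero_kernel[OF frame_det_nonzero(2)[OF assms(1)]])
     (use assms(2) in \<open>simp add: contract_3 mult.commute\<close>)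

lemma contract_add_right: "contract a (b + c) = contract a b + contract a c"
  and contract_diff_right: "contract a (b - c) = contract a b - contract a c"
  and contract_diff_left: "contract (a - b) c = contract a c - contract b c"
  and contract_smult_right: "contract a (k *s b) = k * contract a b"
  and contract_smult_left: "contract (k *s a) b = k * contract a b"
  by (simp_all add: contract_3 algebra_simps)

lemma contract_sum_right: "contract a (sum f A) = (\<Sum>i\<in>A. contract a (f i))"
  by (induction A rule: infinite_finite_induct) (auto simp: contract_add_right, simp_all add: contract_3)

lemma contract_sum_left: "contract (sum f A) b = (\<Sum>i\<in>A. contract (f i) b)"
  by (induction A rule: infinite_finite_induct) (auto simp: contract_3 algebra_simps)

lemma coframe_expansion:
  assumes e: "coordinate_frame x e"
  shows "w = (\<Sum>i\<in>UNIV. contract (e i) w *s differential (x $ i))"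
proof -
  have d: "contract (e i) (differential (x $ j)) = (if j = i then 1 else 0)" for i j
    using e by (simp add: coordinate_frame_def)
  have "w - (\<Sum>i\<in>UNIV. contract (e i) w *s differential (x $ i)) = 0"
    by (rule frame_contract_eq_0[OF e])
       (simp add: d contract_diff_right contract_sum_right contract_smult_right if_distrib cong: if_cong)
  then show ?thesis by simp
qed

text \<open>
  The Jacobian determinant is a unit because its constant term is nonzero. The dual frame consists of
  the columns of the inverse Jacobian, written with cross products.
\<close>

lemma coordinate_frame_exists:
  assumes "formal_coordinates x"
  shows "\<exists>e. coordinate_frame x e"
proof -
  let ?J = "\<chi> i. differential (x $ i)"
  have "coeff3 (det ?J) 0 = det (\<chi> i j. coeff3 (fps3_deriv j (x $ i)) 0 :: complex^3^3)"
    by (simp add: det_3 coeff3_0_mult differential_def)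
  then have "det ?J dvd 1"
    using assms by (intro unit_fps3) (simp add: formal_coordinates_def)
  then obtain u where u: "det ?J * u = 1" by (auto elim: dvdE)
  define C :: "3 \<Rightarrow> 3 \<Rightarrow> fps3^3" where "C i j = (let a = ?J $ i; b = ?J $ j in
     vector [a $ 2 * b $ 3 - a $ 3 * b $ 2, a $ 3 * b $ 1 - a $ 1 * b $ 3, a $ 1 * b $ 2 - a $ 2 * b $ 1])" for i j
  define e :: "3 \<Rightarrow> fps3^3" where
    "e i = u *s (if i = 1 then C 2 3 else if i = 2 then C 3 1 else C 1 2)" for i
  have "contract (C 2 3) (?J $ 1) = det ?J" "contract (C 3 1) (?J $ 2) = det ?J"
    "contract (C 1 2) (?J $ 3) = det ?J" "contract (C 2 3) (?J $ 2) = 0" "contract (C 2 3) (?J $ 3) = 0"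
    "contract (C 3 1) (?J $ 1) = 0" "contract (C 3 1) (?J $ 3) = 0"
    "contract (C 1 2) (?J $ 1) = 0" "contract (C 1 2) (?J $ 2) = 0"
    by (simp_all only: contract_3 det_3 C_def Let_def vector_3) (simp_all add: algebra_simps)
  then have "\<forall>i j. contract (e i) (?J $ j) = (if i = j then 1 else 0)"
    using u by (simp add: forall_3 e_def contract_smult_left mult.commute)
  then show ?thesis
    unfolding coordinate_frame_def by (intro exI[of _ e]) simp
qed

text \<open>
  If \<open>F\<close> is killed by the substitution, so are all its partial derivatives: apply the dual frame to
  \<open>subst3 x F = 0\<close> and use the chain rule. As substitution preserves constant terms, every coefficient
  of \<open>F\<close> vanishes by induction on the degree.
\<close>

lemma subst3_inj:
  assumes x: "\<And>i. coeff3 (x $ i) 0 = 0" and e: "coordinate_frame x e"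
    and "subst3 x F = 0"
  shows "F = 0"
proof -
  have deriv0: "subst3 x (fps3_deriv i F) = 0" if "subst3 x F = 0" for F i
  proof -
    have "0 = vderiv (e i) (subst3 x F)" using that by simp
    also have "\<dots> = (\<Sum>j\<in>UNIV. subst3 x (fps3_deriv j F) * vderiv (e i) (x $ j))"
      by (rule vderiv_subst3[OF x])
    also have "\<dots> = (\<Sum>j\<in>UNIV. if j = i then subst3 x (fps3_deriv j F) else 0)"
      using e by (intro sum.cong) (auto simp: vderiv_def coordinate_frame_def)
    finally show ?thesis by simp
  qed
  have "coeff3 F m = 0" if "subst3 x F = 0" "mdeg m = N" for N F m
    using that
  proof (induction N arbitrary: F m)
    case 0
    then show ?case using coeff3_subst3_0[of x F] by (simp add: mdeg_eq_0_iff)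
  next
    case (Suc N)
    then have "m \<noteq> 0" by auto
    then obtain i where "m $ i \<noteq> 0" by (auto simp: vec_eq_iff)
    then have le: "axis i 1 \<le> m" by (auto simp: less_eq_vec_def axis_def)
    define n where "n = m - axis i 1"
    have m: "m = n + axis i 1" using diff_add_multiindex[OF le] by (simp add: n_def)
    have "mdeg n = N" using Suc.prems by (simp add: m mdeg_add)
    then have "coeff3 (fps3_deriv i F) n = 0" using Suc.IH deriv0 Suc.prems(1) by blast
    then have "of_nat (Suc (n $ i)) * coeff3 F m = 0" by (simp only: coeff3_deriv m Suc_eq_plus1)
    then show ?case by (metis mult_eq_0_iff of_nat_eq_0_iff nat.distinct(1))
  qed
  then show ?thesis using assms(3) by (intro fps3_eqI) simp
qed

text \<open>
  Each monomial is divided by the first of the variables \<open>z\<^sub>1, z\<^sub>2, z\<^sub>3\<close> that occurs in it, so that it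
  contributes to exactly one of the three summands.
\<close>

lemma order_ge_Suc_decomp:
  assumes "order_ge (Suc N) F"
  obtains H where "\<And>i. order_ge N (H i)" "F = (\<Sum>i\<in>UNIV. var i * H i)"
proof -
  define H :: "3 \<Rightarrow> fps3" where "H i = Abs_fps3 (\<lambda>n.
     if i = 1 \<or> (i = 2 \<and> n $ 1 = 0) \<or> (i = 3 \<and> n $ 1 = 0 \<and> n $ 2 = 0)
     then coeff3 F (n + axis i 1) else 0)" for i
  have "order_ge N (H i)" for i
    using assms by (auto simp: order_ge_def H_def mdeg_add)
  moreover have "F = (\<Sum>i\<in>UNIV. var i * H i)"
  proof (rule fps3_eqI)
    fix m :: "nat^3"
    have le: "axis i 1 \<le> m \<longleftrightarrow> m $ i \<noteq> 0" for i
      by (auto simp: less_eq_vec_def axis_def)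
    have c: "coeff3 (var i * H i) m = (if m $ i \<noteq> 0 \<and> (i = 1 \<or> (i = 2 \<and> m $ 1 = 0) \<or> (i = 3 \<and> m $ 1 = 0 \<and> m $ 2 = 0))
       then coeff3 F m else 0)" for i
    proof (cases "m $ i = 0")
      case True
      then show ?thesis by (simp add: var_def coeff3_monom_mult le del: One_nat_def)
    next
      case False
      then have "coeff3 (var i * H i) m = coeff3 (H i) (m - axis i 1)"
        by (simp only: var_def coeff3_monom_mult le) simp
      moreover have "m - axis i 1 + axis i 1 = m"
        using False le by (intro diff_add_multiindex) blast
      moreover have "(m - axis i 1) $ j = (if j = i then m $ j - 1 else m $ j)" for j
        by (simp add: axis_def)
      ultimately show ?thesis
        using False by (simp only: H_def coeff3_Abs_fps3) auto
    qed
    have "coeff3 F m = 0" if "m = 0" using assms that by (simp add: order_ge_def)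
    then show "coeff3 F m = coeff3 (\<Sum>i\<in>UNIV. var i * H i) m"
      by (auto simp: sum_3 c fps_nth_vec_zero_iff)
  qed
  ultimately show ?thesis using that by blast
qed

lemma mdeg_less_2_cases: "mdeg m < 2 \<Longrightarrow> m = 0 \<or> (\<exists>i. m = axis i 1)"
proof (cases "m = 0")
  case False
  assume m: "mdeg m < 2"
  obtain i where "m $ i \<noteq> 0" using False by (auto simp: vec_eq_iff)
  then have "m = axis i 1"
    using m exhaust_3[of i] by (auto simp: mdeg_def sum_3 vec_eq_iff forall_3 axis_def)
  then show ?thesis by blast
qed simp

lemma order_ge_2_iff:
  "order_ge 2 F \<longleftrightarrow> coeff3 F 0 = 0 \<and> (\<forall>i. coeff3 F (axis i 1) = 0)"
proof
  assume "order_ge 2 F"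
  then show "coeff3 F 0 = 0 \<and> (\<forall>i. coeff3 F (axis i 1) = 0)"
    by (auto simp: order_ge_def)
next
  assume "coeff3 F 0 = 0 \<and> (\<forall>i. coeff3 F (axis i 1) = 0)"
  then show "order_ge 2 F"
    unfolding order_ge_def using mdeg_less_2_cases by metis
qed

lemma coeff3_var: "coeff3 (var i) m = (if m = axis i 1 then 1 else 0)"
  by (simp add: var_def coeff3_monom_fps3)

lemma axis_1_eq_iff: "axis i (1::nat) = axis j 1 \<longleftrightarrow> i = (j::3)"
  by (auto simp: axis_def vec_eq_iff split: if_splits)

text \<open>
  In degree one the substitution is given by the invertible linear part of \<open>x\<close>, which provides linear
  forms \<open>l\<^sub>k\<close> with \<open>subst3 x l\<^sub>k = z\<^sub>k\<close> up to order two. Higher degrees follow by writing \<open>F\<close> as a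
  combination of the variables.
\<close>

lemma subst3_graded_surj:
  assumes fc: "formal_coordinates x" and "order_ge N F"
  shows "\<exists>G. order_ge N G \<and> order_ge (Suc N) (F - subst3 x G)"
  using assms(2)
proof (induction N arbitrary: F)
  case 0
  show ?case
    by (rule exI[of _ "const3 (coeff3 F 0)"])
       (auto simp: order_ge_def mdeg_eq_0_iff subst3_const coeff3_const3)
next
  case (Suc N)
  have x: "\<And>i. coeff3 (x $ i) 0 = 0" using fc by (simp add: formal_coordinates_def)
  let ?J = "\<chi> i j. coeff3 (fps3_deriv j (x $ i)) 0 :: complex^3^3"
  have "invertible ?J" using fc by (simp add: formal_coordinates_def invertible_det_nz)
  then obtain B where B: "B ** ?J = mat 1" by (auto simp: invertible_def)
  define l where "l k = (\<Sum>i\<in>UNIV. const3 (B $ k $ i) * var i)" for k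
  have l_subst: "subst3 x (l k) = (\<Sum>i\<in>UNIV. const3 (B $ k $ i) * x $ i)" for k
    by (simp add: l_def subst3_sum subst3_const_mult subst3_var[OF x])
  have l1: "order_ge 1 (l k)" for k
    by (simp add: order_ge_1_iff l_def coeff3_var vec_eq_iff axis_def del: One_nat_def)
  have l2: "order_ge 2 (var k - subst3 x (l k))" for k
  proof -
    have "(\<Sum>i\<in>UNIV. B $ k $ i * coeff3 (x $ i) (axis j 1)) = (if k = j then 1 else 0)" for j
    proof -
      have "(B ** ?J) $ k $ j = (\<Sum>i\<in>UNIV. B $ k $ i * coeff3 (x $ i) (axis j 1))"
        by (simp add: matrix_matrix_mult_def)
      moreover have "(B ** ?J) $ k $ j = (if k = j then 1 else 0)"
        unfolding B by (simp add: mat_def)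
      ultimately show ?thesis by (simp only:)
    qed
    then show ?thesis
      by (simp add: order_ge_2_iff l_subst x coeff3_var axis_1_eq_iff del: One_nat_def)
  qed
  obtain H where H: "\<And>i. order_ge N (H i)" and F: "F = (\<Sum>i\<in>UNIV. var i * H i)"
    using order_ge_Suc_decomp[OF Suc.prems] by metis
  obtain G where G: "\<And>i. order_ge N (G i)" "\<And>i. order_ge (Suc N) (H i - subst3 x (G i))"
    using Suc.IH[OF H] by metis
  have "order_ge (Suc (Suc N)) (var i * H i - subst3 x (l i * G i))" for i
  proof -
    have "var i * H i - subst3 x (l i * G i)
        = (var i - subst3 x (l i)) * H i + subst3 x (l i) * (H i - subst3 x (G i))"
      by (simp add: subst3_mult[OF x] algebra_simps)
    moreover have "order_ge (2 + N) ((var i - subst3 x (l i)) * H i)"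
      by (intro order_ge_mult l2 H)
    moreover have "order_ge (1 + Suc N) (subst3 x (l i) * (H i - subst3 x (G i)))"
      by (intro order_ge_mult order_ge_subst3 l1 G)
    ultimately show ?thesis by (simp add: order_ge_add)
  qed
  then have "order_ge (Suc (Suc N)) (F - subst3 x (\<Sum>i\<in>UNIV. l i * G i))"
    by (simp add: F subst3_sum sum_subtractf[symmetric] order_ge_sum)
  moreover have "order_ge (1 + N) (\<Sum>i\<in>UNIV. l i * G i)"
    by (intro order_ge_sum order_ge_mult l1 G)
  ultimately show ?case by (metis plus_1_eq_Suc)
qed

lemma subst3_surj:
  assumes "formal_coordinates x"
  shows "\<exists>G. subst3 x G = F"
  using graded_surj_imp_surj[of "subst3 x" 0 F] subst3_graded_surj[OF assms]
  by (auto simp: subst3_add order_ge_subst3)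

section \<open>Formal linearisation without resonances\<close>

definition nonresonant :: "complex^3 \<Rightarrow> bool" where
  "nonresonant \<alpha> \<longleftrightarrow> (\<forall>l :: int^3. (\<Sum>i\<in>UNIV. of_int (l $ i) * \<alpha> $ i) = 0 \<longrightarrow> l = 0)"

text \<open>
  The eigenvalue of the monomial with exponent \<open>m\<close> under the field \<open>\<Sum>i. \<alpha>\<^sub>i x\<^sub>i \<partial>/\<partial>x\<^sub>i\<close>.
\<close>

definition weight :: "complex^3 \<Rightarrow> nat^3 \<Rightarrow> complex" where
  "weight \<alpha> m = (\<Sum>i\<in>UNIV. of_nat (m $ i) * \<alpha> $ i)"

lemma weight_axis: "weight \<alpha> (axis i 1) = \<alpha> $ i"
proof -
  have "weight \<alpha> (axis i 1) = (\<Sum>j\<in>UNIV. if j = i then \<alpha> $ j else 0)"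
    unfolding weight_def by (rule sum.cong) (auto simp: axis_def)
  then show ?thesis by simp
qed

lemma weight_inj:
  assumes "nonresonant \<alpha>" "weight \<alpha> m = weight \<alpha> n"
  shows "m = n"
proof -
  let ?l = "\<chi> i. int (m $ i) - int (n $ i)"
  have "(\<Sum>i\<in>UNIV. of_int (?l $ i) * \<alpha> $ i) = 0"
    using assms(2) by (simp add: weight_def left_diff_distrib sum_subtractf)
  then have "?l = 0" using assms(1) by (auto simp: nonresonant_def)
  then show ?thesis by (simp add: vec_eq_iff)
qed

lemma nonresonant_nonzero: "nonresonant \<alpha> \<Longrightarrow> \<alpha> $ i \<noteq> 0"
proof
  assume nr: "nonresonant \<alpha>" and "\<alpha> $ i = 0"
  then have "weight \<alpha> (axis i 1) = weight \<alpha> 0"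
    unfolding weight_axis by (simp add: weight_def)
  then have "axis i (1::nat) = 0" by (rule weight_inj[OF nr])
  then have "axis i (1::nat) $ i = (0 :: nat^3) $ i" by (simp only:)
  then show False by (simp add: axis_def)
qed

lemma nonresonant_inj: "nonresonant \<alpha> \<Longrightarrow> \<alpha> $ i = \<alpha> $ j \<Longrightarrow> i = j"
  using weight_inj[of \<alpha> "axis i 1" "axis j 1"] by (simp add: weight_axis axis_1_eq_iff del: One_nat_def)

text \<open>
  The vector field \<open>\<Sum>i. \<alpha>\<^sub>i z\<^sub>i \<partial>/\<partial>z\<^sub>i\<close>, acting as a derivation.
\<close>

definition euler :: "complex^3 \<Rightarrow> fps3 \<Rightarrow> fps3" where
  "euler \<alpha> F = (\<Sum>i\<in>UNIV. const3 (\<alpha> $ i) * (var i * fps3_deriv i F))"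

lemma coeff3_euler: "coeff3 (euler \<alpha> F) m = weight \<alpha> m * coeff3 F m"
proof -
  have "coeff3 (var i * fps3_deriv i F) m = of_nat (m $ i) * coeff3 F m" for i
  proof (cases "m $ i = 0")
    case True
    then have "\<not> axis i 1 \<le> m" by (auto simp: less_eq_vec_def axis_def intro!: exI[of _ i])
    then show ?thesis using True by (simp add: var_def coeff3_monom_mult del: One_nat_def)
  next
    case False
    then have le: "axis i 1 \<le> m" by (auto simp: less_eq_vec_def axis_def)
    have "(m - axis i 1) $ i + 1 = m $ i" using False by (simp add: axis_def)
    then show ?thesis
      using le by (simp only: var_def coeff3_monom_mult coeff3_deriv diff_add_multiindex[OF le]) simp
  qed
  then show ?thesis
    unfolding euler_def weight_def coeff3_sum coeff3_const3_mult sum_distrib_right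
    by (simp add: mult.assoc mult.left_commute)
qed

lemma vderiv_subst3_euler:
  assumes x: "\<And>i. coeff3 (x $ i) 0 = 0" and eig: "\<And>i. vderiv \<xi> (x $ i) = const3 (\<alpha> $ i) * x $ i"
  shows "vderiv \<xi> (subst3 x F) = subst3 x (euler \<alpha> F)"
  unfolding vderiv_subst3[OF x] euler_def subst3_sum subst3_const_mult subst3_mult[OF x] subst3_var[OF x] eig
  by (simp add: mult_ac)

lemma det_0_kernel:
  fixes A :: "complex^3^3"
  assumes "det A = 0"
  shows "\<exists>v. v \<noteq> 0 \<and> (\<forall>k. (\<Sum>j\<in>UNIV. v $ j * A $ j $ k) = 0)"
proof -
  have "\<not> invertible (transpose A)" using assms by (simp add: invertible_det_nz)
  then obtain v where "v \<noteq> 0" "transpose A *v v = 0"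
    by (meson invertible_left_inverse matrix_left_invertible_ker)
  then show ?thesis
    by (auto simp: vec_eq_iff matrix_vector_mult_def transpose_def mult.commute intro!: exI[of _ v])
qed

text \<open>
  Left eigenvectors to distinct eigenvalues are independent, so they are the rows of an invertible
  matrix. They are the linear parts of the linearising coordinates.
\<close>

lemma left_eigenbasis:
  fixes A :: "complex^3^3"
  assumes ev: "eigenvalues_of A \<alpha>" and inj: "\<And>i j. \<alpha> $ i = \<alpha> $ j \<Longrightarrow> i = j"
  shows "\<exists>V :: complex^3^3. det V \<noteq> 0 \<and> (\<forall>i k. (\<Sum>j\<in>UNIV. V $ i $ j * A $ j $ k) = \<alpha> $ i * V $ i $ k)"
proof -
  have "\<exists>v. v \<noteq> 0 \<and> (\<forall>k. (\<Sum>j\<in>UNIV. v $ j * A $ j $ k) = \<alpha> $ i * v $ k)" for i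
  proof -
    have "det (mat (\<alpha> $ i) - A) = (\<Prod>j\<in>UNIV. (\<alpha> $ i - \<alpha> $ j))"
      using ev by (simp add: eigenvalues_of_def)
    also have "\<dots> = 0" by (intro prod_zero) auto
    finally obtain v where v: "v \<noteq> 0"
      and "\<forall>k. (\<Sum>j\<in>UNIV. v $ j * (mat (\<alpha> $ i) - A) $ j $ k) = 0"
      using det_0_kernel by blast
    then have *: "(\<Sum>j\<in>UNIV. v $ j * mat (\<alpha> $ i) $ j $ k) = (\<Sum>j\<in>UNIV. v $ j * A $ j $ k)" for k
      by (simp add: right_diff_distrib sum_subtractf)
    have "(\<Sum>j\<in>UNIV. v $ j * mat (\<alpha> $ i) $ j $ k) = (\<Sum>j\<in>UNIV. if j = k then \<alpha> $ i * v $ k else 0)" for k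
      by (rule sum.cong) (auto simp: mat_def)
    then show ?thesis using v * by (auto intro!: exI[of _ v])
  qed
  then obtain v where v: "\<And>i. v i \<noteq> 0" "\<And>i k. (\<Sum>j\<in>UNIV. v i $ j * A $ j $ k) = \<alpha> $ i * v i $ k"
    by metis
  define V where "V = (\<chi> i. v i)"
  \<comment> \<open>\<open>K d\<close>: linear relation with coefficients \<open>d\<close>. Applying \<open>A - \<beta>\<close> to a relation yields another one.\<close>
  define K where "K d \<longleftrightarrow> (\<forall>k. (\<Sum>i\<in>UNIV. d i * v i $ k) = 0)" for d
  have Kstep: "K (\<lambda>i. (\<alpha> $ i - \<beta>) * d i)" if "K d" for d \<beta>
    unfolding K_def
  proof
    fix k
    have "(\<Sum>i\<in>UNIV. \<alpha> $ i * d i * v i $ k) = (\<Sum>i\<in>UNIV. \<Sum>j\<in>UNIV. d i * v i $ j * A $ j $ k)"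
      by (simp add: v(2) sum_distrib_left[symmetric] mult.assoc mult.left_commute)
    also have "\<dots> = (\<Sum>j\<in>UNIV. (\<Sum>i\<in>UNIV. d i * v i $ j) * A $ j $ k)"
      by (subst sum.swap) (simp add: sum_distrib_right)
    also have "\<dots> = 0" using that by (simp add: K_def)
    finally have "(\<Sum>i\<in>UNIV. \<alpha> $ i * d i * v i $ k) = 0" .
    moreover have "(\<Sum>i\<in>UNIV. \<beta> * d i * v i $ k) = 0"
      using that by (simp add: K_def mult.assoc sum_distrib_left[symmetric])
    ultimately show "(\<Sum>i\<in>UNIV. (\<alpha> $ i - \<beta>) * d i * v i $ k) = 0"
      by (simp add: left_diff_distrib sum_subtractf)
  qed
  have "det V \<noteq> 0"
  proof
    assume "det V = 0"
    then obtain c where c: "c \<noteq> 0" "K (\<lambda>i. c $ i)"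
      using det_0_kernel[of V] by (auto simp: V_def K_def)
    have "c $ i = 0" if ij: "i \<noteq> j" "i \<noteq> l" "j \<noteq> l" "UNIV = {i, j, l}" for i j l
    proof (rule ccontr)
      assume ci: "c $ i \<noteq> 0"
      have "K (\<lambda>n. (\<alpha> $ n - \<alpha> $ j) * ((\<alpha> $ n - \<alpha> $ l) * c $ n))"
        by (intro Kstep c)
      then have *: "(\<Sum>n\<in>UNIV. (\<alpha> $ n - \<alpha> $ j) * ((\<alpha> $ n - \<alpha> $ l) * c $ n) * v n $ k) = 0" for k
        unfolding K_def by blast
      have "(\<alpha> $ i - \<alpha> $ j) * ((\<alpha> $ i - \<alpha> $ l) * c $ i) * v i $ k = 0" for k
        using *[of k] ij(1-3) unfolding ij(4) by simp
      then have "v i $ k = 0" for k using ci inj[of i j] inj[of i l] ij(1,2) by auto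
      then show False using v(1)[of i] by (simp add: vec_eq_iff)
    qed
    note z = this
    have U: "UNIV = {1, 2, 3 :: 3}" "UNIV = {2, 1, 3 :: 3}" "UNIV = {3, 1, 2 :: 3}"
      using UNIV_3 by auto
    have "c $ 1 = 0" by (rule z[OF _ _ _ U(1)]) simp_all
    moreover have "c $ 2 = 0" by (rule z[OF _ _ _ U(2)]) simp_all
    moreover have "c $ 3 = 0" by (rule z[OF _ _ _ U(3)]) simp_all
    ultimately have "c = 0" by (simp add: vec_eq_iff forall_3)
    then show False using c by simp
  qed
  then show ?thesis using v(2) by (intro exI[of _ V]) (simp add: V_def)
qed

text \<open>
  Start from the linear coordinates \<open>l\<close> that diagonalise the linear part; they satisfy the equation up
  to order two. The error is removed by solving \<open>\<xi>(G) - \<alpha>\<^sub>i G = F\<close> for \<open>F\<close> of order at least two. In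
  degree \<open>N\<close> and up to higher order the operator on the left multiplies the coefficient of \<open>l\<^sup>m\<close> by \<open>weight \<alpha> m - \<alpha>\<^sub>i\<close>,
  which is nonzero for \<open>mdeg m = N \<ge> 2\<close> because there are no resonances.
\<close>

theorem formal_linearisation:
  assumes \<xi>0: "\<And>j. coeff3 (\<xi> $ j) 0 = 0"
    and ev: "eigenvalues_of (\<chi> i j. coeff3 (fps3_deriv j (\<xi> $ i)) 0) \<alpha>"
    and nr: "nonresonant \<alpha>"
  shows "\<exists>x. formal_coordinates x \<and> (\<forall>i. vderiv \<xi> (x $ i) = const3 (\<alpha> $ i) * x $ i)"
proof -
  let ?A = "\<chi> i j. coeff3 (fps3_deriv j (\<xi> $ i)) 0"
  obtain V :: "complex^3^3" where V: "det V \<noteq> 0" "\<And>i k. (\<Sum>j\<in>UNIV. V $ i $ j * ?A $ j $ k) = \<alpha> $ i * V $ i $ k"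
    using left_eigenbasis[OF ev nonresonant_inj[OF nr]] by blast
  define l where "l = (\<chi> i. \<Sum>j\<in>UNIV. const3 (V $ i $ j) * var j)"
  have l0: "coeff3 (l $ i) 0 = 0" for i
    by (simp add: l_def coeff3_var vec_eq_iff axis_def)
  have l1: "coeff3 (l $ i) (axis k 1) = V $ i $ k" for i k
    by (simp add: l_def coeff3_var axis_1_eq_iff if_distrib cong: if_cong del: One_nat_def)
  have l_fc: "formal_coordinates l"
    using V(1) l0 l1 by (simp add: formal_coordinates_def)
  have vl: "vderiv \<xi> (l $ i) = (\<Sum>j\<in>UNIV. const3 (V $ i $ j) * \<xi> $ j)" for i
    by (simp add: vderiv_eq l_def fps3_deriv_sum fps3_deriv_const_mult fps3_deriv_var
        if_distrib cong: if_cong) (simp add: mult.commute)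
  have err: "order_ge 2 (vderiv \<xi> (l $ i) - const3 (\<alpha> $ i) * l $ i)" for i
    unfolding order_ge_2_iff using V(2)[of i] by (simp add: vl \<xi>0 l0 l1 del: One_nat_def)
  have main: "\<exists>G. order_ge 2 G \<and> vderiv \<xi> G - const3 (\<alpha> $ i) * G = F" if F: "order_ge 2 F" for F i
  proof (rule graded_surj_imp_surj[OF _ _ _ F])
    show "vderiv \<xi> (F + G) - const3 (\<alpha> $ i) * (F + G)
        = vderiv \<xi> F - const3 (\<alpha> $ i) * F + (vderiv \<xi> G - const3 (\<alpha> $ i) * G)" for F G
      by (simp add: vderiv_add algebra_simps)
    show "order_ge N (vderiv \<xi> F - const3 (\<alpha> $ i) * F)" if "order_ge N F" for N F
      by (intro order_ge_diff order_ge_vderiv order_ge_mult_left that \<xi>0)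
  next
    fix N F assume N: "2 \<le> N" and F: "order_ge N F"
    obtain M where M: "N = Suc M" using N by (cases N) auto
    obtain H where H: "order_ge N H" "order_ge (Suc N) (F - subst3 l H)"
      using subst3_graded_surj[OF l_fc F] by blast
    \<comment> \<open>The coefficients of \<open>G\<close> below order \<open>N\<close> are zero because those of \<open>H\<close> are, so no denominator
      matters there.\<close>
    define G where "G = Abs_fps3 (\<lambda>m. coeff3 H m / (weight \<alpha> m - \<alpha> $ i))"
    have GN: "order_ge N G" using H(1) by (auto simp: order_ge_def G_def)
    have GH: "euler \<alpha> G - const3 (\<alpha> $ i) * G = H"
    proof (rule fps3_eqI)
      fix m
      show "coeff3 (euler \<alpha> G - const3 (\<alpha> $ i) * G) m = coeff3 H m"
      proof (cases "mdeg m < N")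
        case True
        then show ?thesis using H(1) by (simp add: coeff3_euler G_def order_ge_def)
      next
        case False
        have "weight \<alpha> m \<noteq> weight \<alpha> (axis i 1)"
        proof
          assume "weight \<alpha> m = weight \<alpha> (axis i 1)"
          from weight_inj[OF nr this] show False using False N by simp
        qed
        then have "weight \<alpha> m - \<alpha> $ i \<noteq> 0" by (simp only: weight_axis) simp
        then show ?thesis
          by (simp only: coeff3_diff coeff3_const3_mult coeff3_euler G_def coeff3_Abs_fps3
              left_diff_distrib[symmetric]) simp
      qed
    qed
    \<comment> \<open>the difference between \<open>\<xi>\<close> and its linear part, which raises the order by one\<close>
    have "vderiv \<xi> (subst3 l G) - const3 (\<alpha> $ i) * subst3 l G - subst3 l H
        = (\<Sum>j\<in>UNIV. subst3 l (fps3_deriv j G) * (vderiv \<xi> (l $ j) - const3 (\<alpha> $ j) * l $ j))"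
      unfolding GH[symmetric] vderiv_subst3[OF l0] subst3_diff euler_def subst3_sum subst3_const_mult
        subst3_mult[OF l0] subst3_var[OF l0] right_diff_distrib sum_subtractf
      by (simp add: mult_ac)
    moreover have "order_ge (M + 2) \<dots>"
      using GN unfolding M by (intro order_ge_sum order_ge_mult order_ge_subst3 order_ge_deriv err)
    ultimately have "order_ge (Suc N) (vderiv \<xi> (subst3 l G) - const3 (\<alpha> $ i) * subst3 l G - subst3 l H)"
      by (simp add: M)
    from order_ge_diff[OF H(2) this]
    show "\<exists>G. order_ge N G \<and> order_ge (Suc N) (F - (vderiv \<xi> G - const3 (\<alpha> $ i) * G))"
      by (intro exI[of _ "subst3 l G"]) (simp add: order_ge_subst3 GN algebra_simps)
  qed
  have "\<exists>G. order_ge 2 G \<and> vderiv \<xi> G - const3 (\<alpha> $ i) * G = - (vderiv \<xi> (l $ i) - const3 (\<alpha> $ i) * l $ i)" for i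
    using order_ge_diff[OF order_ge_zero err, of i] by (intro main) simp
  then obtain G where G: "\<And>i. order_ge 2 (G i)"
     "\<And>i. vderiv \<xi> (G i) - const3 (\<alpha> $ i) * G i = - (vderiv \<xi> (l $ i) - const3 (\<alpha> $ i) * l $ i)"
    by metis
  define x where "x = (\<chi> i. l $ i + G i)"
  have "coeff3 (G i) 0 = 0" "coeff3 (G i) (axis j 1) = 0" for i j
    using G(1)[of i] by (auto simp: order_ge_2_iff)
  then have "formal_coordinates x"
    using l_fc by (simp add: formal_coordinates_def x_def)
  moreover have "vderiv \<xi> (x $ i) = const3 (\<alpha> $ i) * x $ i" for i
    using G(2)[of i] by (simp add: x_def vderiv_add algebra_simps)
  ultimately show ?thesis by blast
qed

section \<open>Logarithmic derivatives along a nonresonant diagonal field\<close>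

lemma fps_mult_nth_lowest:
  fixes f g :: "'a::comm_ring_1 fps"
  assumes "\<And>k. k < a \<Longrightarrow> fps_nth f k = 0" "\<And>k. k < b \<Longrightarrow> fps_nth g k = 0"
  shows "fps_nth (f * g) (a + b) = fps_nth f a * fps_nth g b"
proof -
  have "fps_nth (f * g) (a + b) = (\<Sum>i\<in>{a}. fps_nth f i * fps_nth g (a + b - i))"
    unfolding fps_mult_nth
  proof (rule sum.mono_neutral_right)
    show "\<forall>i\<in>{0..a + b} - {a}. fps_nth f i * fps_nth g (a + b - i) = 0"
    proof
      fix i assume "i \<in> {0..a + b} - {a}"
      then have "i < a \<or> a + b - i < b" by auto
      then show "fps_nth f i * fps_nth g (a + b - i) = 0" using assms by auto
    qed
  qed auto
  then show ?thesis by simp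
qed

text \<open>
  The variable \<open>z\<^sub>3\<close> is the outermost one of the iterated power series ring and is therefore compared
  first; lowest terms are then found by taking lowest coefficients three times.
\<close>

definition lex_less :: "nat^3 \<Rightarrow> nat^3 \<Rightarrow> bool" where
  "lex_less n m \<longleftrightarrow> n $ 3 < m $ 3 \<or> n $ 3 = m $ 3 \<and> (n $ 2 < m $ 2 \<or> n $ 2 = m $ 2 \<and> n $ 1 < m $ 1)"

definition lex_ge :: "fps3 \<Rightarrow> nat^3 \<Rightarrow> bool" where
  "lex_ge F m \<longleftrightarrow> (\<forall>n. lex_less n m \<longrightarrow> coeff3 F n = 0)"

lemma lex_ge_nth:
  assumes "lex_ge F m"
  shows "k < m $ 3 \<Longrightarrow> fps_nth F k = 0"
    and "j < m $ 2 \<Longrightarrow> fps_nth (fps_nth F (m $ 3)) j = 0"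
    and "i < m $ 1 \<Longrightarrow> fps_nth (fps_nth (fps_nth F (m $ 3)) (m $ 2)) i = 0"
proof -
  have *: "fps_nth (fps_nth (fps_nth F k) j) i = 0" if "lex_less (vector [i, j, k]) m" for i j k
    using assms that by (auto simp: lex_ge_def coeff3_def vector_3 dest!: spec[of _ "vector [i, j, k]"])
  show "k < m $ 3 \<Longrightarrow> fps_nth F k = 0"
    by (intro fps_ext) (simp add: * lex_less_def vector_3)
  show "j < m $ 2 \<Longrightarrow> fps_nth (fps_nth F (m $ 3)) j = 0"
    by (intro fps_ext) (simp add: * lex_less_def vector_3)
  show "i < m $ 1 \<Longrightarrow> fps_nth (fps_nth (fps_nth F (m $ 3)) (m $ 2)) i = 0"
    by (simp add: * lex_less_def vector_3)
qed

lemma coeff3_mult_lex_lowest: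
  assumes "lex_ge F m" "lex_ge G n"
  shows "coeff3 (F * G) (m + n) = coeff3 F m * coeff3 G n"
  unfolding coeff3_def
  by (simp add: fps_mult_nth_lowest lex_ge_nth[OF assms(1)] lex_ge_nth[OF assms(2)])

lemma lex_lowest_exists:
  assumes "F \<noteq> 0"
  obtains m where "lex_ge F m" "coeff3 F m \<noteq> 0"
proof -
  define c where "c = subdegree F"
  define b where "b = subdegree (fps_nth F c)"
  define a where "a = subdegree (fps_nth (fps_nth F c) b)"
  let ?m = "vector [a, b, c] :: nat^3"
  have 1: "fps_nth F c \<noteq> 0" using assms by (simp add: c_def)
  then have 2: "fps_nth (fps_nth F c) b \<noteq> 0" by (simp add: b_def)
  then have 3: "fps_nth (fps_nth (fps_nth F c) b) a \<noteq> 0" by (simp add: a_def)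
  have "coeff3 F ?m \<noteq> 0" using 3 by (simp add: coeff3_def vector_3)
  moreover have "lex_ge F ?m"
    unfolding lex_ge_def
  proof (intro allI impI)
    fix n assume "lex_less n ?m"
    then consider "n $ 3 < c" | "n $ 3 = c" "n $ 2 < b" | "n $ 3 = c" "n $ 2 = b" "n $ 1 < a"
      by (auto simp: lex_less_def vector_3)
    then show "coeff3 F n = 0"
    proof cases
      case 1
      then have "fps_nth F (n $ 3) = 0" unfolding c_def by (rule nth_less_subdegree_zero)
      then show ?thesis by (simp add: coeff3_def)
    next
      case 2
      then have "fps_nth (fps_nth F c) (n $ 2) = 0" unfolding b_def by (intro nth_less_subdegree_zero)
      then show ?thesis by (simp add: coeff3_def 2)
    next
      case 3
      then have "fps_nth (fps_nth (fps_nth F c) b) (n $ 1) = 0"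
        unfolding a_def by (intro nth_less_subdegree_zero)
      then show ?thesis by (simp add: coeff3_def 3)
    qed
  qed
  ultimately show ?thesis using that by blast
qed

text \<open>
  Let \<open>M\<close> be the lowest exponent of \<open>g\<close>, and subtract from \<open>h\<close> the multiple of \<open>g\<close> with the same
  coefficient at \<open>M\<close>. The difference \<open>k\<close> still satisfies the equation. If \<open>k\<close> had a lowest term, at exponent \<open>N\<close>, then the
  lowest terms of the two products would give \<open>weight \<alpha> N = weight \<alpha> M\<close>, hence \<open>N = M\<close>, where the
  coefficient of \<open>k\<close> was made zero.
\<close>

lemma euler_wronskian_eq_0:
  assumes nr: "nonresonant \<alpha>" and "g \<noteq> 0" and eq: "g * euler \<alpha> h = h * euler \<alpha> g"
  shows "\<exists>c. h = const3 c * g"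
proof -
  obtain M where M: "lex_ge g M" "coeff3 g M \<noteq> 0" using lex_lowest_exists[OF \<open>g \<noteq> 0\<close>] .
  define c where "c = coeff3 h M / coeff3 g M"
  define k where "k = h - const3 c * g"
  have lin: "euler \<alpha> k = euler \<alpha> h - const3 c * euler \<alpha> g"
    by (rule fps3_eqI) (simp add: coeff3_euler k_def right_diff_distrib mult.left_commute)
  have k_eq: "g * euler \<alpha> k = k * euler \<alpha> g"
    unfolding lin using eq by (simp add: k_def algebra_simps)
  have "k = 0"
  proof (rule ccontr)
    assume "k \<noteq> 0"
    then obtain N where N: "lex_ge k N" "coeff3 k N \<noteq> 0" using lex_lowest_exists by blast
    have le: "lex_ge (euler \<alpha> F) m" if "lex_ge F m" for F m
      using that by (simp add: lex_ge_def coeff3_euler)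
    have "coeff3 (g * euler \<alpha> k) (M + N) = coeff3 (k * euler \<alpha> g) (N + M)"
      by (simp add: k_eq add.commute)
    then have "coeff3 g M * (weight \<alpha> N * coeff3 k N) = coeff3 k N * (weight \<alpha> M * coeff3 g M)"
      by (simp only: coeff3_mult_lex_lowest M N le coeff3_euler)
    then have "weight \<alpha> N = weight \<alpha> M" using M(2) N(2) by simp
    then have "N = M" by (rule weight_inj[OF nr])
    then show False using N(2) M(2) by (simp add: k_def c_def)
  qed
  then show ?thesis by (auto simp: k_def)
qed

section \<open>The formal normal form\<close>

text \<open>
  The components of \<open>dw\<close>.
\<close>

definition curl3 :: "fps3^3 \<Rightarrow> 3 \<Rightarrow> 3 \<Rightarrow> fps3" where
  "curl3 w i j = fps3_deriv i (w $ j) - fps3_deriv j (w $ i)"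

text \<open>
  The coefficients of the Lie derivative of the form \<open>w\<close> along \<open>\<xi>\<close>.
\<close>

definition lie_deriv :: "fps3^3 \<Rightarrow> fps3^3 \<Rightarrow> fps3^3" where
  "lie_deriv \<xi> w = (\<chi> j. vderiv \<xi> (w $ j) + (\<Sum>k\<in>UNIV. w $ k * fps3_deriv j (\<xi> $ k)))"

text \<open>
  Cartan's formula gives \<open>L\<^sub>\<xi>w = i\<^sub>\<xi>dw\<close> since \<open>i\<^sub>\<xi>w = 0\<close>, and contracting \<open>w \<and> dw = 0\<close> with \<open>\<xi>\<close>
  gives \<open>w \<and> i\<^sub>\<xi>dw = 0\<close>.
\<close>

lemma lie_deriv_parallel:
  assumes inv: "contract w \<xi> = 0"
    and int: "w $ 1 * curl3 w 2 3 + w $ 2 * curl3 w 3 1 + w $ 3 * curl3 w 1 2 = 0"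
  shows "w $ i * lie_deriv \<xi> w $ j = w $ j * lie_deriv \<xi> w $ i"
proof -
  let ?c = "curl3 w"
  have L: "lie_deriv \<xi> w $ j = (\<Sum>k\<in>UNIV. \<xi> $ k * ?c k j)" for j
  proof -
    have "(\<Sum>k\<in>UNIV. fps3_deriv j (w $ k) * \<xi> $ k + w $ k * fps3_deriv j (\<xi> $ k)) = fps3_deriv j (contract w \<xi>)"
      by (simp add: contract_def fps3_deriv_sum fps3_deriv_mult)
    then have "(\<Sum>k\<in>UNIV. w $ k * fps3_deriv j (\<xi> $ k)) = - (\<Sum>k\<in>UNIV. \<xi> $ k * fps3_deriv j (w $ k))"
      by (simp add: inv sum.distrib mult.commute eq_neg_iff_add_eq_0 add.commute)
    then show ?thesis
      by (simp add: lie_deriv_def vderiv_eq curl3_def right_diff_distrib sum_subtractf)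
  qed
  have anti: "?c i j = - ?c j i" and anti0: "?c i i = 0" for i j by (simp_all add: curl3_def)
  have inv': "w $ 1 * \<xi> $ 1 + w $ 2 * \<xi> $ 2 + w $ 3 * \<xi> $ 3 = 0"
    using inv by (simp add: contract_3)
  have "w $ 1 * lie_deriv \<xi> w $ 2 - w $ 2 * lie_deriv \<xi> w $ 1
      = ?c 1 2 * (w $ 1 * \<xi> $ 1 + w $ 2 * \<xi> $ 2 + w $ 3 * \<xi> $ 3)
        - \<xi> $ 3 * (w $ 1 * ?c 2 3 + w $ 2 * ?c 3 1 + w $ 3 * ?c 1 2)"
    unfolding L sum_3 anti0 using anti[of 2 1] anti[of 3 2] by (simp add: algebra_simps)
  moreover have "w $ 2 * lie_deriv \<xi> w $ 3 - w $ 3 * lie_deriv \<xi> w $ 2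
      = ?c 2 3 * (w $ 1 * \<xi> $ 1 + w $ 2 * \<xi> $ 2 + w $ 3 * \<xi> $ 3)
        - \<xi> $ 1 * (w $ 1 * ?c 2 3 + w $ 2 * ?c 3 1 + w $ 3 * ?c 1 2)"
    unfolding L sum_3 anti0 using anti[of 1 3] anti[of 3 2] by (simp add: algebra_simps)
  moreover have "w $ 3 * lie_deriv \<xi> w $ 1 - w $ 1 * lie_deriv \<xi> w $ 3
      = ?c 3 1 * (w $ 1 * \<xi> $ 1 + w $ 2 * \<xi> $ 2 + w $ 3 * \<xi> $ 3)
        - \<xi> $ 2 * (w $ 1 * ?c 2 3 + w $ 2 * ?c 3 1 + w $ 3 * ?c 1 2)"
    unfolding L sum_3 anti0 using anti[of 2 1] anti[of 1 3] by (simp add: algebra_simps)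
  ultimately have "\<forall>i j. w $ i * lie_deriv \<xi> w $ j = w $ j * lie_deriv \<xi> w $ i"
    unfolding inv' int forall_3 by simp
  then show ?thesis by blast
qed

text \<open>
  The forms \<open>dx\<^sub>i\<close> are eigenvectors of the Lie derivative, \<open>L\<^sub>\<xi>(dx\<^sub>i) = d(\<xi>(x\<^sub>i)) = \<alpha>\<^sub>i dx\<^sub>i\<close>, and the
  product rule gives \<open>L\<^sub>\<xi>(f\<^sub>i dx\<^sub>i) = (\<xi>(f\<^sub>i) + \<alpha>\<^sub>i f\<^sub>i) dx\<^sub>i\<close>.
\<close>

lemma lie_deriv_coframe:
  assumes e: "coordinate_frame x e"
    and eig: "\<And>i. vderiv \<xi> (x $ i) = const3 (\<alpha> $ i) * x $ i"
  shows "contract (e i) (lie_deriv \<xi> w) = vderiv \<xi> (contract (e i) w) + const3 (\<alpha> $ i) * contract (e i) w"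
proof -
  define f where "f i = contract (e i) w" for i
  have w: "w $ j = (\<Sum>i\<in>UNIV. f i * fps3_deriv j (x $ i))" for j
    by (subst coframe_expansion[OF e, of w]) (simp add: f_def differential_def)
  have comm: "vderiv \<xi> (fps3_deriv j (x $ i)) + (\<Sum>k\<in>UNIV. fps3_deriv k (x $ i) * fps3_deriv j (\<xi> $ k))
      = const3 (\<alpha> $ i) * fps3_deriv j (x $ i)" for i j
  proof -
    have "fps3_deriv j (vderiv \<xi> (x $ i)) = vderiv \<xi> (fps3_deriv j (x $ i)) + (\<Sum>k\<in>UNIV. fps3_deriv k (x $ i) * fps3_deriv j (\<xi> $ k))"
      by (simp add: vderiv_eq fps3_deriv_sum fps3_deriv_mult sum.distrib fps3_deriv_commute[of j] mult.commute add.commute)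
    then show ?thesis by (simp add: eig fps3_deriv_const_mult)
  qed
  have L: "lie_deriv \<xi> w $ j = (\<Sum>i\<in>UNIV. (vderiv \<xi> (f i) + const3 (\<alpha> $ i) * f i) * fps3_deriv j (x $ i))" for j
  proof -
    have "(\<Sum>k\<in>UNIV. w $ k * fps3_deriv j (\<xi> $ k)) = (\<Sum>i\<in>UNIV. f i * (\<Sum>k\<in>UNIV. fps3_deriv k (x $ i) * fps3_deriv j (\<xi> $ k)))"
      unfolding w sum_distrib_left sum_distrib_right by (subst sum.swap) (simp add: mult.assoc)
    moreover have "vderiv \<xi> (w $ j) = (\<Sum>i\<in>UNIV. vderiv \<xi> (f i) * fps3_deriv j (x $ i) + f i * vderiv \<xi> (fps3_deriv j (x $ i)))"
      unfolding w by (simp add: vderiv_sum vderiv_mult)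
    ultimately have "lie_deriv \<xi> w $ j = (\<Sum>i\<in>UNIV. vderiv \<xi> (f i) * fps3_deriv j (x $ i) + f i * (vderiv \<xi> (fps3_deriv j (x $ i)) + (\<Sum>k\<in>UNIV. fps3_deriv k (x $ i) * fps3_deriv j (\<xi> $ k))))"
      by (simp add: lie_deriv_def sum.distrib distrib_left add.assoc)
    then show ?thesis unfolding comm by (simp add: distrib_left distrib_right mult_ac)
  qed
  then have "lie_deriv \<xi> w = (\<Sum>i\<in>UNIV. (vderiv \<xi> (f i) + const3 (\<alpha> $ i) * f i) *s differential (x $ i))"
    by (simp add: vec_eq_iff differential_def distrib_right)
  moreover have d: "contract (e i) (differential (x $ j)) = (if j = i then 1 else 0)" for i j
    using e by (simp add: coordinate_frame_def)
  ultimately have "contract (e i) (lie_deriv \<xi> w)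
      = (\<Sum>j\<in>UNIV. (vderiv \<xi> (f j) + const3 (\<alpha> $ j) * f j) * (if j = i then 1 else 0))"
    by (simp only: contract_sum_right contract_smult_right d)
  also have "\<dots> = vderiv \<xi> (f i) + const3 (\<alpha> $ i) * f i"
    by (simp add: if_distrib[of "\<lambda>t. _ * t"] cong: if_cong)
  finally show ?thesis by (simp add: f_def)
qed

text \<open>
  Everything is pulled back to series in the coordinates \<open>x\<close>, where \<open>\<xi>\<close> is the field \<open>euler \<alpha>\<close>. The
  series \<open>\<gamma>\<^sub>i\<close> represent \<open>x\<^sub>i\<close> times the coefficient of \<open>dx\<^sub>i\<close>, that is, the coefficients of \<open>w\<close> with
  respect to the logarithmic forms \<open>dx\<^sub>i/x\<^sub>i\<close>, which \<open>\<xi>\<close> leaves invariant.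
\<close>

theorem formal_normal_form:
  assumes nr: "nonresonant \<alpha>" and fc: "formal_coordinates x" and e: "coordinate_frame x e"
    and \<xi>: "\<xi> = (\<Sum>i\<in>UNIV. (const3 (\<alpha> $ i) * x $ i) *s e i)"
    and inv: "contract w \<xi> = 0"
    and int: "w $ 1 * curl3 w 2 3 + w $ 2 * curl3 w 3 1 + w $ 3 * curl3 w 1 2 = 0"
    and "w \<noteq> 0"
  shows "\<exists>G b. card {i. b $ i \<noteq> 0} \<ge> 2 \<and> w = G *s log_form {i. b $ i \<noteq> 0} b x"
proof -
  have x: "\<And>i. coeff3 (x $ i) 0 = 0" using fc by (simp add: formal_coordinates_def)
  note inj = subst3_inj[OF x e]
  \<comment> \<open>Substitution is injective, so identities between the coefficients of \<open>w\<close> become identities of series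
    in the coordinates \<open>x\<close>.\<close>
  have inj_eq: "F = G" if "subst3 x F = subst3 x G" for F G
    using inj[of "F - G"] that by (simp add: subst3_diff)
  have d: "contract (e i) (differential (x $ j)) = (if i = j then 1 else 0)" for i j
    using e by (simp add: coordinate_frame_def)
  have eig: "vderiv \<xi> (x $ i) = const3 (\<alpha> $ i) * x $ i" for i
    by (simp add: vderiv_def \<xi> contract_sum_left contract_smult_left d if_distrib cong: if_cong)
  define f where "f i = contract (e i) w" for i
  define q where "q i = contract (e i) (lie_deriv \<xi> w)" for i
  have q: "q i = vderiv \<xi> (f i) + const3 (\<alpha> $ i) * f i" for i
    unfolding q_def f_def by (rule lie_deriv_coframe[OF e eig])
  have fq: "f i * q j = f j * q i" for i j
  proof -
    have "f i * q j = (\<Sum>k\<in>UNIV. \<Sum>l\<in>UNIV. e i $ k * e j $ l * (w $ k * lie_deriv \<xi> w $ l))"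
      by (simp add: f_def q_def contract_def sum_product mult_ac)
    also have "\<dots> = (\<Sum>k\<in>UNIV. \<Sum>l\<in>UNIV. e i $ k * e j $ l * (w $ l * lie_deriv \<xi> w $ k))"
      by (simp only: lie_deriv_parallel[OF inv int])
    also have "\<dots> = f j * q i"
      by (subst sum.swap) (simp add: f_def q_def contract_def sum_product mult_ac)
    finally show ?thesis .
  qed
  have "\<forall>i. \<exists>G. subst3 x G = f i" using subst3_surj[OF fc] by blast
  then obtain \<phi> where \<phi>: "\<And>i. subst3 x (\<phi> i) = f i" by metis
  define \<gamma> where "\<gamma> i = var i * \<phi> i" for i
  have \<gamma>: "subst3 x (\<gamma> i) = x $ i * f i" for i
    by (simp add: \<gamma>_def subst3_mult[OF x] subst3_var[OF x] \<phi>)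
  have D\<gamma>: "subst3 x (euler \<alpha> (\<gamma> i)) = x $ i * q i" for i
    by (simp add: vderiv_subst3_euler[OF x eig, symmetric] \<gamma> vderiv_mult eig q algebra_simps)
  have wr: "\<gamma> i * euler \<alpha> (\<gamma> j) = \<gamma> j * euler \<alpha> (\<gamma> i)" for i j
  proof (rule inj_eq)
    have "x $ i * f i * (x $ j * q j) = x $ i * x $ j * (f i * q j)" by (simp add: mult_ac)
    also have "\<dots> = x $ j * f j * (x $ i * q i)" unfolding fq[of i j] by (simp add: mult_ac)
    finally show "subst3 x (\<gamma> i * euler \<alpha> (\<gamma> j)) = subst3 x (\<gamma> j * euler \<alpha> (\<gamma> i))"
      by (simp add: subst3_mult[OF x] \<gamma> D\<gamma>)
  qed
  have w: "w = (\<Sum>i\<in>UNIV. f i *s differential (x $ i))"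
    unfolding f_def by (rule coframe_expansion[OF e])
  have "\<exists>k. \<gamma> k \<noteq> 0"
  proof (rule ccontr)
    assume "\<not> (\<exists>k. \<gamma> k \<noteq> 0)"
    moreover have "var i \<noteq> 0" for i using coeff3_var[of i "axis i 1"] by auto
    ultimately have "\<phi> i = 0" for i by (simp add: \<gamma>_def)
    then have "f i = 0" for i by (metis \<phi> subst3_0)
    then show False using \<open>w \<noteq> 0\<close> w by simp
  qed
  then obtain k where k: "\<gamma> k \<noteq> 0" by blast
  define F where "F = \<gamma> k"
  have "\<exists>c. \<gamma> i = const3 c * F" for i
    unfolding F_def using k wr by (intro euler_wronskian_eq_0[OF nr])
  then obtain c where c: "\<And>i. \<gamma> i = const3 (c i) * F" by metis
  define b where "b = (\<chi> i. c i)"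
  have b: "\<gamma> i = const3 (b $ i) * F" for i by (simp add: b_def c)
  define S where "S = {i. b $ i \<noteq> 0}"
  have coeff_\<gamma>: "coeff3 (\<gamma> i) m = 0" if "m $ i = 0" for i m
  proof -
    have "\<not> axis i 1 \<le> m" using that by (auto simp: less_eq_vec_def axis_def intro!: exI[of _ i])
    then show ?thesis by (simp add: \<gamma>_def var_def coeff3_monom_mult del: One_nat_def)
  qed
  have F_coeff: "coeff3 F m = 0" if "i \<in> S" "m $ i = 0" for i m
    using coeff_\<gamma>[OF that(2)] that(1) by (simp add: b S_def)
  have "b $ k \<noteq> 0" using k b[of k] by auto
  \<comment> \<open>the condition \<open>i\<^sub>\<xi>w = 0\<close>, divided by \<open>F\<close>\<close>
  have sum_b: "(\<Sum>i\<in>UNIV. \<alpha> $ i * b $ i) = 0"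
  proof -
    have "contract w \<xi> = (\<Sum>i\<in>UNIV. const3 (\<alpha> $ i) * (x $ i * f i))"
      unfolding \<xi> contract_sum_right contract_smult_right f_def
      by (simp add: contract_def mult_ac)
    also have "\<dots> = subst3 x (const3 (\<Sum>i\<in>UNIV. \<alpha> $ i * b $ i) * F)"
      unfolding \<gamma>[symmetric] b by (simp add: subst3_const_mult subst3_sum const3_sum const3_mult sum_distrib_right mult.assoc)
    finally have "subst3 x (const3 (\<Sum>i\<in>UNIV. \<alpha> $ i * b $ i) * F) = 0" by (simp only: inv)
    then have "const3 (\<Sum>i\<in>UNIV. \<alpha> $ i * b $ i) * F = 0" by (rule inj)
    then have "const3 (\<Sum>i\<in>UNIV. \<alpha> $ i * b $ i) = 0" using k by (simp add: F_def)
    then show ?thesis using coeff3_const3[of _ 0] by (metis coeff3_0)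
  qed
  have card: "card S \<ge> 2"
  proof (rule ccontr)
    assume "\<not> card S \<ge> 2"
    moreover have "card S \<noteq> 0" using \<open>b $ k \<noteq> 0\<close> by (auto simp: S_def)
    ultimately have "card S = 1" by linarith
    then obtain i where i: "S = {i}" using card_1_singletonE by blast
    have "(\<Sum>j\<in>UNIV. \<alpha> $ j * b $ j) = (\<Sum>j\<in>S. \<alpha> $ j * b $ j)"
      by (rule sum.mono_neutral_right) (auto simp: S_def)
    then have "\<alpha> $ i * b $ i = 0" using sum_b i by simp
    moreover have "b $ i \<noteq> 0" using i by (auto simp: S_def)
    ultimately show False using nonresonant_nonzero[OF nr] by simp
  qed
  \<comment> \<open>the exponent of \<open>\<Prod>i\<in>S. x\<^sub>i\<close>\<close>
  define s :: "nat^3" where "s = (\<chi> i. if i \<in> S then 1 else 0)"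
  define G where "G = Abs_fps3 (\<lambda>m. coeff3 F (m + s))"
  have "F = monom_fps3 s * G"
  proof (rule fps3_eqI)
    fix m
    show "coeff3 F m = coeff3 (monom_fps3 s * G) m"
    proof (cases "s \<le> m")
      case True
      then show ?thesis by (simp add: coeff3_monom_mult G_def diff_add_multiindex)
    next
      case False
      then obtain i where "i \<in> S" "m $ i = 0"
        by (auto simp: less_eq_vec_def s_def split: if_splits)
      then show ?thesis using False F_coeff by (simp add: coeff3_monom_mult)
    qed
  qed
  moreover have "monom_fps3 s = (\<Prod>i\<in>S. var i)"
  proof -
    have "monom_fps3 s = (\<Prod>i\<in>UNIV. if i \<in> S then var i else 1)"
      unfolding monom_fps3_eq_prod s_def by (rule prod.cong) auto
    then show ?thesis by (simp add: prod.If_cases)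
  qed
  ultimately have F: "F = (\<Prod>i\<in>S. var i) * G" by simp
  have \<phi>_eq: "\<phi> i = const3 (b $ i) * (\<Prod>j\<in>S - {i}. var j) * G" for i
  proof -
    have v: "var i \<noteq> 0" using coeff3_var[of i "axis i 1"] by auto
    have "var i * \<phi> i = var i * (const3 (b $ i) * (\<Prod>j\<in>S - {i}. var j) * G)"
    proof (cases "i \<in> S")
      case True
      then show ?thesis using b[of i] unfolding \<gamma>_def F
        by (simp add: prod.remove[of S i] mult_ac)
    next
      case False
      then show ?thesis using b[of i] by (simp add: \<gamma>_def S_def)
    qed
    then show ?thesis using v by (simp only: mult_cancel_left simp_thms)
  qed
  have f_eq: "f i = const3 (b $ i) * (\<Prod>j\<in>S - {i}. x $ j) * subst3 x G" for i
    unfolding \<phi>[symmetric] \<phi>_eq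
    by (simp add: subst3_mult[OF x] subst3_const subst3_prod[OF x] subst3_var[OF x])
  have "w = (\<Sum>i\<in>S. f i *s differential (x $ i))"
    unfolding w by (rule sum.mono_neutral_right) (auto simp: S_def f_eq)
  also have "\<dots> = subst3 x G *s log_form S b x"
    by (simp add: log_form_def vec_eq_iff f_eq sum_distrib_left mult_ac)
  finally show ?thesis using card unfolding S_def by blast
qed

section \<open>Sums of convergent series\<close>

definition polydisc :: "real \<Rightarrow> (complex^3) set" where
  "polydisc \<rho> = {z. \<forall>i. norm (z $ i) < \<rho>}"

text \<open>
  Absolute convergence at the corner \<open>(\<rho>, \<rho>, \<rho>)\<close>, and hence on the closed polydisc of radius \<open>\<rho>\<close>.
\<close>

definition converges3 :: "real \<Rightarrow> fps3 \<Rightarrow> bool" where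
  "converges3 \<rho> F \<longleftrightarrow> (\<lambda>m. norm (coeff3 F m) * \<rho> ^ mdeg m) summable_on UNIV"

definition eval3 :: "fps3 \<Rightarrow> complex^3 \<Rightarrow> complex" where
  "eval3 F z = (\<Sum>\<^sub>\<infinity>m. coeff3 F m * monom3 z m)"

lemma open_polydisc: "open (polydisc \<rho>)"
proof -
  have "polydisc \<rho> = (\<Inter>i. {z. norm (z $ i) < \<rho>})" by (auto simp: polydisc_def)
  moreover have "open {z :: complex^3. norm (z $ i) < \<rho>}" for i
    by (intro open_Collect_less continuous_intros)
  ultimately show ?thesis by (simp only:) (intro open_INT, auto)
qed

lemma zero_in_polydisc: "\<rho> > 0 \<Longrightarrow> 0 \<in> polydisc \<rho>"
  by (simp add: polydisc_def)

lemma norm_less_imp_polydisc: "norm z < \<rho> \<Longrightarrow> z \<in> polydisc \<rho>"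
  using Finite_Cartesian_Product.norm_nth_le[of z] by (auto simp: polydisc_def intro: le_less_trans)

lemma polydisc_mono: "\<rho> \<le> \<rho>' \<Longrightarrow> polydisc \<rho> \<subseteq> polydisc \<rho>'"
  by (auto simp: polydisc_def intro: less_le_trans)

lemma monom3_3: "monom3 z m = z $ 1 ^ m $ 1 * z $ 2 ^ m $ 2 * z $ 3 ^ m $ 3"
  unfolding monom3_def UNIV_3 by (simp add: mult.assoc)

lemma mdeg_3: "mdeg m = m $ 1 + m $ 2 + m $ 3"
  by (simp add: mdeg_def sum_3)

lemma monom3_add: "monom3 z (m + n) = monom3 z m * monom3 z n"
  by (simp add: monom3_def power_add prod.distrib)

lemma norm_monom3_le:
  assumes "\<And>i. norm (z $ i) \<le> \<rho>"
  shows "norm (monom3 z m) \<le> \<rho> ^ mdeg m"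
proof -
  have "norm (monom3 z m) = (\<Prod>i\<in>UNIV. norm (z $ i) ^ (m $ i))"
    by (simp add: monom3_def prod_norm[symmetric] norm_power)
  also have "\<dots> \<le> (\<Prod>i\<in>UNIV. \<rho> ^ (m $ i))"
    by (intro prod_mono conjI power_mono assms) auto
  also have "\<dots> = \<rho> ^ mdeg m" by (simp add: mdeg_def power_sum)
  finally show ?thesis .
qed

lemma polydisc_norm_le: "z \<in> polydisc \<rho> \<Longrightarrow> norm (z $ i) \<le> \<rho>"
  by (auto simp: polydisc_def intro: less_imp_le)

lemma eval3_abs_summable:
  assumes "converges3 \<rho> F" "\<And>i. norm (z $ i) \<le> \<rho>"
  shows "(\<lambda>m. norm (coeff3 F m * monom3 z m)) summable_on UNIV"
  by (rule summable_on_comparison_test[OF assms(1)[unfolded converges3_def]])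
     (auto simp: norm_mult intro!: mult_left_mono norm_monom3_le assms)

lemma eval3_has_sum:
  assumes "converges3 \<rho> F" "z \<in> polydisc \<rho>"
  shows "((\<lambda>m. coeff3 F m * monom3 z m) has_sum eval3 F z) UNIV"
  unfolding eval3_def
  by (rule has_sum_infsum, rule abs_summable_summable,
      rule eval3_abs_summable[OF assms(1) polydisc_norm_le[OF assms(2)]])

lemma eval3_0: "eval3 F 0 = coeff3 F 0"
proof -
  have *: "monom3 0 m = (if m = 0 then 1 else 0)" for m
    by (auto simp: monom3_3 fps_nth_vec_zero_iff)
  have "(\<lambda>m. coeff3 F m * monom3 0 m) = (\<lambda>m. if m = 0 then coeff3 F 0 else 0)"
    by (rule ext) (simp add: *)
  then have "eval3 F 0 = (\<Sum>\<^sub>\<infinity>m::nat^3. if m = 0 then coeff3 F 0 else 0)"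
    unfolding eval3_def by (simp only:)
  also have "\<dots> = (\<Sum>\<^sub>\<infinity>m\<in>{0::nat^3}. coeff3 F 0)"
    by (rule infsum_cong_neutral) auto
  finally show ?thesis by simp
qed

lemma converges3_mono:
  assumes "converges3 \<rho> F" "0 \<le> \<rho>'" "\<rho>' \<le> \<rho>"
  shows "converges3 \<rho>' F"
  using assms(1) unfolding converges3_def
  by (rule summable_on_comparison_test) (use assms in \<open>auto intro!: mult_left_mono power_mono\<close>)

text \<open>
  Convergence at one point with equal positive coordinates is absolute and controls all points whose
  coordinates are not larger in modulus.
\<close>

lemma has_fps3_expansion_imp_eval3:
  assumes "has_fps3_expansion f F"
  shows "\<exists>\<rho>>0. converges3 \<rho> F \<and> (\<forall>z\<in>polydisc \<rho>. f z = eval3 F z)"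
proof -
  obtain d where d: "d > 0" "\<And>z. norm z < d \<Longrightarrow> ((\<lambda>m. coeff3 F m * monom3 z m) has_sum f z) UNIV"
    using assms unfolding has_fps3_expansion_def eventually_nhds_metric by (auto simp: dist_norm)
  define \<rho> where "\<rho> = d / 4"
  have small: "norm z < d" if "\<And>i. norm (z $ i) \<le> \<rho>" for z :: "complex^3"
  proof -
    have "norm z \<le> (\<Sum>i\<in>UNIV. norm (z $ i))" unfolding norm_vec_def by (intro L2_set_le_sum) auto
    also have "\<dots> \<le> 3 * \<rho>" using that[of 1] that[of 2] that[of 3] by (simp add: sum_3)
    finally show ?thesis using d(1) by (simp add: \<rho>_def)
  qed
  let ?z = "\<chi> i. complex_of_real \<rho>"
  have \<rho>: "\<rho> > 0" using d by (simp add: \<rho>_def)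
  have "((\<lambda>m. coeff3 F m * monom3 ?z m) has_sum f ?z) UNIV" using \<rho> by (intro d(2) small) simp
  from has_sum_imp_summable[OF this]
  have "(\<lambda>m. norm (coeff3 F m * monom3 ?z m)) summable_on UNIV"
    by (rule summable_on_iff_abs_summable_on_complex[THEN iffD1])
  moreover have "norm (monom3 ?z m) = \<rho> ^ mdeg m" for m
    using \<rho> by (simp add: monom3_3 mdeg_3 norm_mult norm_power power_add)
  ultimately have "converges3 \<rho> F" by (simp add: converges3_def norm_mult)
  moreover have "f z = eval3 F z" if "z \<in> polydisc \<rho>" for z
    unfolding eval3_def
    by (rule infsumI[symmetric] d(2) small polydisc_norm_le[OF that])+
  ultimately show ?thesis using \<rho> by blast
qed

lemma has_fps3_expansion_evalI:
  assumes "\<rho> > 0" "converges3 \<rho> F" "\<And>z. z \<in> polydisc \<rho> \<Longrightarrow> f z = eval3 F z"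
  shows "has_fps3_expansion f F"
  unfolding has_fps3_expansion_def eventually_nhds
  by (rule exI[of _ "polydisc \<rho>"])
     (use assms eval3_has_sum[OF assms(2)] in \<open>auto simp: open_polydisc zero_in_polydisc\<close>)

lemma converges3_add:
  assumes "converges3 \<rho> F" "converges3 \<rho> G" "0 \<le> \<rho>"
  shows "converges3 \<rho> (F + G)"
proof -
  have "(\<lambda>m. norm (coeff3 F m) * \<rho> ^ mdeg m + norm (coeff3 G m) * \<rho> ^ mdeg m) summable_on UNIV"
    by (intro summable_on_add assms[unfolded converges3_def])
  then show ?thesis
    unfolding converges3_def
    by (rule summable_on_comparison_test)
       (use assms(3) in \<open>auto simp: distrib_right[symmetric] intro!: mult_right_mono norm_triangle_ineq\<close>)
qed

lemma eval3_add:
  assumes "converges3 \<rho> F" "converges3 \<rho> G" "z \<in> polydisc \<rho>"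
  shows "eval3 (F + G) z = eval3 F z + eval3 G z"
proof -
  have "((\<lambda>m. coeff3 F m * monom3 z m + coeff3 G m * monom3 z m) has_sum (eval3 F z + eval3 G z)) UNIV"
    by (intro has_sum_add eval3_has_sum[OF _ assms(3)] assms)
  then show ?thesis
    unfolding eval3_def[of "F + G"] by (intro infsumI) (simp add: distrib_right)
qed

lemma converges3_const_mult: "converges3 \<rho> F \<Longrightarrow> converges3 \<rho> (const3 c * F)"
  unfolding converges3_def using summable_on_cmult_right[of "\<lambda>m. norm (coeff3 F m) * \<rho> ^ mdeg m" UNIV "norm c"]
  by (simp add: norm_mult mult.assoc)

lemma eval3_const_mult: "eval3 (const3 c * F) z = c * eval3 F z"
  unfolding eval3_def by (simp add: mult.assoc infsum_cmult_right')

lemma diff_eq_add_const_mult: "F - G = F + const3 (-1) * G"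
  by (rule fps3_eqI) simp

lemma converges3_diff: "converges3 \<rho> F \<Longrightarrow> converges3 \<rho> G \<Longrightarrow> 0 \<le> \<rho> \<Longrightarrow> converges3 \<rho> (F - G)"
  unfolding diff_eq_add_const_mult by (intro converges3_add converges3_const_mult)

lemma eval3_diff:
  assumes "converges3 \<rho> F" "converges3 \<rho> G" "z \<in> polydisc \<rho>"
  shows "eval3 (F - G) z = eval3 F z - eval3 G z"
  unfolding diff_eq_add_const_mult
  using eval3_add[OF assms(1) converges3_const_mult[OF assms(2)] assms(3), of "-1"]
  by (simp add: eval3_const_mult)

lemma converges3_finite:
  assumes "finite {m. coeff3 F m \<noteq> 0}"
  shows "converges3 \<rho> F"
  unfolding converges3_def
  by (rule summable_on_cong_neutral[where S = "{m. coeff3 F m \<noteq> 0}" and T = UNIV, THEN iffD1])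
     (use assms in auto)

text \<open>
  The double family \<open>a\<^sub>n b\<^sub>k\<close> is summable; summing it along the finite fibres \<open>n + k = m\<close> gives the
  Cauchy product.
\<close>

lemma mult_has_sum3:
  assumes F: "(\<lambda>m. norm (a m)) summable_on UNIV" and G: "(\<lambda>m. norm (b m)) summable_on UNIV"
  shows "((\<lambda>m. \<Sum>n | n \<le> m. a n * b (m - n)) has_sum ((\<Sum>\<^sub>\<infinity>m. a m) * (\<Sum>\<^sub>\<infinity>m. b m))) (UNIV :: (nat^3) set)"
    (is "(?c has_sum _) _")
    and "(\<lambda>m. norm (\<Sum>n | n \<le> m. a n * b (m - n) :: complex)) summable_on UNIV"
proof -
  let ?A = "SIGMA m : UNIV. {n. n \<le> (m :: nat^3)}"
  have bij: "bij_betw (\<lambda>(m, n). (n, m - n)) ?A UNIV"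
    by (rule bij_betwI[of _ _ _ "\<lambda>(n, k). (n + k, n)"])
       (auto simp: less_eq_vec_def vec_eq_iff)
  have s: "(\<lambda>x. norm (case x of (n, k) \<Rightarrow> a n * b k)) summable_on (UNIV \<times> UNIV)"
  proof -
    have "(\<lambda>(n, k). norm (a n) * norm (b k)) summable_on (UNIV \<times> UNIV)"
      by (rule summable_on_SigmaI[where g = "\<lambda>n. norm (a n) * (\<Sum>\<^sub>\<infinity>k. norm (b k))"])
         (auto intro!: has_sum_cmult_right has_sum_infsum G summable_on_cmult_left F mult_nonneg_nonneg)
    then show ?thesis by (simp add: norm_mult case_prod_unfold)
  qed
  have s': "(\<lambda>x. norm (case x of (n, k) \<Rightarrow> a n * b k)) summable_on UNIV" using s by simp
  have sA: "(\<lambda>x. norm (case x of (m, n) \<Rightarrow> a n * b (m - n))) summable_on ?A"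
    using s' summable_on_reindex_bij_betw[OF bij, of "\<lambda>x. norm (case x of (n, k) \<Rightarrow> a n * b k)"]
    by (simp add: case_prod_unfold)
  have "((\<lambda>(n, k). a n * b k) has_sum (\<Sum>\<^sub>\<infinity>m. a m) * (\<Sum>\<^sub>\<infinity>m. b m)) (UNIV \<times> UNIV)"
  proof -
    have "(\<Sum>\<^sub>\<infinity>(n, k)\<in>UNIV \<times> UNIV. a n * b k) = (\<Sum>\<^sub>\<infinity>m. a m) * (\<Sum>\<^sub>\<infinity>m. b m)"
      using s infsum_Sigma'_banach[of "\<lambda>n k. a n * b k" UNIV "\<lambda>_. UNIV"] abs_summable_summable[OF s]
      by (simp add: infsum_cmult_right' infsum_cmult_left')
    then show ?thesis using has_sum_infsum[OF abs_summable_summable[OF s]] by simp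
  qed
  then have "((\<lambda>(m, n). a n * b (m - n)) has_sum (\<Sum>\<^sub>\<infinity>m. a m) * (\<Sum>\<^sub>\<infinity>m. b m)) ?A"
    using has_sum_reindex_bij_betw[OF bij, of "\<lambda>(n, k). a n * b k"] by (simp add: case_prod_unfold)
  then show "(?c has_sum (\<Sum>\<^sub>\<infinity>m. a m) * (\<Sum>\<^sub>\<infinity>m. b m)) UNIV"
    by (rule has_sum_SigmaD[of "\<lambda>(m, n). a n * b (m - n)"]) (auto intro: has_sum_finite)
  have "((\<lambda>(m, n). norm (a n * b (m - n))) has_sum (\<Sum>\<^sub>\<infinity>x\<in>?A. norm (case x of (m, n) \<Rightarrow> a n * b (m - n)))) ?A"
    using has_sum_infsum[OF sA] by (simp add: case_prod_unfold)
  then have "((\<lambda>m. \<Sum>n | n \<le> m. norm (a n * b (m - n))) has_sum (\<Sum>\<^sub>\<infinity>x\<in>?A. norm (case x of (m, n) \<Rightarrow> a n * b (m - n)))) UNIV"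
    by (rule has_sum_SigmaD[of "\<lambda>(m, n). norm (a n * b (m - n))"]) (auto intro: has_sum_finite)
  then have "(\<lambda>m. \<Sum>n | n \<le> m. norm (a n * b (m - n))) summable_on UNIV"
    by (rule has_sum_imp_summable)
  then show "(\<lambda>m. norm (\<Sum>n | n \<le> m. a n * b (m - n))) summable_on UNIV"
    by (rule summable_on_comparison_test) (auto intro: norm_sum)
qed

lemma coeff3_mult_monom3:
  "(\<Sum>n | n \<le> m. coeff3 F n * monom3 z n * (coeff3 G (m - n) * monom3 z (m - n)))
    = coeff3 (F * G) m * monom3 z m"
  unfolding coeff3_mult sum_distrib_right
proof (rule sum.cong[OF refl])
  fix n assume "n \<in> {n. n \<le> m}"
  then have "monom3 z n * monom3 z (m - n) = monom3 z m"
    by (metis add.commute diff_add_multiindex monom3_add mem_Collect_eq)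
  then show "coeff3 F n * monom3 z n * (coeff3 G (m - n) * monom3 z (m - n))
      = coeff3 F n * coeff3 G (m - n) * monom3 z m"
    by (metis (no_types, lifting) mult.assoc mult.left_commute)
qed

lemma eval3_mult:
  assumes "converges3 \<rho> F" "converges3 \<rho> G" "z \<in> polydisc \<rho>"
  shows "eval3 (F * G) z = eval3 F z * eval3 G z"
  using mult_has_sum3(1)[OF eval3_abs_summable[OF assms(1) polydisc_norm_le[OF assms(3)]]
      eval3_abs_summable[OF assms(2) polydisc_norm_le[OF assms(3)]]]
  unfolding coeff3_mult_monom3 eval3_def by (rule infsumI)

lemma converges3_mult:
  assumes "converges3 \<rho> F" "converges3 \<rho> G" "0 \<le> \<rho>"
  shows "converges3 \<rho> (F * G)"
proof -
  let ?z = "\<chi> i. complex_of_real \<rho>"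
  have z: "norm (?z $ i) \<le> \<rho>" for i using assms(3) by simp
  have m: "norm (monom3 ?z m) = \<rho> ^ mdeg m" for m
    using assms(3) by (simp add: monom3_3 mdeg_3 power_add norm_mult norm_power)
  show ?thesis
    using mult_has_sum3(2)[OF eval3_abs_summable[OF assms(1) z] eval3_abs_summable[OF assms(2) z]]
    unfolding coeff3_mult_monom3 norm_mult m converges3_def .
qed

section \<open>Differentiation of convergent series\<close>

lemma polydisc_shrink:
  assumes "p \<in> polydisc \<rho>" "\<rho> > 0"
  shows "\<exists>\<rho>'. 0 < \<rho>' \<and> \<rho>' < \<rho> \<and> p \<in> polydisc \<rho>'"
proof -
  have "\<forall>i. norm (p $ i) < \<rho>" using assms(1) by (simp add: polydisc_def)
  then have "Max (range (\<lambda>i. norm (p $ i))) < \<rho>" by (subst Max_less_iff) auto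
  then obtain \<rho>' where \<rho>': "max 0 (Max (range (\<lambda>i. norm (p $ i)))) < \<rho>'" "\<rho>' < \<rho>"
    using dense[of "max 0 (Max (range (\<lambda>i. norm (p $ i))))" \<rho>] assms(2) by auto
  have "norm (p $ i) < \<rho>'" for i
  proof -
    have "norm (p $ i) \<le> Max (range (\<lambda>i. norm (p $ i)))" by (rule Max_ge) auto
    then show ?thesis using \<rho>' by simp
  qed
  then show ?thesis using \<rho>' by (intro exI[of _ \<rho>']) (simp add: polydisc_def)
qed

text \<open>
  Shrinking the radius absorbs the factor \<open>m\<^sub>j + 1\<close>, since \<open>n x\<^sup>n\<close> is bounded for \<open>x < 1\<close>.
\<close>

lemma converges3_deriv:
  assumes "converges3 \<rho> F" "0 < \<rho>'" "\<rho>' < \<rho>"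
  shows "converges3 \<rho>' (fps3_deriv j F)"
proof -
  let ?x = "\<rho>' / \<rho>"
  have \<rho>: "\<rho> > 0" and x: "norm ?x < 1" using assms by auto
  have "(\<lambda>n. of_nat n * ?x ^ n + ?x ^ n) \<longlonglongrightarrow> 0 + 0"
    using x by (intro tendsto_add powser_times_n_limit_0 LIMSEQ_power_zero) auto
  then have "Bseq (\<lambda>n. of_nat n * ?x ^ n + ?x ^ n)"
    by (rule convergent_imp_Bseq[OF convergentI])
  then obtain K where K: "K > 0" "\<And>n. norm (of_nat n * ?x ^ n + ?x ^ n) \<le> K"
    by (rule BseqE) blast
  have bound: "of_nat (Suc n) * \<rho>' ^ n \<le> K / \<rho> * \<rho> ^ Suc n" for n
  proof -
    have "of_nat n * ?x ^ n + ?x ^ n \<le> K" using K(2)[of n] by (metis abs_le_D1 real_norm_def)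
    then have "(of_nat n * ?x ^ n + ?x ^ n) * \<rho> ^ n \<le> K * \<rho> ^ n"
      using \<rho> by (intro mult_right_mono) auto
    moreover have "(of_nat n * ?x ^ n + ?x ^ n) * \<rho> ^ n = of_nat (Suc n) * \<rho>' ^ n"
      using \<rho> by (simp add: power_divide field_simps)
    ultimately show ?thesis using \<rho> by simp
  qed
  have inj: "inj (\<lambda>m :: nat^3. m + axis j 1)" by (rule injI) simp
  have "(\<lambda>m. norm (coeff3 F m) * \<rho> ^ mdeg m) summable_on range (\<lambda>m. m + axis j 1)"
    using assms(1) unfolding converges3_def by (rule summable_on_subset_banach) simp
  then have "(\<lambda>m. norm (coeff3 F (m + axis j 1)) * \<rho> ^ Suc (mdeg m)) summable_on UNIV"
    by (subst (asm) summable_on_reindex[OF inj]) (simp add: o_def mdeg_add)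
  then have "(\<lambda>m. K / \<rho> * (norm (coeff3 F (m + axis j 1)) * \<rho> ^ Suc (mdeg m))) summable_on UNIV"
    by (rule summable_on_cmult_right)
  then show ?thesis
    unfolding converges3_def
  proof (rule summable_on_comparison_test)
    fix m :: "nat^3"
    have "m $ j \<le> mdeg m" unfolding mdeg_def by (rule member_le_sum) auto
    then have "of_nat (m $ j + 1) * \<rho>' ^ mdeg m \<le> of_nat (Suc (mdeg m)) * \<rho>' ^ mdeg m"
      using assms by (intro mult_right_mono) auto
    also have "\<dots> \<le> K / \<rho> * \<rho> ^ Suc (mdeg m)" by (rule bound)
    finally have "norm (coeff3 F (m + axis j 1)) * (of_nat (m $ j + 1) * \<rho>' ^ mdeg m)
        \<le> norm (coeff3 F (m + axis j 1)) * (K / \<rho> * \<rho> ^ Suc (mdeg m))"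
      by (rule mult_left_mono) simp
    moreover have "norm (coeff3 (fps3_deriv j F) m) = of_nat (m $ j + 1) * norm (coeff3 F (m + axis j 1))"
      unfolding coeff3_deriv norm_mult by (simp only: norm_of_nat)
    ultimately show "norm (coeff3 (fps3_deriv j F) m) * \<rho>' ^ mdeg m
        \<le> K / \<rho> * (norm (coeff3 F (m + axis j 1)) * \<rho> ^ Suc (mdeg m))"
      by (simp only: mult_ac)
  qed (use assms in auto)
qed

lemma monom3_line_deriv:
  "((\<lambda>t. monom3 (p + t *s u) m) has_field_derivative
      (\<Sum>j\<in>UNIV. u $ j * (of_nat (m $ j) * monom3 (p + w *s u) (m - axis j 1)))) (at w)"
proof -
  have *: "((\<lambda>t. (a + t * c) ^ n) has_field_derivative c * (of_nat n * (a + w * c) ^ (n - 1))) (at w)" for a c :: complex and n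
    by (auto intro!: derivative_eq_intros)
  let ?z = "\<lambda>i. p $ i + w * u $ i"
  have "((\<lambda>t. (p $ 1 + t * u $ 1) ^ m $ 1 * (p $ 2 + t * u $ 2) ^ m $ 2 * (p $ 3 + t * u $ 3) ^ m $ 3) has_field_derivative
      (u $ 1 * (of_nat (m $ 1) * (?z 1 ^ (m $ 1 - 1) * ?z 2 ^ m $ 2 * ?z 3 ^ m $ 3))
     + u $ 2 * (of_nat (m $ 2) * (?z 1 ^ m $ 1 * ?z 2 ^ (m $ 2 - 1) * ?z 3 ^ m $ 3))
     + u $ 3 * (of_nat (m $ 3) * (?z 1 ^ m $ 1 * ?z 2 ^ m $ 2 * ?z 3 ^ (m $ 3 - 1))))) (at w)"
    by (rule DERIV_cong[OF DERIV_mult[OF DERIV_mult[OF * *] *]]) (simp only: algebra_simps)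
  then show ?thesis
    unfolding monom3_3 sum_3 by (simp add: axis_def)
qed

lemma eval3_continuous:
  assumes "converges3 \<rho> F"
  shows "continuous_on (polydisc \<rho>) (eval3 F)"
proof -
  have u: "uniform_limit (polydisc \<rho>) (\<lambda>X z. \<Sum>m\<in>X. coeff3 F m * monom3 z m) (eval3 F) (finite_subsets_at_top UNIV)"
    unfolding eval3_def
    by (rule Weierstrass_m_test_general[OF _ assms[unfolded converges3_def]])
       (auto simp: norm_mult intro!: mult_left_mono norm_monom3_le polydisc_norm_le)
  show ?thesis
    by (rule uniform_limit_theorem[OF _ u])
       (auto simp: monom3_def intro!: always_eventually continuous_intros)
qed

lemma continuous_on_line: "continuous_on A (\<lambda>t. p + t *s u :: complex^3)"
proof -
  have "(\<lambda>t. p + t *s u) = (\<lambda>t. \<chi> i. p $ i + t * u $ i)" by (auto simp: vec_eq_iff)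
  then show ?thesis by (simp only:) (intro continuous_on_vec_lambda continuous_intros)
qed

lemma line_in_polydisc:
  assumes "p + w *s u \<in> polydisc \<rho>"
  shows "\<exists>r>0. \<forall>t\<in>cball w r. p + t *s u \<in> polydisc \<rho>"
proof -
  have "open ((\<lambda>t. p + t *s u) -` polydisc \<rho>)"
    by (rule open_vimage[OF open_polydisc continuous_on_line])
  moreover have "w \<in> (\<lambda>t. p + t *s u) -` polydisc \<rho>" using assms by simp
  ultimately obtain r where "r > 0" "cball w r \<subseteq> (\<lambda>t. p + t *s u) -` polydisc \<rho>"
    using open_contains_cball by metis
  then show ?thesis by blast
qed

text \<open>
  The partial sums converge uniformly near the point, so by Weierstrass the derivatives of the partial
  sums converge to the derivative of the sum. They also converge to the sum of the differentiated series.
\<close>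

lemma eval3_line_deriv:
  assumes F: "converges3 \<rho> F" and "\<rho> > 0" and p: "p + w *s u \<in> polydisc \<rho>"
  shows "((\<lambda>t. eval3 F (p + t *s u)) has_field_derivative
            (\<Sum>j\<in>UNIV. u $ j * eval3 (fps3_deriv j F) (p + w *s u))) (at w)"
proof -
  obtain r where r: "r > 0" "\<And>t. t \<in> cball w r \<Longrightarrow> p + t *s u \<in> polydisc \<rho>"
    using line_in_polydisc[OF p] by blast
  let ?f = "\<lambda>X t. \<Sum>m\<in>X. coeff3 F m * monom3 (p + t *s u) m"
  let ?d = "\<lambda>m t. \<Sum>j\<in>UNIV. u $ j * (of_nat (m $ j) * monom3 (p + t *s u) (m - axis j 1))"
  let ?f' = "\<lambda>X t. \<Sum>m\<in>X. coeff3 F m * ?d m t"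
  have d: "((?f X) has_field_derivative (?f' X t)) (at t)" for X t
    by (intro DERIV_sum DERIV_cmult monom3_line_deriv)
  have u: "uniform_limit (cball w r) ?f (\<lambda>t. eval3 F (p + t *s u)) (finite_subsets_at_top UNIV)"
    unfolding eval3_def
    by (rule Weierstrass_m_test_general[OF _ F[unfolded converges3_def]])
       (auto simp: norm_mult intro!: mult_left_mono norm_monom3_le polydisc_norm_le r)
  have ev: "\<forall>\<^sub>F X in finite_subsets_at_top UNIV. continuous_on (cball w r) (?f X) \<and>
       (\<forall>t\<in>ball w r. (?f X has_field_derivative ?f' X t) (at t))"
    using d by (intro always_eventually allI conjI ballI DERIV_continuous_on)
       (auto intro: has_field_derivative_at_within)
  obtain g' where g': "\<And>t. t \<in> ball w r \<Longrightarrow> ((\<lambda>t. eval3 F (p + t *s u)) has_field_derivative g' t) (at t)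
       \<and> ((\<lambda>X. ?f' X t) \<longlongrightarrow> g' t) (finite_subsets_at_top UNIV)"
    using has_complex_derivative_uniform_limit[OF ev u _ r(1)] by auto
  obtain \<rho>' where \<rho>': "0 < \<rho>'" "\<rho>' < \<rho>" "p + w *s u \<in> polydisc \<rho>'"
    using polydisc_shrink[OF p \<open>\<rho> > 0\<close>] by blast
  let ?q = "p + w *s u"
  have "((\<lambda>m. of_nat (m $ j) * (coeff3 F m * monom3 ?q (m - axis j 1))) has_sum eval3 (fps3_deriv j F) ?q) UNIV" for j
  proof -
    have inj: "inj (\<lambda>m :: nat^3. m + axis j 1)" by (rule injI) simp
    have "((\<lambda>m. coeff3 (fps3_deriv j F) m * monom3 ?q m) has_sum eval3 (fps3_deriv j F) ?q) UNIV"
      by (intro eval3_has_sum[OF converges3_deriv[OF F \<rho>'(1,2)]] \<rho>')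
    also have "(\<lambda>m. coeff3 (fps3_deriv j F) m * monom3 ?q m)
       = (\<lambda>m. of_nat (m $ j) * (coeff3 F m * monom3 ?q (m - axis j 1))) \<circ> (\<lambda>m. m + axis j 1)"
      by (rule ext) (simp add: axis_def)
    finally have "((\<lambda>m. of_nat (m $ j) * (coeff3 F m * monom3 ?q (m - axis j 1))) has_sum eval3 (fps3_deriv j F) ?q) (range (\<lambda>m. m + axis j 1))"
      by (subst has_sum_reindex[OF inj])
    then show ?thesis
    proof (rule has_sum_cong_neutral[THEN iffD1, rotated -1])
      fix m :: "nat^3" assume m: "m \<in> UNIV - range (\<lambda>m. m + axis j 1)"
      have "m $ j = 0"
      proof (rule ccontr)
        assume "m $ j \<noteq> 0"
        then have "axis j 1 \<le> m" by (auto simp: less_eq_vec_def axis_def)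
        then have "m = (m - axis j 1) + axis j 1" by (rule diff_add_multiindex[symmetric])
        then show False using m by blast
      qed
      then show "of_nat (m $ j) * (coeff3 F m * monom3 ?q (m - axis j 1)) = 0" by simp
    qed auto
  qed
  then have "((\<lambda>m. \<Sum>j\<in>UNIV. u $ j * (of_nat (m $ j) * (coeff3 F m * monom3 ?q (m - axis j 1)))) has_sum
        (\<Sum>j\<in>UNIV. u $ j * eval3 (fps3_deriv j F) ?q)) UNIV"
    unfolding sum_3 by (intro has_sum_add has_sum_cmult_right)
  also have "(\<lambda>m. \<Sum>j\<in>UNIV. u $ j * (of_nat (m $ j) * (coeff3 F m * monom3 ?q (m - axis j 1))))
      = (\<lambda>m. coeff3 F m * ?d m w)"
    by (rule ext) (simp add: sum_distrib_left mult_ac)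
  finally have lim1: "((\<lambda>X. ?f' X w) \<longlongrightarrow> (\<Sum>j\<in>UNIV. u $ j * eval3 (fps3_deriv j F) ?q)) (finite_subsets_at_top UNIV)"
    by (simp add: has_sum_def)
  have lim2: "((\<lambda>X. ?f' X w) \<longlongrightarrow> g' w) (finite_subsets_at_top UNIV)"
    using g'[of w] r(1) by simp
  have "g' w = (\<Sum>j\<in>UNIV. u $ j * eval3 (fps3_deriv j F) ?q)"
    by (rule tendsto_unique[OF _ lim2 lim1]) simp
  then show ?thesis using g'[of w] r(1) by simp
qed

lemma partial_eq_eval3:
  assumes F: "converges3 \<rho> F" and "\<rho> > 0" and f: "\<And>z. z \<in> polydisc \<rho> \<Longrightarrow> f z = eval3 F z"
    and z: "z \<in> polydisc \<rho>"
  shows "partial j f z = eval3 (fps3_deriv j F) z"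
proof -
  have ax: "z + axis j t = z + t *s axis j 1" for t :: complex
    by (auto simp: vec_eq_iff axis_def)
  have z': "z + 0 *s axis j 1 \<in> polydisc \<rho>" using z by simp
  have "((\<lambda>t. eval3 F (z + t *s axis j 1)) has_field_derivative
      (\<Sum>i\<in>UNIV. axis j 1 $ i * eval3 (fps3_deriv i F) (z + 0 *s axis j 1))) (at 0)"
    by (rule eval3_line_deriv[OF F \<open>\<rho> > 0\<close> z'])
  also have "(\<Sum>i\<in>UNIV. axis j 1 $ i * eval3 (fps3_deriv i F) (z + 0 *s axis j 1))
      = (\<Sum>i\<in>UNIV. if i = j then eval3 (fps3_deriv i F) z else 0)"
    by (rule sum.cong) (auto simp: axis_def)
  also have "\<dots> = eval3 (fps3_deriv j F) z" by simp
  finally have d: "((\<lambda>t. eval3 F (z + t *s axis j 1)) has_field_derivative eval3 (fps3_deriv j F) z) (at 0)" .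
  obtain r where r: "r > 0" "\<And>t. t \<in> cball 0 r \<Longrightarrow> z + t *s axis j 1 \<in> polydisc \<rho>"
    using line_in_polydisc[OF z'] by blast
  have "((\<lambda>t. f (z + axis j t)) has_field_derivative eval3 (fps3_deriv j F) z) (at 0)"
    by (rule has_field_derivative_transform_within_open[OF d, of "ball 0 r"])
       (use r f in \<open>auto simp: ax\<close>)
  then show ?thesis unfolding partial_def by (rule DERIV_imp_deriv)
qed

lemma eval3_order_bound:
  assumes F: "converges3 \<rho> F" "order_ge N F" and "\<rho> > 0"
  shows "\<exists>C\<ge>0. \<forall>z. norm z < \<rho> \<longrightarrow> norm (eval3 F z) \<le> C * norm z ^ N"
proof -
  define C where "C = (\<Sum>\<^sub>\<infinity>m. norm (coeff3 F m) * \<rho> ^ mdeg m)"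
  have C: "C \<ge> 0" unfolding C_def using \<open>\<rho> > 0\<close> by (intro infsum_nonneg) auto
  have "norm (eval3 F z) \<le> C / \<rho> ^ N * norm z ^ N" if z: "norm z < \<rho>" for z
  proof -
    have zi: "norm (z $ i) \<le> norm z" for i by (rule Finite_Cartesian_Product.norm_nth_le)
    then have zi': "norm (z $ i) \<le> \<rho>" for i using z less_imp_le le_less_trans by meson
    note s = eval3_abs_summable[OF F(1) zi']
    have "norm (eval3 F z) \<le> (\<Sum>\<^sub>\<infinity>m. norm (coeff3 F m * monom3 z m))"
      unfolding eval3_def by (rule norm_infsum_bound[OF s])
    also have "\<dots> \<le> (\<Sum>\<^sub>\<infinity>m. (norm z / \<rho>) ^ N * (norm (coeff3 F m) * \<rho> ^ mdeg m))"
    proof (rule infsum_mono[OF s])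
      show "(\<lambda>m. (norm z / \<rho>) ^ N * (norm (coeff3 F m) * \<rho> ^ mdeg m)) summable_on UNIV"
        by (intro summable_on_cmult_right F(1)[unfolded converges3_def])
      fix m
      show "norm (coeff3 F m * monom3 z m) \<le> (norm z / \<rho>) ^ N * (norm (coeff3 F m) * \<rho> ^ mdeg m)"
      proof (cases "mdeg m < N")
        case True
        then show ?thesis using F(2) by (simp add: order_ge_def)
      next
        case False
        have "norm (monom3 z m) \<le> norm z ^ mdeg m" by (rule norm_monom3_le[OF zi])
        also have "norm z ^ mdeg m = (norm z / \<rho>) ^ mdeg m * \<rho> ^ mdeg m"
          using \<open>\<rho> > 0\<close> by (simp add: power_divide)
        also have "\<dots> \<le> (norm z / \<rho>) ^ N * \<rho> ^ mdeg m"
          using \<open>\<rho> > 0\<close> z False by (intro mult_right_mono power_decreasing) auto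
        finally have "norm (coeff3 F m) * norm (monom3 z m) \<le> norm (coeff3 F m) * ((norm z / \<rho>) ^ N * \<rho> ^ mdeg m)"
          by (rule mult_left_mono) simp
        then show ?thesis by (simp add: norm_mult mult_ac)
      qed
    qed
    also have "\<dots> = (norm z / \<rho>) ^ N * C"
      unfolding C_def by (rule infsum_cmult_right')
    finally show ?thesis by (simp add: power_divide mult_ac)
  qed
  then show ?thesis using C \<open>\<rho> > 0\<close> by (intro exI[of _ "C / \<rho> ^ N"]) auto
qed

text \<open>
  The constant term is the value at \<open>0\<close>, and every other coefficient is reached by differentiating.
\<close>

lemma eval3_eq_0_imp_0:
  assumes "converges3 \<rho> F" "\<rho> > 0" "\<And>z. z \<in> polydisc \<rho> \<Longrightarrow> eval3 F z = 0"
  shows "F = 0"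
proof -
  have "coeff3 F m = 0" if "converges3 \<rho> F" "\<rho> > 0" "\<forall>z\<in>polydisc \<rho>. eval3 F z = 0" "mdeg m = N" for N \<rho> F m
    using that
  proof (induction N arbitrary: \<rho> F m)
    case 0
    then show ?case using eval3_0[of F] zero_in_polydisc[of \<rho>] by (simp add: mdeg_eq_0_iff)
  next
    case (Suc N)
    then have "m \<noteq> 0" by auto
    then obtain i where "m $ i \<noteq> 0" by (auto simp: vec_eq_iff)
    then have le: "axis i 1 \<le> m" by (auto simp: less_eq_vec_def axis_def)
    define n where "n = m - axis i 1"
    have m: "m = n + axis i 1" using diff_add_multiindex[OF le] by (simp add: n_def)
    have N: "mdeg n = N" using Suc.prems by (simp add: m mdeg_add)
    have "eval3 (fps3_deriv i F) z = 0" if "z \<in> polydisc \<rho>" for z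
      using partial_eq_eval3[OF Suc.prems(1,2), of "\<lambda>_. 0" z i] Suc.prems(3) that
      by (simp add: partial_def)
    then have "\<forall>z\<in>polydisc (\<rho> / 2). eval3 (fps3_deriv i F) z = 0"
      using polydisc_mono[of "\<rho> / 2" \<rho>] Suc.prems(2) by auto
    then have "coeff3 (fps3_deriv i F) n = 0"
      using Suc.prems by (intro Suc.IH[of "\<rho> / 2"] converges3_deriv[OF Suc.prems(1)] N) auto
    then have "of_nat (Suc (n $ i)) * coeff3 F m = 0" by (simp only: coeff3_deriv m Suc_eq_plus1)
    then show ?case by (metis mult_eq_0_iff of_nat_eq_0_iff nat.distinct(1))
  qed
  then show ?thesis using assms by (intro fps3_eqI) auto
qed

lemma has_fps3_expansion_unique:
  assumes "has_fps3_expansion f F" "has_fps3_expansion f G"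
  shows "F = G"
proof -
  obtain a where a: "a > 0" "converges3 a F" "\<And>z. z \<in> polydisc a \<Longrightarrow> f z = eval3 F z"
    using has_fps3_expansion_imp_eval3[OF assms(1)] by blast
  obtain b where b: "b > 0" "converges3 b G" "\<And>z. z \<in> polydisc b \<Longrightarrow> f z = eval3 G z"
    using has_fps3_expansion_imp_eval3[OF assms(2)] by blast
  let ?c = "min a b"
  have c: "?c > 0" "converges3 ?c F" "converges3 ?c G"
    using a b converges3_mono[OF a(2), of ?c] converges3_mono[OF b(2), of ?c] by auto
  have "F - G = 0"
  proof (rule eval3_eq_0_imp_0[OF converges3_diff[OF c(2,3)] c(1)])
    fix z assume z: "z \<in> polydisc ?c"
    then have "z \<in> polydisc a" "z \<in> polydisc b" by (auto simp: polydisc_def)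
    then show "eval3 (F - G) z = 0" using a(3)[of z] b(3)[of z] eval3_diff[OF c(2,3) z] by simp
  qed (use c in simp)
  then show ?thesis by simp
qed

lemma taylor_eval3:
  assumes "holomorphic_at v 0"
  shows "\<exists>\<rho>>0. \<forall>i. converges3 \<rho> (taylor v $ i) \<and> (\<forall>z\<in>polydisc \<rho>. v z $ i = eval3 (taylor v $ i) z)"
proof -
  have "has_fps3_expansion (\<lambda>z. v z $ i) (taylor v $ i)" for i
  proof -
    obtain F where F: "has_fps3_expansion (\<lambda>z. v z $ i) F"
      using assms by (auto simp: holomorphic_at_def)
    then have "taylor v $ i = F"
      unfolding taylor_def by (simp add: has_fps3_expansion_unique the_equality)
    then show ?thesis using F by simp
  qed
  then have "\<forall>i. \<exists>\<rho>>0. converges3 \<rho> (taylor v $ i) \<and> (\<forall>z\<in>polydisc \<rho>. v z $ i = eval3 (taylor v $ i) z)"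
    using has_fps3_expansion_imp_eval3 by blast
  then obtain r where r: "\<And>i. r i > 0" "\<And>i. converges3 (r i) (taylor v $ i)"
     "\<And>i z. z \<in> polydisc (r i) \<Longrightarrow> v z $ i = eval3 (taylor v $ i) z"
    by metis
  define \<rho> where "\<rho> = Min (range r)"
  have \<rho>: "\<rho> > 0" "\<rho> \<le> r i" for i
    using r(1) by (auto simp: \<rho>_def Min_gr_iff)
  have "converges3 \<rho> (taylor v $ i)" for i
    using converges3_mono[OF r(2)] \<rho> by (simp add: less_imp_le)
  then show ?thesis using \<rho> r(3) polydisc_mono by (intro exI[of _ \<rho>]) blast
qed

lemma eventually_nhds_0_polydisc:
  assumes "\<forall>\<^sub>F z in nhds 0. P z"
  shows "\<exists>\<rho>>0. \<forall>z\<in>polydisc \<rho>. P z"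
proof -
  obtain d where d: "d > 0" "\<And>z. norm z < d \<Longrightarrow> P z"
    using assms unfolding eventually_nhds_metric by (auto simp: dist_norm)
  have "norm z < d" if "z \<in> polydisc (d / 4)" for z :: "complex^3"
  proof -
    have "norm z \<le> (\<Sum>i\<in>UNIV. norm (z $ i))" unfolding norm_vec_def by (intro L2_set_le_sum) auto
    also have "\<dots> \<le> 3 * (d / 4)"
      using polydisc_norm_le[OF that, of 1] polydisc_norm_le[OF that, of 2] polydisc_norm_le[OF that, of 3]
      by (simp add: sum_3)
    finally show ?thesis using d(1) by simp
  qed
  then show ?thesis using d by (intro exI[of _ "d / 4"]) auto
qed

section \<open>Separately holomorphic functions\<close>

lemma contour_integral_param_continuous:
  fixes f :: "'a::topological_space \<Rightarrow> complex \<Rightarrow> complex"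
  assumes "continuous_on (U \<times> sphere z0 r) (\<lambda>(p, u). f p u)" "0 \<le> r"
  shows "continuous_on U (\<lambda>p. contour_integral (circlepath z0 r) (f p))"
proof -
  let ?g = "circlepath z0 r"
  have "contour_integral ?g (f p) = integral (cbox 0 1) (\<lambda>x. f p (?g x) * (2 * pi * \<i> * r * exp (2 * pi * \<i> * x)))" for p
    by (simp add: contour_integral_integral vector_derivative_circlepath cbox_interval)
  moreover have "continuous_on U (\<lambda>p. integral (cbox 0 1) (\<lambda>x. f p (?g x) * (2 * pi * \<i> * r * exp (2 * pi * \<i> * x))))"
  proof (rule integral_continuous_on_param)
    have "continuous_on (U \<times> cbox 0 (1::real)) (\<lambda>x. (\<lambda>(p, u). f p u) (fst x, ?g (snd x)))"
    proof (rule continuous_on_compose2[OF assms(1)])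
      show "continuous_on (U \<times> cbox 0 (1::real)) (\<lambda>x. (fst x, ?g (snd x)))"
        unfolding circlepath by (intro continuous_intros)
      have "?g x \<in> sphere z0 r" if "x \<in> {0..1}" for x
      proof -
        have "?g ` {0..1} = sphere z0 r"
          using path_image_circlepath[of z0 r] assms(2) by (simp add: path_image_def)
        then show ?thesis using that by blast
      qed
      then show "(\<lambda>x. (fst x, ?g (snd x))) ` (U \<times> cbox 0 1) \<subseteq> U \<times> sphere z0 r"
        by (auto simp: cbox_interval simp del: mem_sphere)
    qed
    then have "continuous_on (U \<times> cbox 0 (1::real)) (\<lambda>x. f (fst x) (?g (snd x)) * (2 * pi * \<i> * r * exp (2 * pi * \<i> * (snd x))))"
      by (intro continuous_intros) auto
    then show "continuous_on (U \<times> cbox 0 (1::real)) (\<lambda>(p, x). f p (?g x) * (2 * pi * \<i> * r * exp (2 * pi * \<i> * x)))"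
      by (simp add: case_prod_unfold)
  qed
  ultimately show ?thesis by simp
qed

text \<open>
  Exchanging the order of integration shows that the integral satisfies Cauchy's formula in the
  parameter, which makes it differentiable.
\<close>

lemma contour_integral_param_holomorphic:
  assumes cont: "continuous_on (U \<times> sphere z0 r) (\<lambda>(s, u). f s u)" and "0 < r"
    and holo: "\<And>u. u \<in> sphere z0 r \<Longrightarrow> (\<lambda>s. f s u) holomorphic_on U" and U: "open U"
  shows "(\<lambda>s. contour_integral (circlepath z0 r) (f s)) holomorphic_on U"
proof (rule holomorphic_onI)
  fix s0 assume "s0 \<in> U"
  then obtain e where e: "e > 0" "cball s0 e \<subseteq> U" using U open_contains_cball by metis
  let ?I = "\<lambda>s. contour_integral (circlepath z0 r) (f s)"
  have contI: "continuous_on U ?I"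
    by (rule contour_integral_param_continuous[OF cont]) (use \<open>0 < r\<close> in simp)
  have sub: "sphere s0 e \<subseteq> U" using e by auto
  have rep: "((\<lambda>u. ?I u / (u - w)^1) has_contour_integral (2 * of_real pi * \<i> * ?I w)) (circlepath s0 e)"
    if w: "w \<in> ball s0 e" for w
  proof -
    have c: "contour_integral (circlepath s0 e) (\<lambda>y. f y u / (y - w)) = 2 * of_real pi * \<i> * f w u"
      if u: "u \<in> sphere z0 r" for u
    proof (rule contour_integral_unique, rule Cauchy_integral_circlepath_simple)
      show "(\<lambda>s. f s u) holomorphic_on cball s0 e" using holo[OF u] e(2) holomorphic_on_subset by blast
      show "cmod (w - s0) < e" using w by (simp add: dist_norm norm_minus_commute)
    qed
    have ne: "y \<noteq> w" if "y \<in> sphere s0 e" for y using that w by auto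
    have ab: "contour_integral (circlepath s0 e) (\<lambda>y. contour_integral (circlepath z0 r) (\<lambda>u. f y u / (y - w)))
        = contour_integral (circlepath z0 r) (\<lambda>u. contour_integral (circlepath s0 e) (\<lambda>y. f y u / (y - w)))"
    proof (rule contour_integral_swap)
      have "continuous_on (sphere s0 e \<times> sphere z0 r) (\<lambda>x. (\<lambda>(s, u). f s u) x / (fst x - w))"
        using ne by (intro continuous_intros continuous_on_subset[OF cont]) (use sub in auto)
      then show "continuous_on (path_image (circlepath s0 e) \<times> path_image (circlepath z0 r)) (\<lambda>(y, u). f y u / (y - w))"
        using e(1) \<open>0 < r\<close> by (simp add: case_prod_unfold)
    qed (auto simp: vector_derivative_circlepath intro!: continuous_intros)
    have int: "f y contour_integrable_on circlepath z0 r" if "y \<in> U" for y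
    proof (rule contour_integrable_continuous_circlepath)
      have "continuous_on (sphere z0 r) (\<lambda>u. (\<lambda>(s, u). f s u) (y, u))"
        by (rule continuous_on_compose2[OF cont]) (use that in \<open>auto intro!: continuous_intros\<close>)
      then show "continuous_on (path_image (circlepath z0 r)) (f y)" using \<open>0 < r\<close> by simp
    qed
    have wU: "w \<in> U" using w e(2) by auto
    have "contour_integral (circlepath s0 e) (\<lambda>y. ?I y / (y - w))
        = contour_integral (circlepath s0 e) (\<lambda>y. contour_integral (circlepath z0 r) (\<lambda>u. f y u / (y - w)))"
      by (rule contour_integral_cong) (use e sub int in \<open>auto simp: contour_integral_div\<close>)
    also have "\<dots> = contour_integral (circlepath z0 r) (\<lambda>u. 2 * of_real pi * \<i> * f w u)"
      unfolding ab by (rule contour_integral_cong) (use \<open>0 < r\<close> c in auto)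
    also have "\<dots> = 2 * of_real pi * \<i> * ?I w"
      by (rule contour_integral_lmul[OF int[OF wU]])
    finally have val: "contour_integral (circlepath s0 e) (\<lambda>y. ?I y / (y - w)) = 2 * of_real pi * \<i> * ?I w" .
    have "(\<lambda>y. ?I y / (y - w)) contour_integrable_on circlepath s0 e"
      by (rule contour_integrable_continuous_circlepath)
         (use e ne sub in \<open>auto intro!: continuous_intros continuous_on_subset[OF contI]\<close>)
    from has_contour_integral_integral[OF this] show ?thesis by (simp add: val)
  qed
  have "((\<lambda>s. 2 * of_real pi * \<i> * ?I s) has_field_derivative
      (of_nat 1 * contour_integral (circlepath s0 e) (\<lambda>u. ?I u / (u - s0)^Suc 1))) (at s0)"
    by (rule Cauchy_next_derivative_circlepath(2)[OF _ rep])
       (use e sub in \<open>auto intro!: continuous_on_subset[OF contI]\<close>)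
  then have "(\<lambda>s. 2 * of_real pi * \<i> * ?I s / (2 * of_real pi * \<i>)) field_differentiable at s0"
    by (intro field_differentiable_divide) (auto simp: field_differentiable_def)
  then have "?I field_differentiable at s0" by simp
  then show "?I field_differentiable at s0 within U" by (rule field_differentiable_at_within)
qed

text \<open>
  The \<open>n\<close>-th Taylor coefficient at \<open>0\<close>, as an integral over a fixed circle, so that continuous and
  holomorphic dependence on parameters is inherited from the integrand.
\<close>

definition cauchy_coeff :: "real \<Rightarrow> nat \<Rightarrow> (complex \<Rightarrow> complex) \<Rightarrow> complex" where
  "cauchy_coeff r n h = contour_integral (circlepath 0 r) (\<lambda>u. h u / u ^ Suc n) / (2 * of_real pi * \<i>)"

lemma cauchy_coeff_expansion:
  assumes "0 < r" "continuous_on (cball 0 r) h" "h holomorphic_on ball 0 r"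
    and "\<And>u. norm u = r \<Longrightarrow> norm (h u) \<le> M"
  shows "norm (cauchy_coeff r n h) \<le> M / r ^ n"
    and "norm w < r \<Longrightarrow> (\<lambda>n. cauchy_coeff r n h * w ^ n) sums h w"
proof -
  have c: "cauchy_coeff r n h = (deriv ^^ n) h 0 / fact n" for n
    using Cauchy_higher_derivative_integral_circlepath(2)[OF assms(2,3), of 0 n] assms(1)
    by (simp add: cauchy_coeff_def field_simps)
  have "norm ((deriv ^^ n) h 0) \<le> fact n * M / r ^ n"
    by (rule Cauchy_inequality[OF assms(3,2,1)]) (use assms(4) in simp)
  then show "norm (cauchy_coeff r n h) \<le> M / r ^ n"
    by (simp add: c norm_divide field_simps)
  show "norm w < r \<Longrightarrow> (\<lambda>n. cauchy_coeff r n h * w ^ n) sums h w"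
    using holomorphic_power_series[OF assms(3), of w] by (simp add: c)
qed

lemma cauchy_coeff_continuous:
  fixes h :: "'a::topological_space \<Rightarrow> complex \<Rightarrow> complex"
  assumes "0 < r" "continuous_on (U \<times> cball 0 r) (\<lambda>(p, u). h p u)"
  shows "continuous_on U (\<lambda>p. cauchy_coeff r n (h p))"
  unfolding cauchy_coeff_def
proof (intro continuous_intros contour_integral_param_continuous)
  have "continuous_on (U \<times> sphere 0 r) (\<lambda>x. (\<lambda>(p, u). h p u) x / snd x ^ Suc n)"
    using assms(1) by (intro continuous_intros continuous_on_subset[OF assms(2)]) auto
  then show "continuous_on (U \<times> sphere 0 r) (\<lambda>(p, u). h p u / u ^ Suc n)"
    by (simp add: case_prod_unfold)
qed (use assms(1) in auto)

lemma cauchy_coeff_holomorphic: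
  assumes "0 < r" "continuous_on (U \<times> cball 0 r) (\<lambda>(s, u). h s u)" "open U"
    and "\<And>u. norm u = r \<Longrightarrow> (\<lambda>s. h s u) holomorphic_on U"
  shows "(\<lambda>s. cauchy_coeff r n (h s)) holomorphic_on U"
  unfolding cauchy_coeff_def
proof (intro holomorphic_intros contour_integral_param_holomorphic)
  have "continuous_on (U \<times> sphere 0 r) (\<lambda>x. (\<lambda>(p, u). h p u) x / snd x ^ Suc n)"
    using assms(1) by (intro continuous_intros continuous_on_subset[OF assms(2)]) auto
  then show "continuous_on (U \<times> sphere 0 r) (\<lambda>(p, u). h p u / u ^ Suc n)"
    by (simp add: case_prod_unfold)
qed (use assms in \<open>auto intro!: holomorphic_intros\<close>)

lemma geometric_multiindex_summable:
  assumes "0 \<le> x" "x < (1::real)"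
  shows "(\<lambda>m :: nat^3. x ^ mdeg m) summable_on UNIV"
proof -
  have g: "(\<lambda>n. x ^ n) summable_on UNIV"
    using assms by (intro norm_summable_imp_summable_on) (auto intro: summable_geometric)
  have *: "(\<lambda>(i, j). x ^ i * (h j :: real)) summable_on UNIV" if "h summable_on (UNIV :: 'b set)" "\<And>j. h j \<ge> 0" for h :: "'b \<Rightarrow> real"
  proof -
    have "(\<lambda>(i, j). x ^ i * h j) summable_on UNIV \<times> UNIV"
      by (rule summable_on_SigmaI[where g = "\<lambda>i. x ^ i * (\<Sum>\<^sub>\<infinity>j. h j)"])
         (use assms that in \<open>auto intro!: has_sum_cmult_right has_sum_infsum summable_on_cmult_left g\<close>)
    then show ?thesis by simp
  qed
  have s: "(\<lambda>(i, j, k). x ^ i * (x ^ j * x ^ k)) summable_on UNIV"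
    using *[OF *[OF g, unfolded case_prod_unfold]] assms by (simp add: case_prod_unfold)
  have bij: "bij_betw (\<lambda>m :: nat^3. (m $ 1, m $ 2, m $ 3)) UNIV UNIV"
    by (rule bij_betwI[of _ _ _ "\<lambda>(i, j, k). vector [i, j, k]"]) (auto simp: vector_3 vector3_nth_eta)
  show ?thesis
    using summable_on_reindex_bij_betw[OF bij, of "\<lambda>(i, j, k). x ^ i * (x ^ j * x ^ k)"] s
    by (simp add: mdeg_3 power_add mult.assoc)
qed

text \<open>
  Osgood's lemma: expand in one variable at a time. The coefficients of each expansion are Cauchy
  integrals, hence continuous and holomorphic in the remaining variables, and Cauchy's estimates bound
  the final coefficients by \<open>M / r\<^bsup>mdeg m\<^esup>\<close>.
\<close>

theorem osgood3:
  fixes g :: "complex \<Rightarrow> complex \<Rightarrow> complex \<Rightarrow> complex"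
  assumes r: "0 < r"
    and cont: "continuous_on (cball 0 r \<times> cball 0 r \<times> cball 0 r) (\<lambda>(a, b, c). g a b c)"
    and h1: "\<And>b c. norm b \<le> r \<Longrightarrow> norm c \<le> r \<Longrightarrow> (\<lambda>a. g a b c) holomorphic_on ball 0 r"
    and h2: "\<And>a c. norm a \<le> r \<Longrightarrow> norm c \<le> r \<Longrightarrow> (\<lambda>b. g a b c) holomorphic_on ball 0 r"
    and h3: "\<And>a b. norm a \<le> r \<Longrightarrow> norm b \<le> r \<Longrightarrow> (\<lambda>c. g a b c) holomorphic_on ball 0 r"
  shows "\<exists>F. has_fps3_expansion (\<lambda>z. g (z $ 1) (z $ 2) (z $ 3)) F"
proof -
  let ?K = "cball (0::complex) r"
  have "compact ((\<lambda>(a, b, c). g a b c) ` (?K \<times> ?K \<times> ?K))"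
    by (intro compact_continuous_image cont compact_Times compact_cball)
  then obtain M where M: "\<And>y. y \<in> (\<lambda>(a, b, c). g a b c) ` (?K \<times> ?K \<times> ?K) \<Longrightarrow> norm y \<le> M"
    using compact_imp_bounded bounded_iff by metis
  have M1: "norm (g a b c) \<le> M" if "norm a \<le> r" "norm b \<le> r" "norm c \<le> r" for a b c
    using that by (intro M) (auto intro!: image_eqI[of _ _ "(a, b, c)"])
  \<comment> \<open>The coefficients after expansion in the third, the second and the first variable.\<close>
  define C1 where "C1 k a b = cauchy_coeff r k (\<lambda>c. g a b c)" for k a b
  define C2 where "C2 k j a = cauchy_coeff r j (\<lambda>b. C1 k a b)" for k j a
  define C3 where "C3 k j i = cauchy_coeff r i (\<lambda>a. C2 k j a)" for k j i
  have cont1: "continuous_on (?K \<times> ?K) (\<lambda>(a, b). C1 k a b)" for k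
  proof -
    have "continuous_on ((?K \<times> ?K) \<times> ?K) (\<lambda>x. (\<lambda>(a, b, c). g a b c) (fst (fst x), snd (fst x), snd x))"
      by (rule continuous_on_compose2[OF cont]) (auto intro!: continuous_intros)
    then have "continuous_on (?K \<times> ?K) (\<lambda>p. cauchy_coeff r k (\<lambda>c. g (fst p) (snd p) c))"
      by (intro cauchy_coeff_continuous[OF r]) (simp add: case_prod_unfold)
    then show ?thesis by (simp add: C1_def case_prod_unfold)
  qed
  have cont_sec: "continuous_on ?K (\<lambda>c. g a b c)" if "norm a \<le> r" "norm b \<le> r" for a b
  proof -
    have "continuous_on ?K (\<lambda>c. (\<lambda>(a, b, c). g a b c) (a, b, c))"
      by (rule continuous_on_compose2[OF cont]) (use that in \<open>auto intro!: continuous_intros\<close>)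
    then show ?thesis by simp
  qed
  have cont1_sec: "continuous_on ?K (\<lambda>b. C1 k a b)" if "norm a \<le> r" for a k
  proof -
    have "continuous_on ?K (\<lambda>b. (\<lambda>(a, b). C1 k a b) (a, b))"
      by (rule continuous_on_compose2[OF cont1]) (use that in \<open>auto intro!: continuous_intros\<close>)
    then show ?thesis by simp
  qed
  have holo1a: "(\<lambda>a. C1 k a b) holomorphic_on ball 0 r" if "norm b \<le> r" for k b
    unfolding C1_def
  proof (rule cauchy_coeff_holomorphic[OF r])
    have "continuous_on (ball 0 r \<times> ?K) (\<lambda>x. (\<lambda>(a, b, c). g a b c) (fst x, b, snd x))"
      by (rule continuous_on_compose2[OF cont]) (use that in \<open>auto intro!: continuous_intros\<close>)
    then show "continuous_on (ball 0 r \<times> ?K) (\<lambda>(s, u). g s b u)" by (simp add: case_prod_unfold)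
  qed (use that h1 in auto)
  have holo1b: "(\<lambda>b. C1 k a b) holomorphic_on ball 0 r" if "norm a \<le> r" for k a
    unfolding C1_def
  proof (rule cauchy_coeff_holomorphic[OF r])
    have "continuous_on (ball 0 r \<times> ?K) (\<lambda>x. (\<lambda>(a, b, c). g a b c) (a, fst x, snd x))"
      by (rule continuous_on_compose2[OF cont]) (use that in \<open>auto intro!: continuous_intros\<close>)
    then show "continuous_on (ball 0 r \<times> ?K) (\<lambda>(s, u). g a s u)" by (simp add: case_prod_unfold)
  qed (use that h2 in auto)
  have cont2: "continuous_on ?K (\<lambda>a. C2 k j a)" for k j
    unfolding C2_def by (intro cauchy_coeff_continuous[OF r] cont1)
  have holo2: "(\<lambda>a. C2 k j a) holomorphic_on ball 0 r" for k j
    unfolding C2_def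
  proof (rule cauchy_coeff_holomorphic[OF r])
    show "continuous_on (ball 0 r \<times> ?K) (\<lambda>(s, u). C1 k s u)"
      by (rule continuous_on_subset[OF cont1]) auto
  qed (use holo1a in auto)
  have exp1: "norm (C1 k a b) \<le> M / r ^ k" "norm c < r \<Longrightarrow> (\<lambda>k. C1 k a b * c ^ k) sums g a b c"
    if "norm a \<le> r" "norm b \<le> r" for a b c k
    unfolding C1_def
    using cauchy_coeff_expansion[OF r cont_sec[OF that] h3[OF that], of M] M1 that by auto
  have exp2: "norm (C2 k j a) \<le> M / r ^ k / r ^ j" "norm b < r \<Longrightarrow> (\<lambda>j. C2 k j a * b ^ j) sums C1 k a b"
    if "norm a \<le> r" for a b k j
    unfolding C2_def
    using cauchy_coeff_expansion[OF r cont1_sec[OF that] holo1b[OF that], of k "M / r ^ k"] exp1(1) that by auto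
  have exp3: "norm (C3 k j i) \<le> M / r ^ k / r ^ j / r ^ i" "norm a < r \<Longrightarrow> (\<lambda>i. C3 k j i * a ^ i) sums C2 k j a"
    for a k j i
    unfolding C3_def
    using cauchy_coeff_expansion[OF r cont2 holo2, of k j "M / r ^ k / r ^ j"] exp2(1) by auto
  define F where "F = Abs_fps3 (\<lambda>m. C3 (m $ 3) (m $ 2) (m $ 1))"
  let ?\<rho> = "r / 2"
  have conv: "converges3 ?\<rho> F"
    unfolding converges3_def
  proof (rule summable_on_comparison_test)
    show "(\<lambda>m :: nat^3. M * (1 / 2) ^ mdeg m) summable_on UNIV"
      by (intro summable_on_cmult_right geometric_multiindex_summable) auto
    fix m :: "nat^3"
    have "norm (coeff3 F m) * ?\<rho> ^ mdeg m \<le> (M / r ^ m $ 3 / r ^ m $ 2 / r ^ m $ 1) * ?\<rho> ^ mdeg m"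
      using r exp3(1) by (intro mult_right_mono) (auto simp: F_def)
    also have "\<dots> = M * (1 / 2) ^ mdeg m"
      using r by (simp add: mdeg_3 power_add power_divide field_simps)
    finally show "norm (coeff3 F m) * ?\<rho> ^ mdeg m \<le> M * (1 / 2) ^ mdeg m" .
  qed (use r in auto)
  \<comment> \<open>The factor \<open>e\<close> collects the powers of the variables that have already been treated.\<close>
  have geom: "((\<lambda>n. c n * w ^ n * e) has_sum (s * e)) UNIV"
    if c: "\<And>n. norm (c n) \<le> B / r ^ n" and w: "norm w \<le> r / 2" and "(\<lambda>n. c n * w ^ n) sums s"
    for c :: "nat \<Rightarrow> complex" and B w e s
  proof -
    have "0 \<le> norm (c 0)" by simp
    also have "\<dots> \<le> B" using c[of 0] by simp
    finally have "B \<ge> 0" .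
    have "norm (c n * w ^ n) \<le> B * (1 / 2) ^ n" for n
    proof -
      have "norm (c n * w ^ n) \<le> B / r ^ n * (r / 2) ^ n"
        unfolding norm_mult norm_power using \<open>B \<ge> 0\<close>
        by (intro mult_mono c power_mono w) (use r in auto)
      also have "\<dots> = B * (1 / 2) ^ n" using r by (simp add: power_divide)
      finally show ?thesis .
    qed
    then have "summable (\<lambda>n. norm (c n * w ^ n))"
      using summable_comparison_test'[of "\<lambda>n. B * (1 / 2) ^ n" 0 "\<lambda>n. norm (c n * w ^ n)"]
        summable_mult[OF summable_geometric[of "1 / 2 :: real"], of B] by simp
    from norm_summable_imp_has_sum[OF this that(3)] show ?thesis by (rule has_sum_cmult_left)
  qed
  have val: "eval3 F z = g (z $ 1) (z $ 2) (z $ 3)" if z: "z \<in> polydisc ?\<rho>" for z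
  proof -
    let ?t = "\<lambda>((k, j), i). C3 k j i * z $ 1 ^ i * (z $ 2 ^ j * z $ 3 ^ k)"
    have z2: "norm (z $ i) \<le> r / 2" for i by (rule polydisc_norm_le[OF z])
    have zr: "norm (z $ i) < r" "norm (z $ i) \<le> r" for i using z2[of i] r by linarith+
    have bij: "bij_betw (\<lambda>m :: nat^3. ((m $ 3, m $ 2), m $ 1)) UNIV UNIV"
      by (rule bij_betwI[of _ _ _ "\<lambda>((k, j), i). vector [i, j, k]"]) (auto simp: vector_3 vector3_nth_eta)
    have tm: "?t ((m $ 3, m $ 2), m $ 1) = coeff3 F m * monom3 z m" for m
      by (simp add: F_def monom3_3 mult_ac)
    have "(?t has_sum eval3 F z) UNIV"
      using has_sum_reindex_bij_betw[OF bij, of ?t "eval3 F z"] eval3_has_sum[OF conv z] unfolding tm by blast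
    then have t: "(?t has_sum eval3 F z) (UNIV \<times> UNIV)" by simp
    have "((\<lambda>(k, j). C2 k j (z $ 1) * (z $ 2 ^ j * z $ 3 ^ k)) has_sum eval3 F z) UNIV"
    proof (rule has_sum_SigmaD[OF t])
      fix x :: "nat \<times> nat"
      obtain k j where x: "x = (k, j)" by fastforce
      show "((\<lambda>y. ?t (x, y)) has_sum (case x of (k, j) \<Rightarrow> C2 k j (z $ 1) * (z $ 2 ^ j * z $ 3 ^ k))) UNIV"
        unfolding x by (simp, rule geom[OF exp3(1) z2 exp3(2)[OF zr(1)]])
    qed
    then have t2: "((\<lambda>(k, j). C2 k j (z $ 1) * (z $ 2 ^ j * z $ 3 ^ k)) has_sum eval3 F z) (UNIV \<times> UNIV)"
      by simp
    have "((\<lambda>k. C1 k (z $ 1) (z $ 2) * z $ 3 ^ k) has_sum eval3 F z) UNIV"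
    proof (rule has_sum_SigmaD[OF t2])
      fix k
      show "((\<lambda>j. case (k, j) of (k, j) \<Rightarrow> C2 k j (z $ 1) * (z $ 2 ^ j * z $ 3 ^ k)) has_sum C1 k (z $ 1) (z $ 2) * z $ 3 ^ k) UNIV"
        using geom[OF exp2(1)[OF zr(2)[of 1], of k] z2[of 2] exp2(2)[OF zr(2)[of 1] zr(1)[of 2], of k], of "z $ 3 ^ k"]
        by (simp add: mult.assoc)
    qed
    from has_sum_imp_sums[OF this] show ?thesis
      using exp1(2)[OF zr(2)[of 1] zr(2)[of 2] zr(1)[of 3]] sums_unique2 by blast
  qed
  have "has_fps3_expansion (\<lambda>z. g (z $ 1) (z $ 2) (z $ 3)) F"
    by (rule has_fps3_expansion_evalI[OF _ conv]) (use r val in auto)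
  then show ?thesis by blast
qed

section \<open>Hypersurfaces as complex submanifolds\<close>

lemma DERIV_recenter:
  assumes "(f has_field_derivative D) (at 0)"
  shows "((\<lambda>s. f (s - t)) has_field_derivative D) (at (t :: 'a :: real_normed_field))"
proof -
  have "((\<lambda>s. s - t) has_field_derivative 1) (at t)" by (auto intro!: derivative_eq_intros)
  from DERIV_chain2[OF _ this, of f D] show ?thesis using assms by simp
qed

text \<open>
  Continuity together with complex differentiability along lines: a condition that is easy to verify
  for inverse maps and that yields power series expansions by Osgood's lemma.
\<close>

definition holomorphic3_on :: "(complex^3) set \<Rightarrow> (complex^3 \<Rightarrow> complex) \<Rightarrow> bool" where
  "holomorphic3_on U f \<longleftrightarrow> continuous_on U f \<and>
     (\<forall>p\<in>U. \<forall>u. (\<lambda>t. f (p + t *s u)) field_differentiable at 0)"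

lemma norm_le_sum3: "norm (z :: complex^3) \<le> norm (z $ 1) + norm (z $ 2) + norm (z $ 3)"
proof -
  have "norm z \<le> (\<Sum>i\<in>UNIV. norm (z $ i))" unfolding norm_vec_def by (intro L2_set_le_sum) auto
  then show ?thesis by (simp add: sum_3)
qed

lemma norm_cvec_smult: "norm (t *s u :: complex^'n) = norm t * norm u"
proof -
  have "(\<Sum>i\<in>UNIV. (norm t * norm (u $ i))\<^sup>2) = (norm t)\<^sup>2 * (\<Sum>i\<in>UNIV. (norm (u $ i))\<^sup>2)"
    by (simp add: power_mult_distrib sum_distrib_left)
  then show ?thesis by (simp add: norm_vec_def L2_set_def norm_mult real_sqrt_mult)
qed

lemma holomorphic3_on_imp_expansion:
  assumes U: "open U" and f: "holomorphic3_on U f" and p: "p \<in> U"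
  shows "\<exists>F. has_fps3_expansion (\<lambda>z. f (p + z)) F"
proof -
  obtain d where d: "d > 0" "ball p d \<subseteq> U" using U p open_contains_ball by metis
  define r where "r = d / 4"
  have r: "r > 0" using d by (simp add: r_def)
  define E :: "complex \<Rightarrow> complex \<Rightarrow> complex \<Rightarrow> complex^3" where
    "E a b c = (\<chi> i. if i = 1 then a else if i = 2 then b else c)" for a b c
  have E: "E a b c $ 1 = a" "E a b c $ 2 = b" "E a b c $ 3 = c" for a b c
    by (simp_all add: E_def)
  have inU: "p + E a b c \<in> U" if "norm a \<le> r" "norm b \<le> r" "norm c \<le> r" for a b c
  proof -
    have "norm (E a b c) \<le> norm a + norm b + norm c" using norm_le_sum3[of "E a b c"] by (simp add: E)
    then have "norm (E a b c) < d" using that r by (simp add: r_def)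
    then show ?thesis using d(2) by (auto simp: dist_norm)
  qed
  define g where "g a b c = f (p + E a b c)" for a b c
  have contf: "continuous_on U f" using f by (simp add: holomorphic3_on_def)
  have cont: "continuous_on (cball 0 r \<times> cball 0 r \<times> cball 0 r) (\<lambda>(a, b, c). g a b c)"
  proof -
    have "continuous_on (cball 0 r \<times> cball 0 r \<times> cball 0 r) (\<lambda>x. p + E (fst x) (fst (snd x)) (snd (snd x)))"
      unfolding E_def
    proof (intro continuous_intros continuous_on_vec_lambda)
      show "continuous_on (cball 0 r \<times> cball 0 r \<times> cball 0 r) (\<lambda>x. if i = 1 then fst x else if i = 2 then fst (snd x) else snd (snd x))" for i :: 3
        by (cases "i = 1"; cases "i = 2"; simp; intro continuous_intros)
    qed
    then have "continuous_on (cball 0 r \<times> cball 0 r \<times> cball 0 r) (\<lambda>x. f (p + E (fst x) (fst (snd x)) (snd (snd x))))"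
      by (rule continuous_on_compose2[OF contf]) (auto intro!: inU)
    then show ?thesis by (simp add: g_def case_prod_unfold)
  qed
  have line: "(\<lambda>s. f (q s)) holomorphic_on ball 0 r"
    if q: "\<And>s. norm s < r \<Longrightarrow> q s \<in> U" and lin: "\<And>s s'. q s = q s' + (s - s') *s u" for q u
  proof (rule holomorphic_onI)
    fix s0 :: complex assume s0: "s0 \<in> ball 0 r"
    then have "(\<lambda>t. f (q s0 + t *s u)) field_differentiable at 0"
      using f q[of s0] by (auto simp: holomorphic3_on_def)
    then obtain D where "((\<lambda>t. f (q s0 + t *s u)) has_field_derivative D) (at 0)"
      by (auto simp: field_differentiable_def)
    then have "((\<lambda>s. f (q s0 + (s - s0) *s u)) has_field_derivative D) (at s0)"
      by (rule DERIV_recenter)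
    moreover have "(\<lambda>s. f (q s0 + (s - s0) *s u)) = (\<lambda>s. f (q s))"
      by (rule ext) (metis lin)
    ultimately show "(\<lambda>s. f (q s)) field_differentiable at s0 within ball 0 r"
      by (metis field_differentiable_at_within field_differentiable_def)
  qed
  have "\<exists>F. has_fps3_expansion (\<lambda>z. g (z $ 1) (z $ 2) (z $ 3)) F"
  proof (rule osgood3[OF r cont])
    fix b c :: complex assume "norm b \<le> r" "norm c \<le> r"
    then show "(\<lambda>a. g a b c) holomorphic_on ball 0 r"
      unfolding g_def
      by (intro line[where u = "axis 1 1"] inU)
         (auto simp: vec_eq_iff forall_3 E axis_def)
  next
    fix a c :: complex assume "norm a \<le> r" "norm c \<le> r"
    then show "(\<lambda>b. g a b c) holomorphic_on ball 0 r"
      unfolding g_def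
      by (intro line[where u = "axis 2 1"] inU)
         (auto simp: vec_eq_iff forall_3 E axis_def)
  next
    fix a b :: complex assume "norm a \<le> r" "norm b \<le> r"
    then show "(\<lambda>c. g a b c) holomorphic_on ball 0 r"
      unfolding g_def
      by (intro line[where u = "axis 3 1"] inU)
         (auto simp: vec_eq_iff forall_3 E axis_def)
  qed
  moreover have "E (z $ 1) (z $ 2) (z $ 3) = z" for z
    by (simp add: vec_eq_iff forall_3 E)
  ultimately show ?thesis by (simp add: g_def)
qed

lemma holomorphic3_on_component: "holomorphic3_on U (\<lambda>z. z $ i)"
proof -
  have "(\<lambda>t. (p + t *s u) $ i) field_differentiable at 0" for p u :: "complex^3"
    by (simp add: field_differentiable_add field_differentiable_mult)
  then show ?thesis unfolding holomorphic3_on_def by (auto intro!: continuous_intros)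
qed

lemma holomorphic3_on_add:
  "holomorphic3_on U f \<Longrightarrow> holomorphic3_on U g \<Longrightarrow> holomorphic3_on U (\<lambda>z. f z + g z)"
  unfolding holomorphic3_on_def by (auto intro!: continuous_intros field_differentiable_add)

lemma holomorphic3_on_cmult: "holomorphic3_on U f \<Longrightarrow> holomorphic3_on U (\<lambda>z. c * f z)"
  unfolding holomorphic3_on_def by (auto intro!: continuous_intros field_differentiable_mult)

lemma holomorphic3_on_subset: "holomorphic3_on U f \<Longrightarrow> V \<subseteq> U \<Longrightarrow> holomorphic3_on V f"
  unfolding holomorphic3_on_def using continuous_on_subset by blast

lemma holomorphic_atI:
  assumes "open U" "\<And>i. holomorphic3_on U (\<lambda>z. \<phi> z $ i)" "p \<in> U"
  shows "holomorphic_at \<phi> p"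
  unfolding holomorphic_at_def using holomorphic3_on_imp_expansion[OF assms(1,2,3)] by blast

lemma complex_submanifold_open:
  assumes "open M"
  shows "complex_submanifold 3 M"
  unfolding complex_submanifold_def
proof
  fix p assume "p \<in> M"
  have "holomorphic_at id z" for z
    by (rule holomorphic_atI[of UNIV]) (auto intro: holomorphic3_on_component)
  then show "\<exists>U V \<phi> \<psi> S. open U \<and> open V \<and> p \<in> U \<and>
        (\<forall>z\<in>U. holomorphic_at \<phi> z) \<and> (\<forall>w\<in>V. holomorphic_at \<psi> w) \<and>
        \<phi> ` U = V \<and> \<psi> ` V = U \<and> (\<forall>z\<in>U. \<psi> (\<phi> z) = z) \<and> (\<forall>w\<in>V. \<phi> (\<psi> w) = w) \<and>
        card S = 3 \<and> \<phi> ` (M \<inter> U) = {w \<in> V. \<forall>i. i \<notin> S \<longrightarrow> w $ i = (0::complex)}"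
    using assms \<open>p \<in> M\<close>
    by (intro exI[of _ M] exI[of _ M] exI[of _ id] exI[of _ id] exI[of _ UNIV]) auto
qed

text \<open>
  The mean value estimate for \<open>h(p + t u) - t D\<close> on \<open>[0, 1]\<close>: its derivative is small because the
  partial derivatives \<open>g\<^sub>j\<close> are continuous.
\<close>

lemma line_derivatives_imp_has_derivative:
  fixes h :: "complex^3 \<Rightarrow> complex"
  assumes U: "open U" and p: "p \<in> U"
    and d: "\<And>q u. q \<in> U \<Longrightarrow> ((\<lambda>t. h (q + t *s u)) has_field_derivative (\<Sum>j\<in>UNIV. u $ j * g j q)) (at 0)"
    and cont: "\<And>j. continuous_on U (g j)"
  shows "(h has_derivative (\<lambda>u. \<Sum>j\<in>UNIV. u $ j * g j p)) (at p)"
  unfolding has_derivative_within_alt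
proof (intro conjI allI impI)
  show "bounded_linear (\<lambda>u :: complex^3. \<Sum>j\<in>UNIV. u $ j * g j p)"
    by (intro bounded_linear_sum bounded_linear_mult_const bounded_linear_vec_nth)
  fix e :: real assume e: "e > 0"
  have "\<exists>\<delta>>0. \<forall>q. dist q p < \<delta> \<longrightarrow> q \<in> U \<and> norm (g j q - g j p) < e / 3" for j
  proof -
    obtain d1 where d1: "d1 > 0" "ball p d1 \<subseteq> U" using U p open_contains_ball by metis
    obtain d2 where d2: "d2 > 0" "\<And>q. q \<in> U \<Longrightarrow> dist q p < d2 \<Longrightarrow> dist (g j q) (g j p) < e / 3"
      using cont[of j] p e unfolding continuous_on_iff by (metis divide_pos_pos zero_less_numeral)
    then show ?thesis using d1
      by (intro exI[of _ "min d1 d2"]) (auto simp: dist_norm[symmetric] dist_commute subset_eq)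
  qed
  then obtain \<delta> where \<delta>: "\<And>j. \<delta> j > 0" "\<And>j q. dist q p < \<delta> j \<Longrightarrow> q \<in> U \<and> norm (g j q - g j p) < e / 3"
    by metis
  define d0 where "d0 = Min (range \<delta>)"
  have d0: "d0 > 0" "d0 \<le> \<delta> j" for j using \<delta>(1) by (auto simp: d0_def Min_gr_iff)
  show "\<exists>d>0. \<forall>y\<in>UNIV. norm (y - p) < d \<longrightarrow>
      norm (h y - h p - (\<Sum>j\<in>UNIV. (y - p) $ j * g j p)) \<le> e * norm (y - p)"
  proof (intro exI[of _ d0] conjI ballI impI d0)
    fix y assume y: "norm (y - p) < d0"
    define u where "u = y - p"
    let ?D = "\<Sum>j\<in>UNIV. u $ j * g j p"
    define k where "k t = h (p + t *s u) - t * ?D" for t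
    have near: "q \<in> U" "norm (g j q - g j p) < e / 3" if "q = p + t *s u" "norm t \<le> 1" for q t j
    proof -
      have "dist q p = norm t * norm u" using that(1) by (simp add: dist_norm norm_cvec_smult)
      also have "\<dots> \<le> norm u" using that(2) by (simp add: mult_left_le_one_le)
      finally have "dist q p < \<delta> j" for j using y d0(2)[of j] by (simp add: u_def)
      then show "q \<in> U" "norm (g j q - g j p) < e / 3" using \<delta>(2) by blast+
    qed
    have dk: "(k has_field_derivative (\<Sum>j\<in>UNIV. u $ j * (g j (p + t *s u) - g j p))) (at t)" if t: "norm t \<le> 1" for t
    proof -
      have "p + t *s u \<in> U" using near(1) t by blast
      from DERIV_recenter[OF d[OF this]]
      have "((\<lambda>s. h ((p + t *s u) + (s - t) *s u)) has_field_derivative (\<Sum>j\<in>UNIV. u $ j * g j (p + t *s u))) (at t)" .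
      moreover have "(p + t *s u) + (s - t) *s u = p + s *s u" for s
        by (simp add: vec_eq_iff algebra_simps)
      ultimately have "((\<lambda>s. h (p + s *s u)) has_field_derivative (\<Sum>j\<in>UNIV. u $ j * g j (p + t *s u))) (at t)"
        by simp
      then have "(k has_field_derivative ((\<Sum>j\<in>UNIV. u $ j * g j (p + t *s u)) - ?D)) (at t)"
        unfolding k_def by (auto intro!: derivative_eq_intros)
      then show ?thesis by (simp add: right_diff_distrib sum_subtractf)
    qed
    have "norm (k 1 - k 0) \<le> (e * norm u) * norm (1 - 0 :: complex)"
    proof (rule field_differentiable_bound[where S = "cball 0 1" and f = k
          and f' = "\<lambda>t. \<Sum>j\<in>UNIV. u $ j * (g j (p + t *s u) - g j p)"])
      fix t :: complex assume t: "t \<in> cball 0 1"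
      then show "(k has_field_derivative (\<Sum>j\<in>UNIV. u $ j * (g j (p + t *s u) - g j p))) (at t within cball 0 1)"
        using has_field_derivative_at_within[OF dk] by simp
      have "norm (u $ j * (g j (p + t *s u) - g j p)) \<le> norm u * (e / 3)" for j
        unfolding norm_mult using near(2)[OF refl, of t j] t
        by (intro mult_mono Finite_Cartesian_Product.norm_nth_le) auto
      then have "norm (\<Sum>j\<in>UNIV. u $ j * (g j (p + t *s u) - g j p)) \<le> (\<Sum>j\<in>(UNIV::3 set). norm u * (e / 3))"
        by (intro sum_norm_le) auto
      also have "\<dots> = e * norm u" by simp
      finally show "norm (\<Sum>j\<in>UNIV. u $ j * (g j (p + t *s u) - g j p)) \<le> e * norm u" .
    qed auto
    then show "norm (h y - h p - (\<Sum>j\<in>UNIV. (y - p) $ j * g j p)) \<le> e * norm (y - p)"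
      by (simp add: k_def u_def algebra_simps)
  qed
qed

text \<open>
  The map \<open>\<phi>\<close> moves \<open>q\<close> along \<open>v\<close> until its \<open>k\<close>-th coordinate is \<open>0\<close>, and records \<open>h q\<close> in that
  coordinate. It is a local biholomorphism where the derivative of \<open>h\<close> along \<open>v\<close> is nonzero, and it turns
  the level sets of \<open>h\<close> into planes. Using the direction \<open>v\<close> instead of a coordinate direction has the
  effect that \<open>\<phi>\<close> takes points on one line in direction \<open>v\<close> with equal values of \<open>h\<close> to the same point.
\<close>

theorem hypersurface_chart:
  fixes h :: "complex^3 \<Rightarrow> complex"
  assumes U: "open U" and p: "p \<in> U"
    and d: "\<And>q u. q \<in> U \<Longrightarrow> ((\<lambda>t. h (q + t *s u)) has_field_derivative (\<Sum>j\<in>UNIV. u $ j * g j q)) (at 0)"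
    and cont: "\<And>j. continuous_on U (g j)"
    and v: "v $ k \<noteq> 0" and nz: "(\<Sum>j\<in>UNIV. v $ j * g j p) \<noteq> 0"
  defines "\<phi> \<equiv> \<lambda>q. q - (q $ k / v $ k) *s v + h q *s axis k 1"
  obtains U' V \<psi> where "open U'" "p \<in> U'" "U' \<subseteq> U" "open V" "\<phi> ` U' = V" "\<psi> ` V = U'"
    "\<And>z. z \<in> U' \<Longrightarrow> \<psi> (\<phi> z) = z" "\<And>w. w \<in> V \<Longrightarrow> \<phi> (\<psi> w) = w"
    "\<And>i. holomorphic3_on U' (\<lambda>z. \<phi> z $ i)" "\<And>i. holomorphic3_on V (\<lambda>w. \<psi> w $ i)"
    "continuous_on V \<psi>"
proof -
  define D where "D q u = (\<Sum>j\<in>UNIV. u $ j * g j q)" for q u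
  define L where "L q u = u - (u $ k / v $ k) *s v + D q u *s axis k 1" for q u :: "complex^3"
  have dh: "(h has_derivative D q) (at q)" if "q \<in> U" for q
    using line_derivatives_imp_has_derivative[OF U that d cont] unfolding D_def .
  have bl_smult: "bounded_linear (\<lambda>c :: complex. c *s (w :: complex^3))" for w
    by (rule bounded_linear_intro[of _ "norm w"])
       (auto simp: vec_eq_iff algebra_simps norm_cvec_smult)
  have bl_nth: "bounded_linear (\<lambda>u :: complex^3. u $ k / v $ k)"
    by (intro bounded_linear_divide[THEN bounded_linear_compose] bounded_linear_vec_nth)
  have d\<phi>: "(\<phi> has_derivative L q) (at q)" if q: "q \<in> U" for q
    unfolding \<phi>_def L_def
    by (intro has_derivative_add has_derivative_diff has_derivative_ident
        bounded_linear.has_derivative[OF bl_smult] bounded_linear.has_derivative[OF bl_nth] dh[OF q])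
  have blL: "bounded_linear (L q)" if "q \<in> U" for q
    using d\<phi>[OF that] by (rule has_derivative_bounded_linear)
  have L_smult: "L q (t *s u) = t *s L q u" for q t u
    by (simp add: L_def D_def vec_eq_iff sum_distrib_left algebra_simps)
  have contL: "continuous_on U (\<lambda>q. Blinfun (L q))"
  proof (rule continuous_on_blinfun_componentwise)
    fix i :: "complex^3"
    have "continuous_on U (\<lambda>q. L q i)"
      unfolding L_def D_def
      by (intro continuous_intros bounded_linear.continuous_on[OF bl_smult] cont)
    then show "continuous_on U (\<lambda>q. blinfun_apply (Blinfun (L q)) i)"
      by (subst continuous_on_cong[OF refl]) (simp_all add: bounded_linear_Blinfun_apply blL)
  qed
  have inj: "inj (L p)"
  proof -
    have "u = 0" if "L p u = 0" for u
    proof -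
      \<comment> \<open>The \<open>k\<close>-th coordinate of \<open>L p u\<close> is \<open>D p u\<close> alone, the other terms cancelling there. If it is
        zero, then \<open>u\<close> is a multiple of \<open>v\<close>, along which \<open>D p\<close> is injective.\<close>
      have "L p u $ k = D p u" using v by (simp add: L_def axis_def)
      then have D0: "D p u = 0" using that by simp
      then have u: "u = (u $ k / v $ k) *s v" using that by (simp add: L_def)
      have "D p u = (u $ k / v $ k) * D p v"
        by (subst u) (simp add: D_def sum_distrib_left mult.assoc)
      then have "u $ k / v $ k = 0" using D0 nz by (simp add: D_def)
      with u have "u = 0 *s v" by (simp only:)
      then show ?thesis by simp
    qed
    then show ?thesis using linear_injective_0[OF bounded_linear.linear[OF blL[OF p]]] by blast
  qed
  obtain G where G: "linear G" "G \<circ> L p = id"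
    using linear_injective_left_inverse[OF bounded_linear.linear[OF blL[OF p]] inj] by blast
  have blG: "bounded_linear G" using G(1) by (simp add: linear_conv_bounded_linear)
  have inv: "Blinfun G o\<^sub>L Blinfun (L p) = id_blinfun"
    by (rule blinfun_eqI) (use G(2) blG blL[OF p] in \<open>simp add: bounded_linear_Blinfun_apply fun_eq_iff\<close>)
  have d\<phi>': "(\<phi> has_derivative blinfun_apply (Blinfun (L q))) (at q)" if "q \<in> U" for q
    using d\<phi>[OF that] by (simp add: bounded_linear_Blinfun_apply blL that)
  obtain U' V \<psi> \<psi>' where *: "open U'" "U' \<subseteq> U" "p \<in> U'" "open V" "\<phi> p \<in> V" "homeomorphism U' V \<phi> \<psi>"
    "\<And>y. y \<in> V \<Longrightarrow> (\<psi> has_derivative (\<psi>' y)) (at y)"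
    "\<And>y. y \<in> V \<Longrightarrow> \<psi>' y = Hilbert_Choice.inv (blinfun_apply (Blinfun (L (\<psi> y))))"
    "\<And>y. y \<in> V \<Longrightarrow> bij (blinfun_apply (Blinfun (L (\<psi> y))))"
    by (rule inverse_function_theorem[OF U d\<phi>' contL p inv], assumption, rule that)
  have \<psi>U: "\<psi> y \<in> U" if "y \<in> V" for y
    using *(2,6) that by (auto simp: homeomorphism_def)
  have holo\<phi>: "holomorphic3_on U' (\<lambda>z. \<phi> z $ i)" for i
  proof -
    have "continuous_on U h"
      using dh has_derivative_continuous_on has_derivative_at_withinI by blast
    then have "holomorphic3_on U h"
      using d unfolding holomorphic3_on_def field_differentiable_def by blast
    then have "holomorphic3_on U' h" using *(2) holomorphic3_on_subset by blast
    then have "holomorphic3_on U' (\<lambda>q. q $ i + (- (v $ i / v $ k)) * q $ k + axis k 1 $ i * h q)"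
      by (intro holomorphic3_on_add holomorphic3_on_cmult holomorphic3_on_component)
    moreover have "q $ i + (- (v $ i / v $ k)) * q $ k + axis k 1 $ i * h q = \<phi> q $ i" for q
      by (simp add: \<phi>_def)
    ultimately show ?thesis by simp
  qed
  have cont\<psi>: "continuous_on V \<psi>" using *(6) by (simp add: homeomorphism_def)
  have holo\<psi>: "holomorphic3_on V (\<lambda>w. \<psi> w $ i)" for i
    unfolding holomorphic3_on_def
  proof (intro conjI ballI allI)
    show "continuous_on V (\<lambda>w. \<psi> w $ i)" using cont\<psi> by (intro continuous_intros)
    fix y and w :: "complex^3" assume y: "y \<in> V"
    have Lb: "blinfun_apply (Blinfun (L (\<psi> y))) = L (\<psi> y)"
      by (simp add: bounded_linear_Blinfun_apply blL \<psi>U y)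
    have bij: "bij (L (\<psi> y))" and \<psi>': "\<psi>' y = Hilbert_Choice.inv (L (\<psi> y))"
      using *(8,9)[OF y] by (simp_all add: Lb)
    have sm: "\<psi>' y (t *s w) = t *s \<psi>' y w" for t
      unfolding \<psi>' using bij by (metis L_smult bij_inv_eq_iff)
    have line: "((\<lambda>t. y + t *s w) has_derivative (\<lambda>t. t *s w)) (at 0)"
      using has_derivative_add[OF has_derivative_const[of y] bounded_linear_imp_has_derivative[OF bl_smult[of w]], of "at 0"]
      by simp
    have "(\<psi> has_derivative \<psi>' y) (at (y + 0 *s w))" using *(7)[OF y] by simp
    from has_derivative_compose[OF line this]
    have "((\<lambda>t. \<psi> (y + t *s w)) has_derivative (\<lambda>t. \<psi>' y (t *s w))) (at 0)" .
    then have "((\<lambda>t. \<psi> (y + t *s w) $ i) has_derivative (\<lambda>t. \<psi>' y (t *s w) $ i)) (at 0)"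
      by (rule bounded_linear.has_derivative[OF bounded_linear_vec_nth])
    moreover have "(\<lambda>t. \<psi>' y (t *s w) $ i) = (*) (\<psi>' y w $ i)"
      by (rule ext) (simp add: sm mult.commute)
    ultimately show "(\<lambda>t. \<psi> (y + t *s w) $ i) field_differentiable at 0"
      by (auto simp: field_differentiable_def has_field_derivative_def)
  qed
  have h: "\<phi> ` U' = V" "\<psi> ` V = U'" "\<And>z. z \<in> U' \<Longrightarrow> \<psi> (\<phi> z) = z" "\<And>w. w \<in> V \<Longrightarrow> \<phi> (\<psi> w) = w"
    using *(6) by (auto simp: homeomorphism_def)
  show ?thesis
    by (rule that[OF *(1,3,2,4) h holo\<phi> holo\<psi> cont\<psi>])
qed

lemma complex_submanifold_hypersurface:
  fixes h :: "complex^3 \<Rightarrow> complex"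
  assumes chart: "open U" "open V" "\<phi> ` U = V" "\<psi> ` V = U"
    "\<And>z. z \<in> U \<Longrightarrow> \<psi> (\<phi> z) = z" "\<And>w. w \<in> V \<Longrightarrow> \<phi> (\<psi> w) = w"
    "\<And>i. holomorphic3_on U (\<lambda>z. \<phi> z $ i)" "\<And>i. holomorphic3_on V (\<lambda>w. \<psi> w $ i)" "continuous_on V \<psi>"
    and h: "\<And>z. z \<in> U \<Longrightarrow> \<phi> z $ k = h z" and T: "open T"
  shows "complex_submanifold 2 {z \<in> U. h z = 0 \<and> z \<in> T}"
  unfolding complex_submanifold_def
proof
  let ?M = "{z \<in> U. h z = 0 \<and> z \<in> T}"
  fix p assume p: "p \<in> ?M"
  let ?U = "U \<inter> T" and ?V = "V \<inter> \<psi> -` T"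
  have "open ?V" using chart(2,9) T by (simp add: continuous_open_preimage)
  moreover have "\<forall>z\<in>?U. holomorphic_at \<phi> z" using holomorphic_atI[OF chart(1,7)] by blast
  moreover have "\<forall>w\<in>?V. holomorphic_at \<psi> w" using holomorphic_atI[OF chart(2,8)] by blast
  moreover have "\<phi> ` ?U = ?V"
  proof (intro equalityI subsetI)
    fix w assume w: "w \<in> ?V"
    then have "\<psi> w \<in> ?U" "\<phi> (\<psi> w) = w" using chart(4,6) by auto
    then show "w \<in> \<phi> ` ?U" by force
  next
    fix w assume "w \<in> \<phi> ` ?U"
    then obtain z where "z \<in> U" "z \<in> T" "w = \<phi> z" by blast
    then show "w \<in> ?V" using chart(3,5) by auto
  qed
  moreover have "\<psi> ` ?V = ?U"
  proof (intro equalityI subsetI)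
    fix z assume z: "z \<in> ?U"
    then have "\<phi> z \<in> ?V" "\<psi> (\<phi> z) = z" using chart(3,5) by auto
    then show "z \<in> \<psi> ` ?V" by force
  next
    fix z assume "z \<in> \<psi> ` ?V"
    then obtain w where "w \<in> V" "\<psi> w \<in> T" "z = \<psi> w" by blast
    then show "z \<in> ?U" using chart(4) by auto
  qed
  moreover have "card (UNIV - {k}) = (2 :: nat)" by (simp add: card_Diff_singleton)
  moreover have "\<phi> ` (?M \<inter> ?U) = {w \<in> ?V. \<forall>i. i \<notin> UNIV - {k} \<longrightarrow> w $ i = 0}"
  proof
    show "\<phi> ` (?M \<inter> ?U) \<subseteq> {w \<in> ?V. \<forall>i. i \<notin> UNIV - {k} \<longrightarrow> w $ i = 0}"
      using chart(3,5) h by auto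
    show "{w \<in> ?V. \<forall>i. i \<notin> UNIV - {k} \<longrightarrow> w $ i = 0} \<subseteq> \<phi> ` (?M \<inter> ?U)"
    proof
      fix w assume w: "w \<in> {w \<in> ?V. \<forall>i. i \<notin> UNIV - {k} \<longrightarrow> w $ i = 0}"
      then have "\<psi> w \<in> U" using chart(4) by auto
      then show "w \<in> \<phi> ` (?M \<inter> ?U)"
        using w h[of "\<psi> w"] chart(6)[of w] by (intro image_eqI[of _ _ "\<psi> w"]) auto
    qed
  qed
  ultimately show "\<exists>U V \<phi> \<psi> S. open U \<and> open V \<and> p \<in> U \<and>
        (\<forall>z\<in>U. holomorphic_at \<phi> z) \<and> (\<forall>w\<in>V. holomorphic_at \<psi> w) \<and>
        \<phi> ` U = V \<and> \<psi> ` V = U \<and> (\<forall>z\<in>U. \<psi> (\<phi> z) = z) \<and> (\<forall>w\<in>V. \<phi> (\<psi> w) = w) \<and>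
        card S = 2 \<and> \<phi> ` (?M \<inter> U) = {w \<in> V. \<forall>i. i \<notin> S \<longrightarrow> w $ i = (0::complex)}"
    using chart(1,5,6) T p
    by (intro exI[of _ ?U] exI[of _ ?V] exI[of _ \<phi>] exI[of _ \<psi>] exI[of _ "UNIV - {k}"]) (auto simp: open_Int)
qed

section \<open>Common roots of a flat pair of functions\<close>

text \<open>
  Zeros are removed one at a time, each with its multiplicity; the list repeats a zero according to its
  multiplicity.
\<close>

lemma factor_out_zeros:
  fixes f :: "complex \<Rightarrow> complex"
  assumes "f holomorphic_on ball 0 R" "0 < r" "r < R" "\<And>u. norm u = r \<Longrightarrow> f u \<noteq> 0"
  shows "\<exists>\<rho>s g. set \<rho>s \<subseteq> ball 0 r \<and> g holomorphic_on ball 0 R \<and> (\<forall>u\<in>cball 0 r. g u \<noteq> 0) \<and>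
           (\<forall>u\<in>ball 0 R. f u = (\<Prod>\<rho>\<leftarrow>\<rho>s. u - \<rho>) * g u)"
proof -
  have fin: "finite {u \<in> cball 0 r. f u = 0}"
    if f: "f holomorphic_on ball 0 R" "\<And>u. norm u = r \<Longrightarrow> f u \<noteq> 0" for f :: "complex \<Rightarrow> complex"
  proof (cases "f constant_on ball 0 R")
    case True
    then obtain c where c: "\<And>u. u \<in> ball 0 R \<Longrightarrow> f u = c" by (auto simp: constant_on_def)
    have r0: "norm (of_real r :: complex) = r" using assms(2) by simp
    then have "c \<noteq> 0" using f(2)[OF r0] c[of "of_real r"] assms(3) by simp
    then have "{u \<in> cball 0 r. f u = 0} = {}" using c assms(3) by auto
    then show ?thesis by (simp only: finite.emptyI)
  next
    case False
    then show ?thesis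
      by (intro holomorphic_compact_finite_zeros[OF f(1)]) (use assms in auto)
  qed
  have "\<exists>\<rho>s g. set \<rho>s \<subseteq> ball 0 r \<and> g holomorphic_on ball 0 R \<and> (\<forall>u\<in>cball 0 r. g u \<noteq> 0) \<and>
           (\<forall>u\<in>ball 0 R. f u = (\<Prod>\<rho>\<leftarrow>\<rho>s. u - \<rho>) * g u)"
    if "f holomorphic_on ball 0 R" "\<And>u. norm u = r \<Longrightarrow> f u \<noteq> 0" "card {u \<in> cball 0 r. f u = 0} = n" for f n
    using that
  proof (induction n arbitrary: f)
    case 0
    then have "{u \<in> cball 0 r. f u = 0} = {}" using fin[OF 0(1,2)] by simp
    then show ?case using 0(1) by (intro exI[of _ "[]"] exI[of _ f]) auto
  next
    case (Suc n)
    then have "{u \<in> cball 0 r. f u = 0} \<noteq> {}" by (metis card.empty nat.distinct(1))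
    then obtain p where p: "norm p \<le> r" "f p = 0" by auto
    then have pr: "norm p < r" using Suc.prems(2)[of p] by fastforce
    have pR: "p \<in> ball 0 R" using pr assms(3) by simp
    have "norm (of_real r :: complex) = r" using assms(2) by simp
    from Suc.prems(2)[OF this] have nz: "\<exists>w\<in>ball 0 R. f w \<noteq> 0"
      using assms(2,3) by (intro bexI[of _ "of_real r"]) auto
    define k where "k = nat (zorder f p)"
    define h where "h = zor_poly f p"
    obtain e where k: "k > 0" and e: "e > 0" "cball p e \<subseteq> ball 0 R" "h holomorphic_on cball p e"
       "\<And>w. w \<in> cball p e \<Longrightarrow> f w = h w * (w - p) ^ k \<and> h w \<noteq> 0"
      using zorder_exist_zero[OF Suc.prems(1) _ _ pR nz] p(2) by (auto simp: k_def h_def)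
    define f1 where "f1 w = (if w = p then h p else f w / (w - p) ^ k)" for w
    have f1: "f1 holomorphic_on ball 0 R"
      unfolding f1_def
    proof (rule removable_singularity)
      show "(\<lambda>w. f w / (w - p) ^ k) holomorphic_on ball 0 R - {p}"
        by (intro holomorphic_intros holomorphic_on_subset[OF Suc.prems(1)]) auto
      have "isCont h p" using e(1,3) holomorphic_on_imp_continuous_on continuous_on_interior
        by (metis centre_in_ball interior_cball)
      then have "(h \<longlongrightarrow> h p) (at p)" by (simp add: isCont_def)
      then show "(\<lambda>w. f w / (w - p) ^ k) \<midarrow>p\<rightarrow> h p"
      proof (rule Lim_transform_within_open[of _ _ _ _ "ball p e"])
        fix w assume "w \<in> ball p e" "w \<noteq> p"
        then show "h w = f w / (w - p) ^ k" using e(4)[of w] by simp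
      qed (use e in auto)
    qed simp
    have ff1: "f w = (w - p) ^ k * f1 w" for w
      using p(2) k by (simp add: f1_def)
    have "h p \<noteq> 0" using e(1,4) by simp
    then have zeros: "{u \<in> cball 0 r. f1 u = 0} = {u \<in> cball 0 r. f u = 0} - {p}"
      using ff1 k by (auto simp: f1_def)
    have "card {u \<in> cball 0 r. f1 u = 0} = n"
      unfolding zeros using Suc.prems(3) p fin[OF Suc.prems(1,2)] by simp
    moreover have "f1 u \<noteq> 0" if "norm u = r" for u using ff1[of u] Suc.prems(2)[OF that] by auto
    ultimately obtain \<rho>s g where IH: "set \<rho>s \<subseteq> ball 0 r" "g holomorphic_on ball 0 R" "\<forall>u\<in>cball 0 r. g u \<noteq> 0"
       "\<forall>u\<in>ball 0 R. f1 u = (\<Prod>\<rho>\<leftarrow>\<rho>s. u - \<rho>) * g u"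
      using Suc.IH[OF f1] by blast
    have "(\<Prod>\<rho>\<leftarrow>replicate k p. u - \<rho>) = (u - p) ^ k" for u by (simp add: map_replicate_const prod_list_replicate)
    then show ?case using IH pr ff1
      by (intro exI[of _ "replicate k p @ \<rho>s"] exI[of _ g]) (auto simp: mult.assoc)
  qed
  then show ?thesis using assms by blast
qed

lemma log_derivative_prod_list:
  assumes "u \<notin> set \<rho>s"
  shows "((\<lambda>u. \<Prod>\<rho>\<leftarrow>\<rho>s. u - \<rho> :: complex) has_field_derivative (\<Sum>\<rho>\<leftarrow>\<rho>s. 1 / (u - \<rho>)) * (\<Prod>\<rho>\<leftarrow>\<rho>s. u - \<rho>)) (at u)"
  using assms
proof (induction \<rho>s)
  case (Cons a \<rho>s)
  then have *: "((\<lambda>u. \<Prod>\<rho>\<leftarrow>\<rho>s. u - \<rho>) has_field_derivative (\<Sum>\<rho>\<leftarrow>\<rho>s. 1 / (u - \<rho>)) * (\<Prod>\<rho>\<leftarrow>\<rho>s. u - \<rho>)) (at u)"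
    by simp
  have "((\<lambda>u. (u - a) * (\<Prod>\<rho>\<leftarrow>\<rho>s. u - \<rho>)) has_field_derivative
     ((u - a) * ((\<Sum>\<rho>\<leftarrow>\<rho>s. 1 / (u - \<rho>)) * (\<Prod>\<rho>\<leftarrow>\<rho>s. u - \<rho>)) + 1 * (\<Prod>\<rho>\<leftarrow>\<rho>s. u - \<rho>))) (at u)"
    by (rule DERIV_mult'[OF _ *]) (auto intro!: derivative_eq_intros)
  moreover have "(u - a) * ((\<Sum>\<rho>\<leftarrow>\<rho>s. 1 / (u - \<rho>)) * (\<Prod>\<rho>\<leftarrow>\<rho>s. u - \<rho>)) + 1 * (\<Prod>\<rho>\<leftarrow>\<rho>s. u - \<rho>)
      = (1 / (u - a) + (\<Sum>\<rho>\<leftarrow>\<rho>s. 1 / (u - \<rho>))) * ((u - a) * (\<Prod>\<rho>\<leftarrow>\<rho>s. u - \<rho>))"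
    using Cons.prems by (simp add: field_simps)
  ultimately show ?case by (simp only: list.map prod_list.Cons sum_list.Cons)
qed simp

lemma prod_list_diff_nonzero: "u \<notin> set \<rho>s \<Longrightarrow> (\<Prod>\<rho>\<leftarrow>\<rho>s. u - \<rho> :: complex) \<noteq> 0"
  by (induction \<rho>s) auto

text \<open>
  The argument principle with a weight \<open>H\<close>: sums of \<open>H\<close> over the zeros of \<open>f\<close> become integrals over a
  fixed circle, so they depend holomorphically on parameters although the single zeros do not.
\<close>

lemma weighted_zero_sum_integral:
  assumes r: "0 < r" "r < R"
    and \<rho>s: "set \<rho>s \<subseteq> ball 0 r" and g: "g holomorphic_on ball 0 R" "\<And>u. u \<in> cball 0 r \<Longrightarrow> g u \<noteq> 0"
    and f: "\<And>u. u \<in> ball 0 R \<Longrightarrow> f u = (\<Prod>\<rho>\<leftarrow>\<rho>s. u - \<rho>) * g u"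
    and f': "\<And>u. u \<in> ball 0 R \<Longrightarrow> (f has_field_derivative f' u) (at u)"
    and H: "H holomorphic_on cball 0 r"
  shows "((\<lambda>u. H u * (f' u / f u)) has_contour_integral (2 * of_real pi * \<i> * (\<Sum>\<rho>\<leftarrow>\<rho>s. H \<rho>))) (circlepath 0 r)"
proof -
  have quot: "f' u / f u = (\<Sum>\<rho>\<leftarrow>\<rho>s. 1 / (u - \<rho>)) + deriv g u / g u" if u: "norm u = r" for u
  proof -
    have uR: "u \<in> ball 0 R" and un: "u \<notin> set \<rho>s" using u r \<rho>s by auto
    have dg: "(g has_field_derivative deriv g u) (at u)"
      using g(1) uR holomorphic_derivI by blast
    have "((\<lambda>u. (\<Prod>\<rho>\<leftarrow>\<rho>s. u - \<rho>) * g u) has_field_derivative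
        (\<Prod>\<rho>\<leftarrow>\<rho>s. u - \<rho>) * deriv g u + ((\<Sum>\<rho>\<leftarrow>\<rho>s. 1 / (u - \<rho>)) * (\<Prod>\<rho>\<leftarrow>\<rho>s. u - \<rho>)) * g u) (at u)"
      by (rule DERIV_mult'[OF log_derivative_prod_list[OF un] dg])
    then have "(f has_field_derivative
        (\<Prod>\<rho>\<leftarrow>\<rho>s. u - \<rho>) * deriv g u + ((\<Sum>\<rho>\<leftarrow>\<rho>s. 1 / (u - \<rho>)) * (\<Prod>\<rho>\<leftarrow>\<rho>s. u - \<rho>)) * g u) (at u)"
      by (rule has_field_derivative_transform_within_open[of _ _ _ "ball 0 R"]) (use uR f in auto)
    from DERIV_unique[OF f'[OF uR] this] show ?thesis
      using prod_list_diff_nonzero[OF un] g(2)[of u] u by (simp add: f[OF uR] field_simps)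
  qed
  have "((\<lambda>u. H u * deriv g u / g u) has_contour_integral 0) (circlepath 0 r)"
  proof (rule Cauchy_theorem_convex_simple)
    have sub: "cball 0 r \<subseteq> ball (0::complex) R" using r by auto
    have "deriv g holomorphic_on ball 0 R" using g(1) by (intro holomorphic_deriv) auto
    then show "(\<lambda>u. H u * deriv g u / g u) holomorphic_on cball 0 r"
      using g(2) by (intro holomorphic_on_divide holomorphic_on_mult H
          holomorphic_on_subset[OF _ sub] g(1)) auto
  qed (use r in auto)
  moreover have "((\<lambda>u. \<Sum>\<rho>\<leftarrow>\<rho>s. H u / (u - \<rho>)) has_contour_integral (\<Sum>\<rho>\<leftarrow>\<rho>s. 2 * of_real pi * \<i> * H \<rho>)) (circlepath 0 r)"
    using \<rho>s
  proof (induction \<rho>s)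
    case (Cons a \<rho>s)
    then have "((\<lambda>u. H u / (u - a)) has_contour_integral 2 * of_real pi * \<i> * H a) (circlepath 0 r)"
      by (intro Cauchy_integral_circlepath_simple[OF H]) auto
    with Cons show ?case by (simp add: has_contour_integral_add)
  qed (simp add: has_contour_integral_0)
  ultimately have "((\<lambda>u. H u * deriv g u / g u + (\<Sum>\<rho>\<leftarrow>\<rho>s. H u / (u - \<rho>))) has_contour_integral
      0 + (\<Sum>\<rho>\<leftarrow>\<rho>s. 2 * of_real pi * \<i> * H \<rho>)) (circlepath 0 r)"
    by (rule has_contour_integral_add)
  moreover have "(\<Sum>\<rho>\<leftarrow>\<rho>s. 2 * of_real pi * \<i> * H \<rho>) = 2 * of_real pi * \<i> * (\<Sum>\<rho>\<leftarrow>\<rho>s. H \<rho>)"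
    by (induction \<rho>s) (auto simp: algebra_simps)
  ultimately have "((\<lambda>u. H u * deriv g u / g u + (\<Sum>\<rho>\<leftarrow>\<rho>s. H u / (u - \<rho>))) has_contour_integral
      2 * of_real pi * \<i> * (\<Sum>\<rho>\<leftarrow>\<rho>s. H \<rho>)) (circlepath 0 r)" by simp
  then show ?thesis
  proof (rule has_contour_integral_eq)
    fix u assume "u \<in> path_image (circlepath 0 r)"
    then have "norm u = r" using r by (simp add: dist_norm)
    moreover have "H u * (\<Sum>\<rho>\<leftarrow>\<rho>s. 1 / (u - \<rho>)) = (\<Sum>\<rho>\<leftarrow>\<rho>s. H u / (u - \<rho>))"
      by (induction \<rho>s) (auto simp: algebra_simps)
    ultimately show "H u * deriv g u / g u + (\<Sum>\<rho>\<leftarrow>\<rho>s. H u / (u - \<rho>)) = H u * (f' u / f u)"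
      by (simp add: quot distrib_left)
  qed
qed

text \<open>
  Lagrange interpolation at the points of \<open>X\<close>, evaluated at \<open>0\<close>. The weights do not depend on the
  polynomial.
\<close>

lemma lagrange_at_0:
  assumes "finite (X :: complex set)"
  shows "\<exists>c. \<forall>p :: complex poly. degree p < card X \<longrightarrow> poly p 0 = (\<Sum>x\<in>X. c x * poly p x)"
proof -
  define l where "l x = smult (inverse (\<Prod>y\<in>X - {x}. x - y)) (\<Prod>y\<in>X - {x}. [:- y, 1:])" for x
  have l: "poly (l x) z = (if z = x then 1 else 0)" if "x \<in> X" "z \<in> X" for x z
  proof (cases "z = x")
    case True
    then show ?thesis using assms by (simp add: l_def poly_prod)
  next
    case False
    then have "(\<Prod>y\<in>X - {x}. poly [:- y, 1:] z) = 0"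
      using that assms by (intro prod_zero) (auto intro!: bexI[of _ z])
    then show ?thesis using False by (simp add: l_def poly_prod)
  qed
  have deg: "degree (l x) < card X" if "x \<in> X" for x
  proof -
    have "degree (\<Prod>y\<in>X - {x}. [:- y, 1:]) \<le> sum (degree \<circ> (\<lambda>y. [:- y, 1:])) (X - {x})"
      using assms by (intro degree_prod_sum_le) auto
    also have "\<dots> = card (X - {x})" by simp
    also have "\<dots> < card X" using assms that by (rule card_Diff1_less)
    finally show ?thesis unfolding l_def using degree_smult_le le_less_trans by blast
  qed
  have "poly p 0 = (\<Sum>x\<in>X. poly (l x) 0 * poly p x)" if p: "degree p < card X" for p
  proof -
    have "p = (\<Sum>x\<in>X. smult (poly p x) (l x))"
    proof (rule poly_eqI_degree[of X])
      fix z assume z: "z \<in> X"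
      have "(\<Sum>x\<in>X. poly p x * poly (l x) z) = (\<Sum>x\<in>X. if x = z then poly p x else 0)"
        using z by (intro sum.cong) (auto simp: l)
      then show "poly p z = poly (\<Sum>x\<in>X. smult (poly p x) (l x)) z"
        using z assms by (simp add: poly_sum)
      have "X \<noteq> {}" using z by auto
    next
      have "degree (\<Sum>x\<in>X. smult (poly p x) (l x)) \<le> card X - 1"
      proof (rule degree_sum_le[OF assms])
        fix x assume "x \<in> X"
        then show "degree (smult (poly p x) (l x)) \<le> card X - 1"
          using deg[of x] degree_smult_le[of "poly p x" "l x"] by linarith
      qed
      then show "degree (\<Sum>x\<in>X. smult (poly p x) (l x)) < card X" using p by linarith
    qed (rule p)
    then have "poly p 0 = poly (\<Sum>x\<in>X. smult (poly p x) (l x)) 0" by simp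
    then show ?thesis by (simp add: poly_sum mult.commute)
  qed
  then show ?thesis by (intro exI[of _ "\<lambda>x. poly (l x) 0"]) blast
qed

text \<open>
  Cauchy's estimate on circles shrinking to \<open>0\<close> shows that all derivatives at \<open>0\<close> vanish.
\<close>

lemma flat_holomorphic_eq_0:
  assumes f: "f holomorphic_on ball 0 R" and w: "w \<in> ball 0 R"
    and flat: "\<And>N. \<exists>C \<delta>. \<delta> > 0 \<and> (\<forall>s. 0 < norm s \<and> norm s < \<delta> \<longrightarrow> norm (f s) \<le> C * norm s ^ N)"
  shows "f w = (0 :: complex)"
proof (rule holomorphic_fun_eq_0_on_ball[OF f w])
  fix n
  have R: "R > 0" using w by (metis ball_eq_empty empty_iff not_le)
  obtain C \<delta> where C: "\<delta> > 0" "\<And>s. 0 < norm s \<Longrightarrow> norm s < \<delta> \<Longrightarrow> norm (f s) \<le> C * norm s ^ Suc n"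
    using flat[of "Suc n"] by blast
  have bound: "norm ((deriv ^^ n) f 0) \<le> fact n * C * e" if e: "0 < e" "e < min \<delta> R" for e
  proof -
    have sub: "cball 0 e \<subseteq> ball (0::complex) R" using e by auto
    have "norm ((deriv ^^ n) f 0) \<le> fact n * (C * e ^ Suc n) / e ^ n"
    proof (rule Cauchy_inequality)
      show "f holomorphic_on ball 0 e" using f sub holomorphic_on_subset by (metis ball_subset_cball order_trans)
      show "continuous_on (cball 0 e) f" using f sub holomorphic_on_imp_continuous_on holomorphic_on_subset by blast
      show "norm (f x) \<le> C * e ^ Suc n" if "norm (0 - x) = e" for x
        using C(2)[of x] that e by (cases "x = 0") auto
    qed (use e in auto)
    then show ?thesis using e by (simp add: mult_ac)
  qed
  have "((\<lambda>e. fact n * C * e) \<longlongrightarrow> fact n * C * 0) (at_right 0)"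
    by (intro tendsto_intros)
  moreover have "\<forall>\<^sub>F e in at_right 0. norm ((deriv ^^ n) f 0) \<le> fact n * C * e"
    using C(1) R bound unfolding eventually_at_right_field by (intro exI[of _ "min \<delta> R"]) auto
  ultimately have "norm ((deriv ^^ n) f 0) \<le> fact n * C * 0"
    by (rule tendsto_lowerbound) simp
  then show "(deriv ^^ n) f 0 = 0" by simp
qed

text \<open>
  The product changes at most linearly when all the factors are shifted by \<open>x\<close>, uniformly for bounded
  factors.
\<close>

lemma prod_list_le_perturb:
  assumes K: "0 \<le> (K :: real)"
  shows "\<exists>C\<ge>0. \<forall>x b. length b = n \<longrightarrow> 0 \<le> x \<longrightarrow> x \<le> K \<longrightarrow> (\<forall>y\<in>set b. 0 \<le> y \<and> y \<le> K) \<longrightarrow>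
           (\<Prod>y\<leftarrow>b. x + y) \<le> prod_list b + C * x"
proof (induction n)
  case 0
  show ?case by (intro exI[of _ 0]) auto
next
  case (Suc n)
  then obtain C where C: "C \<ge> 0" "\<And>x b. length b = n \<Longrightarrow> 0 \<le> x \<Longrightarrow> x \<le> K \<Longrightarrow> (\<forall>y\<in>set b. 0 \<le> y \<and> y \<le> K) \<Longrightarrow>
           (\<Prod>y\<leftarrow>b. x + y) \<le> prod_list b + C * x" by blast
  have prod_le: "0 \<le> (\<Prod>y\<leftarrow>b. x + y) \<and> (\<Prod>y\<leftarrow>b. x + y) \<le> (2 * K) ^ length b"
    if "0 \<le> x" "x \<le> K" "\<forall>y\<in>set b. 0 \<le> y \<and> y \<le> K" for x and b :: "real list"
    using that
  proof (induction b)
    case (Cons y b)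
    then have "0 \<le> (\<Prod>y\<leftarrow>b. x + y)" "(\<Prod>y\<leftarrow>b. x + y) \<le> (2 * K) ^ length b" "0 \<le> x + y" "x + y \<le> 2 * K"
      by auto
    then show ?case by (auto intro!: mult_mono)
  qed simp
  have "(\<Prod>y\<leftarrow>b. x + y) \<le> prod_list b + ((2 * K) ^ n + K * C) * x"
    if b: "length b = Suc n" and x: "0 \<le> x" "x \<le> K" and y: "\<forall>y\<in>set b. 0 \<le> y \<and> y \<le> K" for x b
  proof -
    obtain z b' where b': "b = z # b'" "length b' = n" using b by (cases b) auto
    let ?P = "\<Prod>y\<leftarrow>b'. x + y"
    have z: "0 \<le> z" "z \<le> K" using y b' by auto
    have "?P \<le> (2 * K) ^ n" using prod_le[of x b'] x y b' by auto
    then have "x * ?P \<le> x * (2 * K) ^ n" using x by (intro mult_left_mono) auto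
    moreover have "?P \<le> prod_list b' + C * x" using C(2)[of b' x] x y b' by auto
    then have "z * ?P \<le> z * (prod_list b' + C * x)" using z by (intro mult_left_mono) auto
    moreover have "z * (C * x) \<le> K * (C * x)" using z C(1) x by (intro mult_right_mono) auto
    ultimately show ?thesis by (simp add: b' algebra_simps)
  qed
  then show ?case using C(1) K by (intro exI[of _ "(2 * K) ^ n + K * C"]) auto
qed

lemma norm_prod_list: "norm (prod_list xs) = (\<Prod>x\<leftarrow>xs. norm (x :: complex))"
  by (induction xs) (auto simp: norm_mult)

lemma prod_list_mono_nonneg:
  "(\<And>x. x \<in> set xs \<Longrightarrow> 0 \<le> f x \<and> f x \<le> (g x :: real)) \<Longrightarrow> 0 \<le> (\<Prod>x\<leftarrow>xs. f x) \<and> (\<Prod>x\<leftarrow>xs. f x) \<le> (\<Prod>x\<leftarrow>xs. g x)"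
proof (induction xs)
  case (Cons x xs)
  then have "0 \<le> f x" "f x \<le> g x" "0 \<le> (\<Prod>x\<leftarrow>xs. f x)" "(\<Prod>x\<leftarrow>xs. f x) \<le> (\<Prod>x\<leftarrow>xs. g x)" by auto
  then show ?case by (auto intro!: mult_mono mult_nonneg_nonneg)
qed simp

text \<open>
  Consider the product \<open>P s\<close> of the values of \<open>g s\<close> over the zeros of \<open>a s\<close> in the disc. A common root
  exists exactly when \<open>P s = 0\<close>. The product is holomorphic in \<open>s\<close>: the number of zeros is constant, and
  symmetric functions of the zeros are circle integrals. It is flat at \<open>s = 0\<close>: at an approximate common
  root \<open>u\<close>, the smallness of \<open>a s u\<close> makes the product of the distances from \<open>u\<close> to the zeros small, and
  \<open>g s\<close> is Lipschitz. So \<open>P\<close> vanishes identically.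
\<close>

theorem common_root_of_flat:
  fixes a a' g :: "complex \<Rightarrow> complex \<Rightarrow> complex"
  assumes r: "0 < r" "r < R"
    and da: "\<And>s u. s \<in> ball 0 S \<Longrightarrow> u \<in> ball 0 R \<Longrightarrow> (a s has_field_derivative a' s u) (at u)"
    and hg: "\<And>s. s \<in> ball 0 S \<Longrightarrow> g s holomorphic_on ball 0 R"
    and cont: "continuous_on (ball 0 S \<times> sphere 0 r) (\<lambda>(s, u). a s u)"
       "continuous_on (ball 0 S \<times> sphere 0 r) (\<lambda>(s, u). a' s u)"
       "continuous_on (ball 0 S \<times> sphere 0 r) (\<lambda>(s, u). g s u)"
    and hol: "\<And>u. norm u = r \<Longrightarrow> (\<lambda>s. a s u) holomorphic_on ball 0 S"
       "\<And>u. norm u = r \<Longrightarrow> (\<lambda>s. a' s u) holomorphic_on ball 0 S"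
       "\<And>u. norm u = r \<Longrightarrow> (\<lambda>s. g s u) holomorphic_on ball 0 S"
    and m: "m > 0" "\<And>s u. s \<in> ball 0 S \<Longrightarrow> norm u = r \<Longrightarrow> m \<le> norm (a s u)"
    and T: "\<And>s u. s \<in> ball 0 S \<Longrightarrow> norm u \<le> r \<Longrightarrow> norm (g s u) < T"
    and L: "L \<ge> 0" "\<And>s u u'. s \<in> ball 0 S \<Longrightarrow> norm u \<le> r \<Longrightarrow> norm u' \<le> r \<Longrightarrow> norm (g s u - g s u') \<le> L * norm (u - u')"
    and flat: "\<And>N. \<exists>C \<delta>. \<delta> > 0 \<and> (\<forall>s. 0 < norm s \<and> norm s < \<delta> \<longrightarrow>
        (\<exists>u. norm u \<le> r \<and> norm (a s u) \<le> C * norm s ^ N \<and> norm (g s u) \<le> C * norm s ^ N))"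
    and s: "s \<in> ball 0 S"
  shows "\<exists>u. norm u < r \<and> a s u = 0 \<and> g s u = 0"
proof -
  let ?U = "ball (0::complex) S"
  have S: "S > 0" using s by (metis ball_eq_empty empty_iff not_le)
  have T0: "T > 0" using T[OF s, of 0] r norm_ge_zero[of "g s 0"] by (simp del: norm_ge_zero)
  have anz: "a s u \<noteq> 0" if "s \<in> ?U" "norm u = r" for s u using m(2)[OF that] m(1) by auto
  have ha: "a s holomorphic_on ball 0 R" if "s \<in> ?U" for s
    unfolding holomorphic_on_open[OF open_ball] using da[OF that] by blast
  have "\<forall>s\<in>?U. \<exists>\<rho>s h. set \<rho>s \<subseteq> ball 0 r \<and> h holomorphic_on ball 0 R \<and> (\<forall>u\<in>cball 0 r. h u \<noteq> 0) \<and>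
           (\<forall>u\<in>ball 0 R. a s u = (\<Prod>\<rho>\<leftarrow>\<rho>s. u - \<rho>) * h u)"
    using factor_out_zeros[OF ha r] anz by blast
  then obtain \<rho> h where \<rho>: "\<And>s. s \<in> ?U \<Longrightarrow> set (\<rho> s) \<subseteq> ball 0 r"
     and h: "\<And>s. s \<in> ?U \<Longrightarrow> h s holomorphic_on ball 0 R" "\<And>s u. s \<in> ?U \<Longrightarrow> u \<in> cball 0 r \<Longrightarrow> h s u \<noteq> 0"
     and fac: "\<And>s u. s \<in> ?U \<Longrightarrow> u \<in> ball 0 R \<Longrightarrow> a s u = (\<Prod>\<rho>\<leftarrow>\<rho> s. u - \<rho>) * h s u"
    by metis
  have sub: "cball 0 r \<subseteq> ball (0::complex) R" using r by auto
  \<comment> \<open>\<open>J H s\<close> is the sum of \<open>H s\<close> over the zeros of \<open>a s\<close>.\<close>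
  define J where "J H s = contour_integral (circlepath 0 r) (\<lambda>u. H s u * (a' s u / a s u)) / (2 * of_real pi * \<i>)" for H s
  have J_eq: "J H s = (\<Sum>\<rho>\<leftarrow>\<rho> s. H s \<rho>)" if "s \<in> ?U" "H s holomorphic_on cball 0 r" for H s
    using contour_integral_unique[OF weighted_zero_sum_integral[OF r \<rho>[OF that(1)] h[OF that(1)] fac[OF that(1)] da[OF that(1)] that(2)]]
    by (simp add: J_def)
  have J_holo: "J H holomorphic_on ?U"
    if H: "continuous_on (?U \<times> sphere 0 r) (\<lambda>(s, u). H s u)" "\<And>u. norm u = r \<Longrightarrow> (\<lambda>s. H s u) holomorphic_on ?U" for H
  proof -
    have "(\<lambda>s. contour_integral (circlepath 0 r) (\<lambda>u. H s u * (a' s u / a s u))) holomorphic_on ?U"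
    proof (rule contour_integral_param_holomorphic[OF _ r(1)])
      have "continuous_on (?U \<times> sphere 0 r) (\<lambda>x. (\<lambda>(s, u). H s u) x * ((\<lambda>(s, u). a' s u) x / (\<lambda>(s, u). a s u) x))"
        using anz by (intro continuous_intros H cont) auto
      then show "continuous_on (?U \<times> sphere 0 r) (\<lambda>(s, u). H s u * (a' s u / a s u))"
        by (simp add: case_prod_unfold)
      show "(\<lambda>s. H s u * (a' s u / a s u)) holomorphic_on ?U" if u: "u \<in> sphere 0 r" for u
        using anz u by (intro holomorphic_on_mult holomorphic_on_divide H(2) hol) auto
    qed auto
    then show ?thesis unfolding J_def by (intro holomorphic_intros) auto
  qed
  have count: "J (\<lambda>_ _. 1) s = of_nat (length (\<rho> s))" if "s \<in> ?U" for s
    using J_eq[OF that, of "\<lambda>_ _. 1"] by (simp add: sum_list_triv)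
  \<comment> \<open>The number of zeros is a continuous function with integer values.\<close>
  have "J (\<lambda>_ _. 1) constant_on ?U"
  proof (rule continuous_discrete_range_constant)
    show "continuous_on ?U (J (\<lambda>_ _. 1))"
      by (intro holomorphic_on_imp_continuous_on J_holo) (auto simp: case_prod_unfold)
    fix x assume x: "x \<in> ?U"
    show "\<exists>e>0. \<forall>y. y \<in> ?U \<and> J (\<lambda>_ _. 1) y \<noteq> J (\<lambda>_ _. 1) x \<longrightarrow> e \<le> norm (J (\<lambda>_ _. 1) y - J (\<lambda>_ _. 1) x)"
    proof (intro exI[of _ 1] conjI allI impI)
      fix y assume y: "y \<in> ?U \<and> J (\<lambda>_ _. 1) y \<noteq> J (\<lambda>_ _. 1) x"
      have "norm (complex_of_int (int (length (\<rho> y)) - int (length (\<rho> x)))) = \<bar>real_of_int (int (length (\<rho> y)) - int (length (\<rho> x)))\<bar>"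
        by (rule norm_of_int)
      also have "\<dots> \<ge> 1" using y x count by auto
      finally show "1 \<le> norm (J (\<lambda>_ _. 1) y - J (\<lambda>_ _. 1) x)" using y x count by simp
    qed simp
  qed simp
  then obtain c where c: "\<And>s. s \<in> ?U \<Longrightarrow> J (\<lambda>_ _. 1) s = c" by (auto simp: constant_on_def)
  define n where "n = length (\<rho> s)"
  have n: "length (\<rho> t) = n" if "t \<in> ?U" for t
    using c[OF that] c[OF s] count[OF that] count[OF s] unfolding n_def by (metis of_nat_eq_iff)
  \<comment> \<open>The polynomial with the values of \<open>g t\<close> at the zeros of \<open>a t\<close> as its roots. Its constant term is, up
    to sign, the resultant.\<close>
  define Q where "Q t = (\<Prod>y\<leftarrow>map (g t) (\<rho> t). [:- y, 1:])" for t
  have poly_prod: "poly (\<Prod>y\<leftarrow>ys. [:- y, 1:]) \<tau> = (\<Prod>y\<leftarrow>ys. \<tau> - y)" for ys and \<tau> :: complex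
    by (induction ys) (auto simp: algebra_simps)
  have Q: "poly (Q t) \<tau> = (\<Prod>\<rho>\<leftarrow>\<rho> t. \<tau> - g t \<rho>)" for t \<tau>
    using poly_prod[of "map (g t) (\<rho> t)" \<tau>] by (simp add: Q_def o_def)
  have deg: "degree (Q t) = n" if "t \<in> ?U" for t
  proof -
    have deg_prod: "(\<Prod>y\<leftarrow>ys. [:- y, 1:]) \<noteq> 0 \<and> degree (\<Prod>y\<leftarrow>ys. [:- y, 1:]) = length ys" for ys :: "complex list"
    proof (induction ys)
      case (Cons y ys)
      have "[:- y, 1:] \<noteq> 0" by simp
      then show ?case using Cons by (simp add: degree_mult_eq del: mult_pCons_left)
    qed simp
    show ?thesis using n[OF that] deg_prod[of "map (g t) (\<rho> t)"] unfolding Q_def by (simp del: map_map)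
  qed
  \<comment> \<open>For \<open>\<tau> \<in> X\<close> the differences \<open>\<tau> - g t u\<close> lie in the right half plane, where the logarithm is
    holomorphic; so \<open>poly (Q t) \<tau>\<close> is the exponential of a sum over the zeros. The value at \<open>0\<close>, where no
    logarithm is available, is interpolated from these \<open>n + 1\<close> values.\<close>
  define X where "X = (\<lambda>k. complex_of_real (T * (1 + real k))) ` {..n}"
  have X: "finite X" "card X = Suc n" "\<And>x. x \<in> X \<Longrightarrow> Re x \<ge> T"
    using T0 by (auto simp: X_def card_image inj_on_def)
  obtain c where c: "\<And>p :: complex poly. degree p < card X \<Longrightarrow> poly p 0 = (\<Sum>x\<in>X. c x * poly p x)"
    using lagrange_at_0[OF X(1)] by blast
  have Re: "\<tau> - g t u \<notin> \<real>\<^sub>\<le>\<^sub>0" "\<tau> - g t u \<noteq> 0" if "\<tau> \<in> X" "t \<in> ?U" "norm u \<le> r" for \<tau> t u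
  proof -
    have "Re (g t u) < T" using T[OF that(2,3)] complex_Re_le_cmod le_less_trans by blast
    then have "Re (\<tau> - g t u) > 0" using X(3)[OF that(1)] by simp
    then show "\<tau> - g t u \<notin> \<real>\<^sub>\<le>\<^sub>0" "\<tau> - g t u \<noteq> 0" by (auto simp: complex_nonpos_Reals_iff)
  qed
  have E: "poly (Q t) \<tau> = exp (J (\<lambda>t u. Ln (\<tau> - g t u)) t)" if "\<tau> \<in> X" "t \<in> ?U" for \<tau> t
  proof -
    have "(\<lambda>u. Ln (\<tau> - g t u)) holomorphic_on cball 0 r"
      using Re[OF that] by (intro holomorphic_on_Ln' holomorphic_intros holomorphic_on_subset[OF hg[OF that(2)] sub]) auto
    then have "J (\<lambda>t u. Ln (\<tau> - g t u)) t = (\<Sum>\<rho>\<leftarrow>\<rho> t. Ln (\<tau> - g t \<rho>))"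
      by (rule J_eq[OF that(2)])
    also have "exp \<dots> = (\<Prod>\<rho>\<leftarrow>\<rho> t. exp (Ln (\<tau> - g t \<rho>)))"
    proof -
      have "exp (sum_list xs) = (\<Prod>x\<leftarrow>xs. exp x)" for xs :: "complex list"
        by (induction xs) (auto simp: exp_add)
      then show ?thesis by (simp add: o_def)
    qed
    also have "\<dots> = (\<Prod>\<rho>\<leftarrow>\<rho> t. \<tau> - g t \<rho>)"
    proof (intro arg_cong[where f = prod_list] map_cong refl exp_Ln)
      fix x assume "x \<in> set (\<rho> t)"
      then have "x \<in> ball 0 r" using \<rho>[OF that(2)] by blast
      then have "norm x \<le> r" by simp
      then show "\<tau> - g t x \<noteq> 0" by (rule Re(2)[OF that])
    qed
    finally show ?thesis by (simp add: Q)
  qed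
  define P where "P t = poly (Q t) 0" for t
  have "(\<lambda>t. \<Sum>\<tau>\<in>X. c \<tau> * exp (J (\<lambda>t u. Ln (\<tau> - g t u)) t)) holomorphic_on ?U"
  proof (intro holomorphic_on_sum holomorphic_on_mult holomorphic_on_const holomorphic_on_exp')
    fix \<tau> assume \<tau>: "\<tau> \<in> X"
    show "J (\<lambda>t u. Ln (\<tau> - g t u)) holomorphic_on ?U"
    proof (rule J_holo)
      have "continuous_on (?U \<times> sphere 0 r) (\<lambda>x. Ln (\<tau> - (\<lambda>(t, u). g t u) x))"
        using Re(1)[OF \<tau>] by (intro continuous_on_Ln' continuous_intros cont) auto
      then show "continuous_on (?U \<times> sphere 0 r) (\<lambda>(t, u). Ln (\<tau> - g t u))"
        by (simp add: case_prod_unfold)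
      show "(\<lambda>t. Ln (\<tau> - g t u)) holomorphic_on ?U" if "norm u = r" for u
        using Re(1)[OF \<tau>] that by (intro holomorphic_on_Ln' holomorphic_on_diff holomorphic_on_const hol) auto
    qed
  qed
  then have P_holo: "P holomorphic_on ?U"
    by (rule holomorphic_transform) (use c[of "Q _"] deg X(2) E in \<open>simp add: P_def\<close>)
  have "P s = 0"
  proof (rule flat_holomorphic_eq_0[OF P_holo s])
    fix N
    obtain C \<delta> where C: "\<delta> > 0" "\<And>t. 0 < norm t \<Longrightarrow> norm t < \<delta> \<Longrightarrow>
        \<exists>u. norm u \<le> r \<and> norm (a t u) \<le> C * norm t ^ N \<and> norm (g t u) \<le> C * norm t ^ N"
      using flat[of N] by blast
    \<comment> \<open>The zero-free factor \<open>h t\<close> is bounded below on the circle, hence on the disc by the maximum principle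
      for \<open>1 / h t\<close>.\<close>
    define \<mu> where "\<mu> = m / (2 * r) ^ n"
    have \<mu>: "\<mu> > 0" using m(1) r by (simp add: \<mu>_def)
    have hb: "norm (h t u) \<ge> \<mu>" if t: "t \<in> ?U" and u: "norm u \<le> r" for t u
    proof -
      have "norm (1 / h t u) \<le> 1 / \<mu>"
      proof (rule maximum_modulus_frontier[of "\<lambda>u. 1 / h t u" "cball 0 r"])
        show "(\<lambda>u. 1 / h t u) holomorphic_on interior (cball 0 r)"
          using h(2)[OF t] sub by (intro holomorphic_on_divide holomorphic_on_const holomorphic_on_subset[OF h(1)[OF t]]) auto
        show "continuous_on (closure (cball 0 r)) (\<lambda>u. 1 / h t u)"
          using h(2)[OF t] sub
          by (intro continuous_on_divide continuous_on_const holomorphic_on_imp_continuous_on holomorphic_on_subset[OF h(1)[OF t]]) auto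
        fix z assume "z \<in> frontier (cball (0::complex) r)"
        then have z: "norm z = r" using r by (simp add: frontier_cball)
        have "norm (\<Prod>\<rho>\<leftarrow>\<rho> t. z - \<rho>) \<le> (\<Prod>\<rho>\<leftarrow>\<rho> t. 2 * r)"
          unfolding norm_prod_list list.map_comp o_def
        proof (rule prod_list_mono_nonneg[THEN conjunct2])
          fix x assume "x \<in> set (\<rho> t)"
          then have "norm x < r" using \<rho>[OF t] by auto
          then show "0 \<le> norm (z - x) \<and> norm (z - x) \<le> 2 * r" using norm_triangle_ineq4[of z x] z by simp
        qed
        also have "\<dots> = (2 * r) ^ n" using n[OF t] by (simp add: map_replicate_const prod_list_replicate)
        finally have le: "norm (\<Prod>\<rho>\<leftarrow>\<rho> t. z - \<rho>) \<le> (2 * r) ^ n" .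
        have "m \<le> norm (\<Prod>\<rho>\<leftarrow>\<rho> t. z - \<rho>) * norm (h t z)"
          using m(2)[OF t z] fac[OF t, of z] z r by (simp add: norm_mult)
        also have "\<dots> \<le> (2 * r) ^ n * norm (h t z)" using le by (intro mult_right_mono) auto
        finally have "\<mu> \<le> norm (h t z)" using r by (simp add: \<mu>_def field_simps)
        then show "norm (1 / h t z) \<le> 1 / \<mu>" using \<mu> by (simp add: norm_divide frac_le)
      qed (use u in auto)
      then show ?thesis using \<mu> h(2)[OF t, of u] u by (simp add: norm_divide field_simps)
    qed
    define K where "K = max T (L * (2 * r))"
    have K: "K \<ge> 0" using T0 by (simp add: K_def)
    obtain B where B: "B \<ge> 0" "\<And>x b. length b = n \<Longrightarrow> 0 \<le> x \<Longrightarrow> x \<le> K \<Longrightarrow> (\<forall>y\<in>set b. 0 \<le> y \<and> y \<le> K) \<Longrightarrow>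
           (\<Prod>y\<leftarrow>b. x + y) \<le> prod_list b + B * x"
      using prod_list_le_perturb[OF K, of n] by blast
    have "norm (P t) \<le> (L ^ n * C / \<mu> + B * C) * norm t ^ N" if t: "0 < norm t" "norm t < min \<delta> S" for t
    proof -
      have tU: "t \<in> ?U" using t by simp
      obtain u where u: "norm u \<le> r" "norm (a t u) \<le> C * norm t ^ N" "norm (g t u) \<le> C * norm t ^ N"
        using C(2)[of t] t by auto
      have \<rho>r: "norm x < r" if "x \<in> set (\<rho> t)" for x using \<rho>[OF tU] that by auto
      let ?b = "map (\<lambda>x. L * norm (u - x)) (\<rho> t)"
      have "norm (P t) = (\<Prod>x\<leftarrow>\<rho> t. norm (g t x))"
        by (simp add: P_def Q norm_prod_list o_def)
      also have "\<dots> \<le> (\<Prod>x\<leftarrow>\<rho> t. norm (g t u) + L * norm (u - x))"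
      proof (rule prod_list_mono_nonneg[THEN conjunct2])
        fix x assume "x \<in> set (\<rho> t)"
        then have "norm (g t u - g t x) \<le> L * norm (u - x)" using L(2)[OF tU u(1)] \<rho>r less_imp_le by blast
        then show "0 \<le> norm (g t x) \<and> norm (g t x) \<le> norm (g t u) + L * norm (u - x)"
          using norm_triangle_ineq3[of "g t u" "g t x"] by simp
      qed
      also have "\<dots> = (\<Prod>y\<leftarrow>?b. norm (g t u) + y)" by (simp add: o_def)
      also have "\<dots> \<le> prod_list ?b + B * norm (g t u)"
      proof (rule B(2))
        show "norm (g t u) \<le> K" using T[OF tU u(1)] by (simp add: K_def)
        have "L * norm (u - x) \<le> L * (2 * r)" if "x \<in> set (\<rho> t)" for x
          using norm_triangle_ineq4[of u x] \<rho>r[OF that] u(1) L(1) by (intro mult_left_mono) auto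
        then show "\<forall>y\<in>set ?b. 0 \<le> y \<and> y \<le> K" using L(1) by (auto simp: K_def intro: max.coboundedI2)
      qed (use n[OF tU] in auto)
      also have "prod_list ?b = L ^ n * norm (\<Prod>x\<leftarrow>\<rho> t. u - x)"
      proof -
        have "prod_list (map (\<lambda>x. L * norm (u - x)) xs) = L ^ length xs * norm (\<Prod>x\<leftarrow>xs. u - x)" for xs
          by (induction xs) (auto simp: norm_mult)
        then show ?thesis using n[OF tU] by simp
      qed
      also have "norm (\<Prod>x\<leftarrow>\<rho> t. u - x) \<le> C * norm t ^ N / \<mu>"
      proof -
        have "norm (\<Prod>x\<leftarrow>\<rho> t. u - x) * \<mu> \<le> norm (\<Prod>x\<leftarrow>\<rho> t. u - x) * norm (h t u)"
          using hb[OF tU u(1)] by (intro mult_left_mono) auto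
        also have "\<dots> = norm (a t u)" using fac[OF tU, of u] u(1) r by (simp add: norm_mult)
        finally show ?thesis using u(2) \<mu> by (simp add: field_simps)
      qed
      finally have "norm (P t) \<le> L ^ n * (C * norm t ^ N / \<mu>) + B * norm (g t u)"
        using L(1) by (simp add: mult_left_mono)
      also have "\<dots> \<le> L ^ n * (C * norm t ^ N / \<mu>) + B * (C * norm t ^ N)"
        using u(3) B(1) by (intro add_left_mono mult_left_mono)
      finally show ?thesis by (simp add: algebra_simps)
    qed
    then show "\<exists>C \<delta>. \<delta> > 0 \<and> (\<forall>s. 0 < norm s \<and> norm s < \<delta> \<longrightarrow> norm (P s) \<le> C * norm s ^ N)"
      using C(1) S by (intro exI[of _ "L ^ n * C / \<mu> + B * C"] exI[of _ "min \<delta> S"]) auto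
  qed
  then have "0 \<in> set (map (\<lambda>x. 0 - g s x) (\<rho> s))"
    unfolding P_def Q by (simp only: prod_list_zero_iff)
  then obtain x where x: "x \<in> set (\<rho> s)" "g s x = 0" by auto
  have xr: "norm x < r" using \<rho>[OF s] x(1) by auto
  have "(\<Prod>\<rho>\<leftarrow>\<rho> s. x - \<rho>) = 0"
    using x(1) by (auto simp: prod_list_zero_iff)
  then have "a s x = 0" using fac[OF s, of x] xr r by simp
  then show ?thesis using x xr by blast
qed

section \<open>Approximate common zeros near a formal hypersurface\<close>

lemma eval3_bounded:
  assumes "converges3 \<rho> F" "\<rho> > 0"
  shows "\<exists>B>0. \<forall>z. norm z < \<rho> \<longrightarrow> norm (eval3 F z) \<le> B"
proof -
  obtain C where "C \<ge> 0" "\<And>z. norm z < \<rho> \<Longrightarrow> norm (eval3 F z) \<le> C"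
    using eval3_order_bound[OF assms(1) order_ge_0 assms(2)] by auto
  then show ?thesis by (intro exI[of _ "C + 1"]) fastforce
qed

lemma eval3_lipschitz:
  assumes F: "converges3 \<rho> F" and \<rho>: "\<rho> > 0"
  shows "\<exists>L>0. \<forall>p q. norm p < \<rho> / 2 \<longrightarrow> norm q < \<rho> / 2 \<longrightarrow> norm (eval3 F p - eval3 F q) \<le> L * norm (p - q)"
proof -
  have "\<exists>B>0. \<forall>z. norm z < \<rho> / 2 \<longrightarrow> norm (eval3 (fps3_deriv j F) z) \<le> B" for j
    using \<rho> by (intro eval3_bounded converges3_deriv[OF F]) auto
  then obtain B where B: "\<And>j. B j > 0" "\<And>j z. norm z < \<rho> / 2 \<Longrightarrow> norm (eval3 (fps3_deriv j F) z) \<le> B j"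
    by metis
  let ?L = "\<Sum>j\<in>UNIV. B j"
  have "norm (eval3 F p - eval3 F q) \<le> ?L * norm (p - q)" if p: "norm p < \<rho> / 2" and q: "norm q < \<rho> / 2" for p q
  proof -
    let ?u = "p - q"
    let ?k = "\<lambda>t. eval3 F (q + t *s ?u)"
    have near: "norm (q + t *s ?u) < \<rho> / 2" if t: "t \<in> closed_segment 0 1" for t
    proof -
      obtain \<tau> where \<tau>: "0 \<le> \<tau>" "\<tau> \<le> 1" "t = (1 - \<tau>) *\<^sub>R 0 + \<tau> *\<^sub>R 1"
        using t unfolding closed_segment_def by blast
      have t\<tau>: "t = of_real \<tau>" using \<tau>(3) by (simp add: scaleR_conv_of_real)
      have eq: "q + t *s ?u = (1 - \<tau>) *\<^sub>R q + \<tau> *\<^sub>R p"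
        unfolding t\<tau> vec_eq_iff vector_add_component vector_scaleR_component vector_smult_component
          vector_minus_component
        by (simp add: scaleR_conv_of_real algebra_simps)
      have "q \<in> ball 0 (\<rho> / 2)" "p \<in> ball 0 (\<rho> / 2)" using p q by auto
      from convexD[OF convex_ball this, of "1 - \<tau>" \<tau>] have "q + t *s ?u \<in> ball 0 (\<rho> / 2)"
        using \<tau>(1,2) unfolding eq by simp
      then show ?thesis by simp
    qed
    have "norm (?k 1 - ?k 0) \<le> (?L * norm ?u) * norm (1 - 0 :: complex)"
    proof (rule field_differentiable_bound[where S = "closed_segment 0 1" and f = ?k
          and f' = "\<lambda>t. \<Sum>j\<in>UNIV. ?u $ j * eval3 (fps3_deriv j F) (q + t *s ?u)"])
      fix t :: complex assume t: "t \<in> closed_segment 0 1"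
      have "q + t *s ?u \<in> polydisc \<rho>" using near[OF t] \<rho> by (intro norm_less_imp_polydisc) simp
      from eval3_line_deriv[OF F \<rho> this]
      show "(?k has_field_derivative (\<Sum>j\<in>UNIV. ?u $ j * eval3 (fps3_deriv j F) (q + t *s ?u))) (at t within closed_segment 0 1)"
        by (rule has_field_derivative_at_within)
      have "norm (?u $ j * eval3 (fps3_deriv j F) (q + t *s ?u)) \<le> norm ?u * B j" for j
        unfolding norm_mult using B(2)[OF near[OF t]] by (intro mult_mono Finite_Cartesian_Product.norm_nth_le) auto
      then have "norm (\<Sum>j\<in>UNIV. ?u $ j * eval3 (fps3_deriv j F) (q + t *s ?u)) \<le> (\<Sum>j\<in>UNIV. norm ?u * B j)"
        by (intro sum_norm_le) auto
      also have "\<dots> = ?L * norm ?u" by (simp add: sum_distrib_right mult.commute)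
      finally show "norm (\<Sum>j\<in>UNIV. ?u $ j * eval3 (fps3_deriv j F) (q + t *s ?u)) \<le> ?L * norm ?u" .
    qed auto
    then show ?thesis by simp
  qed
  moreover have "?L > 0" using B(1) by (intro sum_pos) auto
  ultimately show ?thesis by blast
qed

lemma converges3_trunc3: "converges3 \<rho> (trunc3 N F)"
  by (rule converges3_finite, rule finite_subset[OF _ finite_mdeg_less[of N]]) (auto simp: coeff3_trunc3)

text \<open>
  A quantitative form of the continuity of roots. If \<open>P\<close> had no zero on the disc of radius \<open>K \<epsilon>\<close>, then
  \<open>1/P\<close> would attain its maximum modulus on the boundary. There \<open>P\<close> is as large as on the line through
  \<open>0\<close>, up to the Lipschitz error, so it is larger than the Lipschitz bound for \<open>P x\<close> at the centre.
\<close>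

lemma small_zero_on_line:
  fixes P :: "complex^3 \<Rightarrow> complex" and v x :: "complex^3"
  assumes holo: "\<And>y. norm y < \<rho> \<Longrightarrow> (\<lambda>t. P (y + t *s v)) field_differentiable at 0"
    and lip: "L > 0" "\<And>y z. norm y < \<rho> \<Longrightarrow> norm z < \<rho> \<Longrightarrow> norm (P y - P z) \<le> L * norm (y - z)" and "P 0 = 0"
    and low: "c > 0" "\<And>t. norm t \<le> t0 \<Longrightarrow> c * norm t ^ d \<le> norm (P (t *s v))"
    and \<epsilon>: "norm x = \<epsilon> ^ d" "0 < \<epsilon>"
    and K: "K > 0" "c * K ^ d \<ge> 2 * L + 1" and small: "K * \<epsilon> \<le> t0" "norm x + K * \<epsilon> * norm v < \<rho>"
  shows "\<exists>u. norm u \<le> K * \<epsilon> \<and> P (x + u *s v) = 0"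
proof (rule ccontr)
  assume contra: "\<not> ?thesis"
  let ?k = "K * \<epsilon>"
  have k: "?k > 0" using K \<epsilon> by simp
  have near: "norm (x + u *s v) < \<rho>" if "norm u \<le> ?k" for u
  proof -
    have "norm (x + u *s v) \<le> norm x + norm u * norm v"
      using norm_triangle_ineq[of x "u *s v"] by (simp add: norm_cvec_smult)
    also have "\<dots> \<le> norm x + ?k * norm v" using that by (intro add_left_mono mult_right_mono) auto
    finally show ?thesis using small(2) by simp
  qed
  have xpos: "norm x > 0" using \<epsilon> by simp
  have D: "(\<lambda>u. P (x + u *s v)) field_differentiable at u" if u: "norm u \<le> ?k" for u
  proof -
    obtain D where "((\<lambda>t. P (x + u *s v + t *s v)) has_field_derivative D) (at 0)"
      using holo[OF near[OF u]] by (auto simp: field_differentiable_def)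
    from DERIV_recenter[OF this, of u]
    have "((\<lambda>s. P (x + u *s v + (s - u) *s v)) has_field_derivative D) (at u)" .
    moreover have "x + u *s v + (s - u) *s v = x + s *s v" for s by (simp add: vec_eq_iff algebra_simps)
    ultimately show ?thesis by (auto simp: field_differentiable_def)
  qed
  have nz: "P (x + u *s v) \<noteq> 0" if "norm u \<le> ?k" for u using contra that by blast
  have hol: "(\<lambda>u. P (x + u *s v)) holomorphic_on cball 0 ?k"
    by (rule holomorphic_onI, rule field_differentiable_at_within, rule D) simp
  have "norm (1 / P (x + 0 *s v)) \<le> 1 / ((L + 1) * norm x)"
  proof (rule maximum_modulus_frontier[of "\<lambda>u. 1 / P (x + u *s v)" "cball 0 ?k"])
    show "(\<lambda>u. 1 / P (x + u *s v)) holomorphic_on interior (cball 0 ?k)"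
      using nz by (intro holomorphic_on_divide holomorphic_on_const holomorphic_on_subset[OF hol]) auto
    show "continuous_on (closure (cball 0 ?k)) (\<lambda>u. 1 / P (x + u *s v))"
      using nz by (intro continuous_on_divide continuous_on_const holomorphic_on_imp_continuous_on holomorphic_on_subset[OF hol]) auto
    fix u assume "u \<in> frontier (cball (0::complex) ?k)"
    then have u: "norm u = ?k" using k by (simp add: frontier_cball)
    have uv: "norm (u *s v) < \<rho>"
    proof -
      have "norm (u *s v) = ?k * norm v" by (simp add: norm_cvec_smult u)
      then show ?thesis using small(2) norm_ge_zero[of x] by linarith
    qed
    have "(2 * L + 1) * norm x \<le> (c * K ^ d) * norm x" using K(2) by (intro mult_right_mono) auto
    also have "\<dots> = c * ?k ^ d" by (simp add: power_mult_distrib \<epsilon>(1))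
    also have "\<dots> \<le> norm (P (u *s v))" using low(2)[of u] u small(1) by simp
    finally have "(2 * L + 1) * norm x \<le> norm (P (u *s v))" .
    moreover have "norm (P (x + u *s v) - P (u *s v)) \<le> L * norm x"
      using lip(2)[OF near uv, of u] u by simp
    moreover have "norm (P (u *s v)) \<le> norm (P (x + u *s v)) + norm (P (x + u *s v) - P (u *s v))"
      by (metis norm_minus_commute norm_triangle_sub)
    moreover have "(L + 1) * norm x = (2 * L + 1) * norm x - L * norm x" by (simp add: algebra_simps)
    ultimately have "(L + 1) * norm x \<le> norm (P (x + u *s v))" by linarith
    moreover have "0 < (L + 1) * norm x" using lip(1) xpos by simp
    ultimately show "norm (1 / P (x + u *s v)) \<le> 1 / ((L + 1) * norm x)"
      by (simp add: norm_divide frac_le)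
  qed (use k in auto)
  then have "1 / norm (P x) \<le> 1 / ((L + 1) * norm x)" by (simp add: norm_divide)
  moreover have "norm (P x) > 0" using nz[of 0] k by simp
  ultimately have "(L + 1) * norm x \<le> norm (P x)"
    by (rule inverse_le_imp_le[unfolded inverse_eq_divide])
  also have "norm (P x) \<le> L * norm x"
    using lip(2)[of x 0] near[of 0] k \<open>P 0 = 0\<close> small(2) norm_ge_zero[of x] by auto
  finally show False using xpos by (simp add: algebra_simps)
qed

text \<open>
  The truncation \<open>P\<close> of \<open>G\<close> is a polynomial with a genuine zero close to \<open>x\<close> on the line in direction
  \<open>v\<close>, at distance of the order of \<open>\<epsilon> = \<bar>x\<bar>\<^bsup>1/d\<^esup>\<close>. At this zero each \<open>W\<^sub>j\<close> equals the remainder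
  \<open>W\<^sub>j - P H\<^sub>j\<close>, which has order at least \<open>M\<close>.
\<close>

lemma approximate_common_zeros:
  fixes W \<eta> :: "fps3^3"
  assumes \<rho>: "\<rho> > 0" and conv: "\<And>j. converges3 \<rho> (W $ j)" and W: "\<And>j. W $ j = G * \<eta> $ j"
    and G0: "coeff3 G 0 = 0"
    and c: "c > 0" "d > 0" "t0 > 0" "\<And>t. norm t \<le> t0 \<Longrightarrow> c * norm t ^ d \<le> norm (eval3 (W $ i) (t *s v))"
    and "r > 0"
  shows "\<exists>C \<delta>. \<delta> > 0 \<and> (\<forall>x. 0 < norm x \<and> norm x < \<delta> \<longrightarrow>
      (\<exists>u. norm u \<le> r \<and> (\<forall>j. norm (eval3 (W $ j) (x + u *s v)) \<le> C * norm x ^ N)))"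
proof -
  \<comment> \<open>\<open>\<epsilon>\<^sup>M\<close> has to be at most \<open>\<epsilon>\<^bsup>N d\<^esup> = \<bar>x\<bar>\<^sup>N\<close>, and \<open>M > d\<close> makes the remainder negligible against the
    lower bound of order \<open>d\<close>.\<close>
  define M where "M = N * d + d + 1"
  define P where "P = trunc3 M G"
  define H where "H j = trunc3 M (\<eta> $ j)" for j
  have convP: "converges3 s P" and convH: "converges3 s (H j)" for s j
    by (simp_all add: P_def H_def converges3_trunc3)
  have ord: "order_ge M (W $ j - P * H j)" for j
  proof -
    have "W $ j - P * H j = (G - P) * \<eta> $ j + P * (\<eta> $ j - H j)" by (simp add: W algebra_simps)
    then show ?thesis unfolding P_def H_def
      by (simp only:) (intro order_ge_add order_ge_mult_left order_ge_mult_right order_ge_diff_trunc3)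
  qed
  have convD: "converges3 \<rho> (W $ j - P * H j)" for j
    using \<rho> by (intro converges3_diff converges3_mult conv convP convH) auto
  have "\<exists>C\<ge>0. \<forall>z. norm z < \<rho> \<longrightarrow> norm (eval3 (W $ j - P * H j) z) \<le> C * norm z ^ M" for j
    by (rule eval3_order_bound[OF convD ord \<rho>])
  then obtain C0 where C0: "\<And>j. C0 j \<ge> 0" "\<And>j z. norm z < \<rho> \<Longrightarrow> norm (eval3 (W $ j - P * H j) z) \<le> C0 j * norm z ^ M"
    by metis
  define C where "C = (\<Sum>j\<in>UNIV. C0 j)"
  have C: "C \<ge> 0" "C0 j \<le> C" for j
    unfolding C_def using C0(1) by (auto intro: sum_nonneg member_le_sum)
  have val: "eval3 (W $ j - P * H j) z = eval3 (W $ j) z - eval3 P z * eval3 (H j) z" if "norm z < \<rho>" for z j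
    using norm_less_imp_polydisc[OF that] \<rho>
    by (simp add: eval3_diff[OF conv converges3_mult[OF convP convH]] eval3_mult[OF convP convH])
  have err: "norm (eval3 (W $ j) z - eval3 P z * eval3 (H j) z) \<le> C * norm z ^ M" if "norm z < \<rho>" for z j
    using C0(2)[OF that, of j] mult_right_mono[OF C(2)[of j], of "norm z ^ M"] val[OF that, of j] by simp
  obtain B where B: "B > 0" "\<And>z. norm z < \<rho> \<Longrightarrow> norm (eval3 (H i) z) \<le> B"
    using eval3_bounded[OF convH \<rho>] by blast
  obtain L where L: "L > 0" "\<And>p q. norm p < 2 * \<rho> / 2 \<Longrightarrow> norm q < 2 * \<rho> / 2 \<Longrightarrow> norm (eval3 P p - eval3 P q) \<le> L * norm (p - q)"
    using eval3_lipschitz[OF convP, of "2 * \<rho>"] \<rho> by auto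
  have P0: "eval3 P 0 = 0" using G0 by (simp add: eval3_0 P_def coeff3_trunc3)
  let ?V = "C * norm v ^ M"
  define c1 where "c1 = c / (2 * B)"
  \<comment> \<open>so small that the remainder is at most half of \<open>c \<bar>t\<bar>\<^sup>d\<close> and the points stay in the polydisc\<close>
  define t1 where "t1 = min t0 (min 1 (min (c / (2 * (?V + 1))) (\<rho> / (2 * (norm v + 1)))))"
  have V: "?V \<ge> 0" using C(1) by simp
  have t1: "t1 > 0" "t1 \<le> t0" "t1 \<le> 1" "t1 \<le> c / (2 * (?V + 1))" "t1 \<le> \<rho> / (2 * (norm v + 1))"
  proof -
    have "c / (2 * (?V + 1)) > 0" "\<rho> / (2 * (norm v + 1)) > 0"
      using c(1) V \<rho> norm_ge_zero[of v] by (auto intro!: divide_pos_pos add_nonneg_pos)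
    then show "t1 > 0" unfolding t1_def using c(3) by (simp only: min_less_iff_conj zero_less_one)
    show "t1 \<le> t0" "t1 \<le> 1" "t1 \<le> c / (2 * (?V + 1))" "t1 \<le> \<rho> / (2 * (norm v + 1))"
      unfolding t1_def min_le_iff_disj by simp_all
  qed
  have low: "c1 * norm t ^ d \<le> norm (eval3 P (t *s v))" if t: "norm t \<le> t1" for t
  proof -
    have tv: "norm (t *s v) < \<rho>"
    proof -
      have "norm (t *s v) \<le> \<rho> / (2 * (norm v + 1)) * norm v"
        unfolding norm_cvec_smult using t t1(5) by (intro mult_right_mono) auto
      also have "\<dots> \<le> \<rho> / (2 * (norm v + 1)) * (norm v + 1)"
        using \<rho> by (intro mult_left_mono) auto
      also have "\<dots> = \<rho> / 2" using norm_ge_zero[of v] by (simp add: field_simps add_nonneg_eq_0_iff)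
      also have "\<dots> < \<rho>" using \<rho> by simp
      finally show ?thesis .
    qed
    have "norm t ^ M = norm t ^ d * (norm t * norm t ^ (N * d))" by (simp add: M_def power_add)
    also have "\<dots> \<le> norm t ^ d * (t1 * 1)"
      using t t1(1,3) by (intro mult_left_mono mult_mono power_le_one) auto
    finally have tM: "norm t ^ M \<le> norm t ^ d * t1" by simp
    have "c * norm t ^ d \<le> norm (eval3 (W $ i) (t *s v))" using c(4)[of t] t t1(2) by simp
    also have "\<dots> \<le> norm (eval3 P (t *s v) * eval3 (H i) (t *s v)) + norm (eval3 (W $ i) (t *s v) - eval3 P (t *s v) * eval3 (H i) (t *s v))"
      by (metis norm_triangle_sub)
    also have "\<dots> \<le> norm (eval3 P (t *s v)) * B + C * norm (t *s v) ^ M"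
      using err[OF tv, of i] B(2)[OF tv] by (intro add_mono) (auto simp: norm_mult intro: mult_left_mono)
    also have "C * norm (t *s v) ^ M = ?V * norm t ^ M"
      by (simp add: norm_cvec_smult power_mult_distrib)
    also have "?V * norm t ^ M \<le> ?V * (norm t ^ d * t1)" using tM V by (intro mult_left_mono)
    also have "\<dots> \<le> (?V + 1) * (norm t ^ d * t1)" using t1(1) by (intro mult_right_mono) auto
    also have "\<dots> = norm t ^ d * ((?V + 1) * t1)" by (simp add: mult_ac)
    also have "\<dots> \<le> norm t ^ d * (c / 2)"
      using t1(4) V by (intro mult_left_mono) (auto simp: field_simps)
    finally have "c / 2 * norm t ^ d \<le> norm (eval3 P (t *s v)) * B" by (simp add: algebra_simps)
    then show ?thesis using B(1) by (simp add: c1_def field_simps)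
  qed
  have c1: "c1 > 0" using c(1) B(1) by (simp add: c1_def)
  obtain K where K: "K > 0" "c1 * K ^ d \<ge> 2 * L + 1"
  proof -
    define K where "K = max 1 ((2 * L + 1) / c1)"
    have "K \<le> K ^ d" using c(2) by (intro self_le_power) (auto simp: K_def)
    then have "(2 * L + 1) / c1 \<le> K ^ d" by (simp add: K_def)
    then have "2 * L + 1 \<le> c1 * K ^ d" using c1 by (simp add: field_simps)
    moreover have "K > 0" by (simp add: K_def)
    ultimately show ?thesis using that by blast
  qed
  define \<epsilon>0 where "\<epsilon>0 = min 1 (min (t1 / K) (min (r / K) (\<rho> / (2 * (1 + K * norm v)))))"
  have Kv: "1 + K * norm v > 0" using K(1) by (simp add: add_pos_nonneg)
  have \<epsilon>0: "\<epsilon>0 > 0" "\<epsilon>0 \<le> 1" "\<epsilon>0 \<le> t1 / K" "\<epsilon>0 \<le> r / K" "\<epsilon>0 \<le> \<rho> / (2 * (1 + K * norm v))"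
    using t1(1) K(1) \<open>r > 0\<close> \<rho> Kv unfolding \<epsilon>0_def by auto
  let ?C = "C * (1 + K * norm v) ^ M"
  have "\<exists>u. norm u \<le> r \<and> (\<forall>j. norm (eval3 (W $ j) (x + u *s v)) \<le> ?C * norm x ^ N)"
    if x: "0 < norm x" "norm x < \<epsilon>0 ^ d" for x
  proof -
    define \<epsilon> where "\<epsilon> = root d (norm x)"
    have \<epsilon>: "norm x = \<epsilon> ^ d" "0 < \<epsilon>" using c(2) x(1) by (simp_all add: \<epsilon>_def)
    have "\<epsilon> < \<epsilon>0"
      using x(2) \<epsilon> \<epsilon>0(1) by (metis less_imp_le power_less_imp_less_base)
    then have \<epsilon>': "\<epsilon> \<le> 1" "K * \<epsilon> \<le> t1" "K * \<epsilon> \<le> r" "\<epsilon> * (1 + K * norm v) < \<rho>"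
    proof -
      show "\<epsilon> \<le> 1" using \<open>\<epsilon> < \<epsilon>0\<close> \<epsilon>0(2) by simp
      have "K * \<epsilon> \<le> K * \<epsilon>0" using \<open>\<epsilon> < \<epsilon>0\<close> K(1) by simp
      moreover have "K * \<epsilon>0 \<le> t1" "K * \<epsilon>0 \<le> r" using \<epsilon>0(3,4) K(1) by (simp_all add: field_simps)
      ultimately show "K * \<epsilon> \<le> t1" "K * \<epsilon> \<le> r" by linarith+
      have "\<epsilon> * (1 + K * norm v) \<le> \<rho> / (2 * (1 + K * norm v)) * (1 + K * norm v)"
        using \<open>\<epsilon> < \<epsilon>0\<close> \<epsilon>0(5) Kv by (intro mult_right_mono) auto
      also have "\<dots> = \<rho> / 2"
      proof -
        have "\<rho> / (2 * Y) * Y = \<rho> / 2" if "Y > 0" for Y :: real using that by simp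
        from this[OF Kv] show ?thesis .
      qed
      also have "\<dots> < \<rho>" using \<rho> by simp
      finally show "\<epsilon> * (1 + K * norm v) < \<rho>" .
    qed
    have x\<epsilon>: "norm x \<le> \<epsilon>"
      unfolding \<epsilon>(1) using \<epsilon>(2) \<epsilon>'(1) c(2) power_decreasing[of 1 d \<epsilon>] by simp
    have sm: "norm x + K * \<epsilon> * norm v < \<rho>" using x\<epsilon> \<epsilon>'(4) by (simp add: algebra_simps)
    have "\<exists>u. norm u \<le> K * \<epsilon> \<and> eval3 P (x + u *s v) = 0"
    proof (rule small_zero_on_line[where \<rho> = \<rho> and P = "eval3 P", OF _ L(1) _ P0 c1 low \<epsilon> K \<epsilon>'(2) sm])
      fix y :: "complex^3" assume "norm y < \<rho>"
      then have "y + 0 *s v \<in> polydisc \<rho>" using norm_less_imp_polydisc by simp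
      from eval3_line_deriv[OF convP \<rho> this]
      show "(\<lambda>t. eval3 P (y + t *s v)) field_differentiable at 0" by (auto simp: field_differentiable_def)
    qed (use L(2) in auto)
    then obtain u where u: "norm u \<le> K * \<epsilon>" "eval3 P (x + u *s v) = 0" by blast
    have q: "norm (x + u *s v) \<le> \<epsilon> * (1 + K * norm v)"
    proof -
      have "norm (x + u *s v) \<le> norm x + norm u * norm v"
        using norm_triangle_ineq[of x "u *s v"] by (simp add: norm_cvec_smult)
      also have "\<dots> \<le> \<epsilon> + K * \<epsilon> * norm v" using u(1) x\<epsilon> by (intro add_mono mult_right_mono) auto
      finally show ?thesis by (simp add: algebra_simps)
    qed
    have "norm (eval3 (W $ j) (x + u *s v)) \<le> ?C * norm x ^ N" for j
    proof -
      have "norm (eval3 (W $ j) (x + u *s v)) \<le> C * norm (x + u *s v) ^ M"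
        using err[of "x + u *s v" j] q \<epsilon>'(4) u(2) by simp
      also have "\<dots> \<le> C * (\<epsilon> * (1 + K * norm v)) ^ M"
        using q C(1) by (intro mult_left_mono power_mono) auto
      also have "\<dots> = ?C * \<epsilon> ^ M" by (simp add: power_mult_distrib)
      also have "\<dots> \<le> ?C * \<epsilon> ^ (d * N)"
        using \<epsilon>(2) \<epsilon>'(1) C(1) Kv by (intro mult_left_mono power_decreasing) (auto simp: M_def)
      also have "\<epsilon> ^ (d * N) = norm x ^ N" by (simp add: \<epsilon>(1) power_mult)
      finally show ?thesis .
    qed
    then show ?thesis using u(1) \<epsilon>'(3) by (intro exI[of _ u]) auto
  qed
  then show ?thesis using \<epsilon>0(1) by (intro exI[of _ ?C] exI[of _ "\<epsilon>0 ^ d"]) auto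
qed

section \<open>Common zeros on parallel lines\<close>

lemma holomorphic_on_line:
  assumes F: "converges3 \<rho> F" "\<rho> > 0" and "\<And>t. t \<in> T \<Longrightarrow> p + t *s u \<in> polydisc \<rho>"
  shows "(\<lambda>t. eval3 F (p + t *s u)) holomorphic_on T"
proof (rule holomorphic_onI)
  fix t assume "t \<in> T"
  from eval3_line_deriv[OF F assms(3)[OF this]]
  have "(\<lambda>t. eval3 F (p + t *s u)) field_differentiable at t" by (auto simp: field_differentiable_def)
  then show "(\<lambda>t. eval3 F (p + t *s u)) field_differentiable at t within T"
    by (rule field_differentiable_at_within)
qed

text \<open>
  This allows the three coefficients of the form to be treated through the single functions
  \<open>W\<^sub>1 + t W\<^sub>2 + t\<^sup>2 W\<^sub>3\<close> with natural numbers \<open>t\<close>.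
\<close>

lemma quadratic_eq_0:
  assumes "infinite {t :: nat. a + of_nat t * b + of_nat t ^ 2 * c = (0 :: complex)}"
  shows "a = 0 \<and> b = 0 \<and> c = 0"
proof -
  let ?p = "[:a, b, c:]"
  have "inj_on complex_of_nat A" for A by (rule inj_onI) simp
  then have "infinite (of_nat ` {t :: nat. a + of_nat t * b + of_nat t ^ 2 * c = (0 :: complex)} :: complex set)"
    using assms finite_image_iff by blast
  moreover have "(of_nat ` {t :: nat. a + of_nat t * b + of_nat t ^ 2 * c = (0 :: complex)} :: complex set) \<subseteq> {x. poly ?p x = 0}"
    by (auto simp: algebra_simps power2_eq_square)
  ultimately have "infinite {x. poly ?p x = 0}" using finite_subset by blast
  then have "?p = 0" using poly_roots_finite by blast
  then show ?thesis by simp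
qed

text \<open>
  One coefficient \<open>W\<^sub>i\<close>, restricted to a line in a suitable direction \<open>v\<close> through \<open>0\<close>, has an isolated
  zero of some order \<open>d\<close> at \<open>0\<close>; this lower bound persists on the circle \<open>\<bar>u\<bar> = r\<close> of nearby parallel
  lines. On the family of lines through \<open>s z\<close> the pair consisting of \<open>W\<^sub>i\<close> and any combination of the
  coefficients is flat at \<open>s = 0\<close>, so it has a common root at \<open>s = 1\<close>. Running through infinitely many
  combinations yields a common root of all coefficients.
\<close>

theorem common_zeros_on_lines:
  fixes W \<eta> :: "fps3^3"
  assumes \<rho>: "\<rho> > 0" and conv: "\<And>j. converges3 \<rho> (W $ j)" and W: "\<And>j. W $ j = G * \<eta> $ j"
    and G0: "coeff3 G 0 = 0" and "W \<noteq> 0" and e: "e > 0"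
  shows "\<exists>i v r \<delta>. 0 < r \<and> 0 < \<delta> \<and>
      (\<forall>z u. norm z < \<delta> \<longrightarrow> norm u \<le> r \<longrightarrow> norm (z + u *s v) < e) \<and>
      (\<forall>z u. norm z < \<delta> \<longrightarrow> norm u = r \<longrightarrow> eval3 (W $ i) (z + u *s v) \<noteq> 0) \<and>
      (\<forall>z. norm z < \<delta> \<longrightarrow> (\<exists>u. norm u < r \<and> (\<forall>j. eval3 (W $ j) (z + u *s v) = 0)))"
proof -
  have W0: "eval3 (W $ j) 0 = 0" for j by (simp add: eval3_0 W coeff3_0_mult G0)
  obtain i where "W $ i \<noteq> 0" using \<open>W \<noteq> 0\<close> by (auto simp: vec_eq_iff)
  then obtain v where v: "v \<in> polydisc \<rho>" "eval3 (W $ i) v \<noteq> 0"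
    using eval3_eq_0_imp_0[OF conv \<rho>] by blast
  have nv: "norm v > 0" using v(2) W0 by auto
  define A where "A t = eval3 (W $ i) (0 + t *s v)" for t
  obtain \<rho>' where \<rho>': "0 < \<rho>'" "\<rho>' < \<rho>" "v \<in> polydisc \<rho>'" using polydisc_shrink[OF v(1) \<rho>] by blast
  have A_holo: "A holomorphic_on ball 0 (\<rho> / \<rho>')"
    unfolding A_def
  proof (rule holomorphic_on_line[OF conv \<rho>])
    fix t :: complex assume "t \<in> ball 0 (\<rho> / \<rho>')"
    then have t: "norm t * \<rho>' < \<rho>" using \<rho>'(1) by (simp add: field_simps)
    have "norm (t * v $ i) < \<rho>" for i
    proof -
      have "norm (t * v $ i) \<le> norm t * \<rho>'"
        unfolding norm_mult using polydisc_norm_le[OF \<rho>'(3)] by (intro mult_left_mono) auto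
      then show ?thesis using t by simp
    qed
    then show "0 + t *s v \<in> polydisc \<rho>" by (simp add: polydisc_def)
  qed
  have "1 \<in> ball (0::complex) (\<rho> / \<rho>')" using \<rho>' by simp
  then have Anz: "\<exists>w\<in>ball 0 (\<rho> / \<rho>'). A w \<noteq> 0" using v(2) by (intro bexI[of _ 1]) (auto simp: A_def)
  have A0: "A 0 = 0" by (simp add: A_def W0)
  have in0: "0 \<in> ball (0::complex) (\<rho> / \<rho>')" using \<rho> \<rho>' by simp
  note Z = zorder_exist_zero[OF A_holo open_ball connected_ball in0 Anz]
  have ord: "zorder A 0 > 0" using Z A0 by simp
  obtain t0 where t0: "t0 > 0" "zor_poly A 0 holomorphic_on cball 0 t0"
     "\<And>w. w \<in> cball 0 t0 \<Longrightarrow> A w = zor_poly A 0 w * (w - 0) ^ nat (zorder A 0) \<and> zor_poly A 0 w \<noteq> 0"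
    using Z by blast
  define d where "d = nat (zorder A 0)"
  have d: "d > 0" using ord by (simp add: d_def)
  have "continuous_on (cball 0 t0) (\<lambda>w. norm (zor_poly A 0 w))"
    by (intro continuous_on_norm holomorphic_on_imp_continuous_on t0)
  moreover have "cball (0::complex) t0 \<noteq> {}" using t0(1) by simp
  ultimately obtain w0 where w0: "w0 \<in> cball 0 t0" "\<And>w. w \<in> cball 0 t0 \<Longrightarrow> norm (zor_poly A 0 w0) \<le> norm (zor_poly A 0 w)"
    using continuous_attains_inf[OF compact_cball] by blast
  define c where "c = norm (zor_poly A 0 w0)"
  have c: "c > 0" using t0(3)[OF w0(1)] by (simp add: c_def)
  have low: "c * norm t ^ d \<le> norm (eval3 (W $ i) (t *s v))" if "norm t \<le> t0" for t
  proof -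
    have t: "t \<in> cball 0 t0" using that by simp
    have "c * norm t ^ d \<le> norm (zor_poly A 0 t) * norm t ^ d"
      using w0(2)[OF t] by (intro mult_right_mono) (auto simp: c_def)
    also have "\<dots> = norm (A t)" using t0(3)[OF t] by (simp add: d_def norm_mult norm_power)
    finally show ?thesis by (simp add: A_def)
  qed
  have "\<exists>L>0. \<forall>p q. norm p < \<rho> / 2 \<longrightarrow> norm q < \<rho> / 2 \<longrightarrow> norm (eval3 F p - eval3 F q) \<le> L * norm (p - q)"
    if "converges3 \<rho> F" for F
    using eval3_lipschitz[OF that \<rho>] .
  then obtain L where L: "L > 0" "\<And>p q. norm p < \<rho> / 2 \<Longrightarrow> norm q < \<rho> / 2 \<Longrightarrow> norm (eval3 (W $ i) p - eval3 (W $ i) q) \<le> L * norm (p - q)"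
    using conv by meson
  define r where "r = min t0 (min (\<rho> / (8 * norm v)) (e / (4 * norm v)))"
  have r: "r > 0" "r \<le> t0" "r * norm v \<le> \<rho> / 8" "r * norm v \<le> e / 4"
  proof -
    show "r > 0" unfolding r_def using t0(1) \<rho> e nv by simp
    show "r \<le> t0" by (simp add: r_def)
    have "r \<le> \<rho> / (8 * norm v)" "r \<le> e / (4 * norm v)" unfolding r_def min_le_iff_disj by simp_all
    then show "r * norm v \<le> \<rho> / 8" "r * norm v \<le> e / 4" using nv by (simp_all add: field_simps)
  qed
  define \<delta> where "\<delta> = min (\<rho> / 8) (min (e / 4) (c * r ^ d / (4 * L)))"
  have \<delta>: "\<delta> > 0" "\<delta> \<le> \<rho> / 8" "\<delta> \<le> e / 4" "L * (2 * \<delta>) \<le> c * r ^ d / 2"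
  proof -
    show "\<delta> > 0" unfolding \<delta>_def using \<rho> e c r(1) L(1) by simp
    show "\<delta> \<le> \<rho> / 8" "\<delta> \<le> e / 4" unfolding \<delta>_def min_le_iff_disj by simp_all
    have "\<delta> \<le> c * r ^ d / (4 * L)" unfolding \<delta>_def min_le_iff_disj by simp
    then show "L * (2 * \<delta>) \<le> c * r ^ d / 2" using L(1) by (simp add: field_simps)
  qed
  have norm_pt: "norm (z + u *s v) \<le> norm z + norm u * norm v" for z u
    using norm_triangle_ineq[of z "u *s v"] by (simp add: norm_cvec_smult)
  have pt: "norm (s *s z + u *s v) < \<rho> / 2" if "norm z < \<delta>" "norm s < 2" "norm u < 2 * r" for s z u
  proof -
    have "norm s * norm z \<le> 2 * norm z" using that(2) by (intro mult_right_mono) auto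
    moreover have "norm u * norm v \<le> (2 * r) * norm v" using that(3) by (intro mult_right_mono) auto
    ultimately show ?thesis
      using norm_pt[of "s *s z" u] that(1) \<delta>(2) r(3) unfolding norm_cvec_smult by linarith
  qed
  have ptD: "s *s z + u *s v \<in> polydisc (\<rho> / 2)" if "norm z < \<delta>" "norm s < 2" "norm u < 2 * r" for s z u
    using pt[OF that] by (rule norm_less_imp_polydisc)
  have sub: "polydisc (\<rho> / 2) \<subseteq> polydisc \<rho>" using \<rho> by (intro polydisc_mono) simp
  have A_low: "c * r ^ d / 2 \<le> norm (eval3 (W $ i) (s *s z + u *s v))"
    if "norm z < \<delta>" "norm s < 2" "norm u = r" for s z u
  proof -
    have u2: "norm u < 2 * r" using that(3) r(1) by simp
    have p0: "norm (u *s v) < \<rho> / 2" using pt[of 0 0 u] \<delta>(1) u2 by simp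
    have "norm (eval3 (W $ i) (s *s z + u *s v) - eval3 (W $ i) (u *s v)) \<le> L * norm (s *s z)"
      using L(2)[OF pt[OF that(1,2) u2] p0] by simp
    also have "\<dots> \<le> L * (2 * \<delta>)"
      unfolding norm_cvec_smult using that L(1) by (intro mult_left_mono mult_mono) auto
    also have "\<dots> \<le> c * r ^ d / 2" by (rule \<delta>(4))
    finally have "norm (eval3 (W $ i) (s *s z + u *s v) - eval3 (W $ i) (u *s v)) \<le> c * r ^ d / 2" .
    moreover have "c * r ^ d \<le> norm (eval3 (W $ i) (u *s v))" using low[of u] that(3) r(2) by simp
    moreover have "norm (eval3 (W $ i) (u *s v)) \<le> norm (eval3 (W $ i) (s *s z + u *s v)) + norm (eval3 (W $ i) (s *s z + u *s v) - eval3 (W $ i) (u *s v))"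
      by (metis norm_minus_commute norm_triangle_sub)
    ultimately show ?thesis by linarith
  qed
  have cr: "c * r ^ d / 2 > 0" using c r(1) by simp
  \<comment> \<open>combinations of the coefficients, with \<open>t\<close> running through the natural numbers\<close>
  define Gt where "Gt t = W $ 1 + (const3 (of_nat t) * W $ 2 + const3 (of_nat t ^ 2) * W $ 3)" for t :: nat
  have convGt: "converges3 \<rho> (Gt t)" for t
    unfolding Gt_def using \<rho> by (intro converges3_add converges3_const_mult conv) auto
  have evalGt: "eval3 (Gt t) x = eval3 (W $ 1) x + of_nat t * eval3 (W $ 2) x + of_nat t ^ 2 * eval3 (W $ 3) x"
    if "x \<in> polydisc \<rho>" for x t
    unfolding Gt_def using \<rho> that
    by (simp add: eval3_add[where \<rho> = \<rho>] eval3_const_mult converges3_add converges3_const_mult conv)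
  have root: "\<exists>u. norm u < r \<and> eval3 (W $ i) (z + u *s v) = 0 \<and> eval3 (Gt t) (z + u *s v) = 0"
    if z: "norm z < \<delta>" "z \<noteq> 0" for z t
  proof -
    let ?a = "\<lambda>s u. eval3 (W $ i) (s *s z + u *s v)"
    let ?a' = "\<lambda>s u. \<Sum>j\<in>UNIV. v $ j * eval3 (fps3_deriv j (W $ i)) (s *s z + u *s v)"
    let ?g = "\<lambda>s u. eval3 (Gt t) (s *s z + u *s v)"
    have contp: "continuous_on X (\<lambda>x. fst x *s z + snd x *s v)" for X :: "(complex \<times> complex) set"
    proof -
      have "(\<lambda>x. fst x *s z + snd x *s v) = (\<lambda>x. \<chi> i. fst x * z $ i + snd x * v $ i)"
        by (auto simp: vec_eq_iff)
      then show ?thesis by (simp only:) (intro continuous_on_vec_lambda continuous_intros)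
    qed
    have cont: "continuous_on (ball 0 2 \<times> sphere 0 r) (\<lambda>(s, u). eval3 F (s *s z + u *s v))"
      if "converges3 (\<rho> / 2) F" for F
    proof -
      have "continuous_on (ball 0 2 \<times> sphere 0 r) (\<lambda>x. eval3 F (fst x *s z + snd x *s v))"
        by (rule continuous_on_compose2[OF eval3_continuous[OF that] contp])
           (use ptD z r(1) in auto)
      then show ?thesis by (simp add: case_prod_unfold)
    qed
    have hol_s: "(\<lambda>s. eval3 F (s *s z + u *s v)) holomorphic_on ball 0 2"
      if "converges3 (\<rho> / 2) F" "norm u = r" for F u
    proof -
      have "(\<lambda>s. eval3 F (u *s v + s *s z)) holomorphic_on ball 0 2"
        by (rule holomorphic_on_line[OF that(1)])
           (use \<rho> ptD[OF z(1), of _ u] that(2) r(1) in \<open>auto simp: add.commute\<close>)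
      then show ?thesis by (simp add: add.commute)
    qed
    have half: "converges3 (\<rho> / 2) F" if "converges3 \<rho> F" for F
      using converges3_mono[OF that] \<rho> by simp
    have halfd: "converges3 (\<rho> / 2) (fps3_deriv j (W $ i))" for j
      using \<rho> by (intro converges3_deriv[OF conv]) auto
    obtain Lg where Lg: "Lg > 0" "\<And>p q. norm p < \<rho> / 2 \<Longrightarrow> norm q < \<rho> / 2 \<Longrightarrow> norm (eval3 (Gt t) p - eval3 (Gt t) q) \<le> Lg * norm (p - q)"
      using eval3_lipschitz[OF convGt \<rho>, of t] by blast
    obtain B where B: "B > 0" "\<And>x. norm x < \<rho> \<Longrightarrow> norm (eval3 (Gt t) x) \<le> B"
      using eval3_bounded[OF convGt \<rho>, of t] by blast
    \<comment> \<open>The radius \<open>S = 2\<close> in \<open>s\<close> puts the line through \<open>z\<close> itself, at \<open>s = 1\<close>, inside the domain.\<close>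
    have "\<exists>u. norm u < r \<and> ?a 1 u = 0 \<and> ?g 1 u = 0"
    proof (rule common_root_of_flat[where a = ?a and a' = ?a' and g = ?g and R = "2 * r" and S = 2
          and m = "c * r ^ d / 2" and T = "B + 1" and L = "Lg * norm v", OF r(1) _ _ _ _ _ _ _ _ _ cr])
      show "r < 2 * r" using r(1) by simp
    next
      fix s u :: complex assume s: "s \<in> ball 0 2" and u: "u \<in> ball 0 (2 * r)"
      have "s *s z + u *s v \<in> polydisc \<rho>" using ptD[OF z(1), of s u] s u sub by auto
      from eval3_line_deriv[OF conv \<rho> this]
      show "(?a s has_field_derivative ?a' s u) (at u)" .
    next
      fix s :: complex assume s: "s \<in> ball 0 2"
      show "?g s holomorphic_on ball 0 (2 * r)"
        by (rule holomorphic_on_line[OF convGt \<rho>]) (use ptD[OF z(1), of s] s sub in auto)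
    next
      show "continuous_on (ball 0 2 \<times> sphere 0 r) (\<lambda>(s, u). ?a s u)" by (rule cont[OF half[OF conv]])
      show "continuous_on (ball 0 2 \<times> sphere 0 r) (\<lambda>(s, u). ?g s u)" by (rule cont[OF half[OF convGt]])
      have "continuous_on (ball 0 2 \<times> sphere 0 r) (\<lambda>x. \<Sum>j\<in>UNIV. v $ j * (\<lambda>(s, u). eval3 (fps3_deriv j (W $ i)) (s *s z + u *s v)) x)"
        by (intro continuous_intros cont halfd)
      then show "continuous_on (ball 0 2 \<times> sphere 0 r) (\<lambda>(s, u). ?a' s u)" by (simp add: case_prod_unfold)
    next
      fix u :: complex assume u: "norm u = r"
      show "(\<lambda>s. ?a s u) holomorphic_on ball 0 2" by (rule hol_s[OF half[OF conv] u])
      show "(\<lambda>s. ?g s u) holomorphic_on ball 0 2" by (rule hol_s[OF half[OF convGt] u])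
      show "(\<lambda>s. ?a' s u) holomorphic_on ball 0 2"
        by (intro holomorphic_on_sum holomorphic_on_mult holomorphic_on_const hol_s[OF halfd u])
    next
      fix s u :: complex assume "s \<in> ball 0 2" "norm u = r"
      then show "c * r ^ d / 2 \<le> norm (?a s u)" using A_low[OF z(1)] by simp
    next
      fix s u :: complex assume "s \<in> ball 0 2" "norm u \<le> r"
      then have "norm (s *s z + u *s v) < \<rho>" using pt[OF z(1), of s u] r(1) \<rho> by simp
      then show "norm (?g s u) < B + 1" using B(2) by fastforce
    next
      show "0 \<le> Lg * norm v" using Lg(1) by simp
      fix s u u' :: complex assume *: "s \<in> ball 0 2" "norm u \<le> r" "norm u' \<le> r"
      have "norm (?g s u - ?g s u') \<le> Lg * norm ((s *s z + u *s v) - (s *s z + u' *s v))"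
        using * r(1) by (intro Lg(2) pt[OF z(1)]) auto
      also have "(s *s z + u *s v) - (s *s z + u' *s v) = (u - u') *s v"
        by (simp add: vec_eq_iff algebra_simps)
      finally show "norm (?g s u - ?g s u') \<le> Lg * norm v * norm (u - u')"
        by (simp only: norm_cvec_smult mult_ac)
    next
      fix N
      obtain C \<delta>N where C: "\<delta>N > 0" "\<And>x. 0 < norm x \<Longrightarrow> norm x < \<delta>N \<Longrightarrow>
          \<exists>u. norm u \<le> r \<and> (\<forall>j. norm (eval3 (W $ j) (x + u *s v)) \<le> C * norm x ^ N)"
        using approximate_common_zeros[OF \<rho> conv W G0 c d t0(1) low r(1), of N] by blast
      let ?T = "1 + real t + (real t)\<^sup>2"
      have T1: "?T \<ge> 1" by simp
      let ?C = "?T * (\<bar>C\<bar> * norm z ^ N)"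
      have nz: "norm z > 0" using z(2) by simp
      have "\<exists>u. norm u \<le> r \<and> norm (?a s u) \<le> ?C * norm s ^ N \<and> norm (?g s u) \<le> ?C * norm s ^ N"
        if s: "0 < norm s" "norm s < min 2 (\<delta>N / norm z)" for s
      proof -
        have x: "norm (s *s z) = norm s * norm z" by (rule norm_cvec_smult)
        have "0 < norm (s *s z)" "norm (s *s z) < \<delta>N"
          using s nz unfolding x by (auto simp: field_simps)
        then obtain u where u: "norm u \<le> r" "\<And>j. norm (eval3 (W $ j) (s *s z + u *s v)) \<le> C * norm (s *s z) ^ N"
          using C(2) by blast
        let ?D = "\<bar>C\<bar> * norm z ^ N * norm s ^ N"
        have D: "norm (eval3 (W $ j) (s *s z + u *s v)) \<le> ?D" for j
        proof -
          have "C * norm (s *s z) ^ N \<le> \<bar>C\<bar> * norm (s *s z) ^ N" by (intro mult_right_mono) auto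
          also have "\<dots> = ?D" unfolding x by (simp add: power_mult_distrib mult_ac)
          finally show ?thesis using u(2)[of j] by linarith
        qed
        have D0: "?D \<ge> 0" by simp
        have inD: "s *s z + u *s v \<in> polydisc \<rho>" using ptD[OF z(1), of s u] s u(1) r(1) sub by auto
        have "norm (?g s u) \<le> norm (eval3 (W $ 1) (s *s z + u *s v)) + real t * norm (eval3 (W $ 2) (s *s z + u *s v))
            + (real t)\<^sup>2 * norm (eval3 (W $ 3) (s *s z + u *s v))"
          unfolding evalGt[OF inD]
          by (intro norm_triangle_le add_mono) (simp_all add: norm_mult norm_power)
        also have "\<dots> \<le> ?D + real t * ?D + (real t)\<^sup>2 * ?D"
          by (intro add_mono mult_left_mono D) auto
        also have "\<dots> = ?C * norm s ^ N" by (simp add: algebra_simps)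
        finally have "norm (?g s u) \<le> ?C * norm s ^ N" .
        moreover have "norm (?a s u) \<le> ?C * norm s ^ N"
        proof -
          have "1 * ?D \<le> ?T * ?D" using T1 D0 by (intro mult_right_mono)
          then show ?thesis using D[of i] by (simp add: mult.assoc)
        qed
        ultimately show ?thesis using u(1) by blast
      qed
      then show "\<exists>C \<delta>. \<delta> > 0 \<and> (\<forall>s. 0 < norm s \<and> norm s < \<delta> \<longrightarrow>
          (\<exists>u. norm u \<le> r \<and> norm (?a s u) \<le> C * norm s ^ N \<and> norm (?g s u) \<le> C * norm s ^ N))"
        using C(1) nz by (intro exI[of _ ?C] exI[of _ "min 2 (\<delta>N / norm z)"]) auto
    qed simp
    then show ?thesis by simp
  qed
  have common: "\<exists>u. norm u < r \<and> (\<forall>j. eval3 (W $ j) (z + u *s v) = 0)" if z: "norm z < \<delta>" for z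
  proof (cases "z = 0")
    case True
    then show ?thesis using r(1) W0 by (intro exI[of _ 0]) simp
  next
    case False
    let ?A = "\<lambda>u. eval3 (W $ i) (z + u *s v)"
    have inD: "z + u *s v \<in> polydisc \<rho>" if "norm u < 2 * r" for u
      using ptD[OF z, of 1 u] that sub by auto
    \<comment> \<open>\<open>W\<^sub>i\<close> has finitely many zeros on the line, so one of them serves for infinitely many \<open>t\<close>.\<close>
    obtain u where u: "\<And>t. norm (u t) < r" "\<And>t. ?A (u t) = 0" "\<And>t. eval3 (Gt t) (z + u t *s v) = 0"
      using root[OF z False] by metis
    have "finite {w \<in> cball 0 r. ?A w = 0}"
    proof (rule holomorphic_compact_finite_zeros)
      show "?A holomorphic_on ball 0 (2 * r)" by (rule holomorphic_on_line[OF conv \<rho>]) (use inD in auto)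
      show "\<not> ?A constant_on ball 0 (2 * r)"
      proof
        assume "?A constant_on ball 0 (2 * r)"
        then obtain k where k: "\<And>w. w \<in> ball 0 (2 * r) \<Longrightarrow> ?A w = k" by (auto simp: constant_on_def)
        have "?A (of_real r) = ?A (u 0)" using k[of "of_real r"] k[of "u 0"] u(1)[of 0] r(1) by simp
        then show False using u(2)[of 0] A_low[OF z, of 1 "of_real r"] cr r(1) by simp
      qed
    qed (use r(1) in auto)
    moreover have "range u \<subseteq> {w \<in> cball 0 r. ?A w = 0}" using u(1,2) less_imp_le by auto
    ultimately have "finite (range u)" by (rule finite_subset[rotated])
    then obtain t0 where "infinite {t \<in> UNIV. u t = u t0}"
      using pigeonhole_infinite[of "UNIV :: nat set" u] by auto
    moreover have "{t \<in> UNIV. u t = u t0} \<subseteq> {t. eval3 (W $ 1) (z + u t0 *s v) + of_nat t * eval3 (W $ 2) (z + u t0 *s v) + of_nat t ^ 2 * eval3 (W $ 3) (z + u t0 *s v) = 0}"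
    proof
      fix t assume t: "t \<in> {t \<in> UNIV. u t = u t0}"
      have "z + u t0 *s v \<in> polydisc \<rho>" using inD u(1)[of t0] r(1) by simp
      from evalGt[OF this, of t] u(3)[of t] t
      show "t \<in> {t. eval3 (W $ 1) (z + u t0 *s v) + of_nat t * eval3 (W $ 2) (z + u t0 *s v) + of_nat t ^ 2 * eval3 (W $ 3) (z + u t0 *s v) = 0}"
        by simp
    qed
    ultimately have "infinite {t. eval3 (W $ 1) (z + u t0 *s v) + of_nat t * eval3 (W $ 2) (z + u t0 *s v) + of_nat t ^ 2 * eval3 (W $ 3) (z + u t0 *s v) = 0}"
      using finite_subset by blast
    from quadratic_eq_0[OF this] have "\<forall>j. eval3 (W $ j) (z + u t0 *s v) = 0" by (simp add: forall_3)
    then show ?thesis using u(1) by blast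
  qed
  have "norm (z + u *s v) < e" if "norm z < \<delta>" "norm u \<le> r" for z u
  proof -
    have "norm u * norm v \<le> r * norm v" using that(2) by (intro mult_right_mono) auto
    then show ?thesis using norm_pt[of z u] that(1) \<delta>(3) r(4) e by linarith
  qed
  moreover have "eval3 (W $ i) (z + u *s v) \<noteq> 0" if "norm z < \<delta>" "norm u = r" for z u
    using A_low[OF that(1), of 1 u] that(2) cr by auto
  ultimately show ?thesis using r(1) \<delta>(1) common by blast
qed

section \<open>A formal common factor forces a hypersurface of zeros\<close>

definition dir_deriv :: "complex^3 \<Rightarrow> fps3 \<Rightarrow> fps3" where
  "dir_deriv v = vderiv (\<chi> j. const3 (v $ j))"

lemma dir_deriv_3:
  "dir_deriv v F = const3 (v $ 1) * fps3_deriv 1 F + const3 (v $ 2) * fps3_deriv 2 F + const3 (v $ 3) * fps3_deriv 3 F"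
  by (simp add: dir_deriv_def vderiv_eq sum_3)

lemma dir_deriv_power_converges:
  assumes "converges3 \<rho> F" "0 < \<sigma>" "\<sigma> < \<rho>"
  shows "converges3 \<sigma> ((dir_deriv v ^^ n) F)"
  using assms(2,3)
proof (induction n arbitrary: \<sigma>)
  case 0
  then show ?case using converges3_mono[OF assms(1), of \<sigma>] by simp
next
  case (Suc n)
  obtain \<tau> where \<tau>: "\<sigma> < \<tau>" "\<tau> < \<rho>" using dense Suc.prems(2) by blast
  have "converges3 \<sigma> (fps3_deriv j ((dir_deriv v ^^ n) F))" for j
    using Suc.IH[of \<tau>] \<tau> Suc.prems by (intro converges3_deriv[of \<tau>]) auto
  then have "converges3 \<sigma> (dir_deriv v ((dir_deriv v ^^ n) F))"
    unfolding dir_deriv_3[of v "(dir_deriv v ^^ n) F"] using Suc.prems(1)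
    by (intro converges3_add converges3_const_mult) auto
  then show ?case by simp
qed

lemma dir_deriv_eval3:
  assumes "converges3 \<rho> F" "0 < \<sigma>" "\<sigma> < \<rho>" "p \<in> polydisc \<sigma>"
  shows "eval3 (dir_deriv v F) p = (\<Sum>j\<in>UNIV. v $ j * eval3 (fps3_deriv j F) p)"
proof -
  have c: "converges3 \<sigma> (fps3_deriv j F)" for j by (rule converges3_deriv[OF assms(1-3)])
  show ?thesis
    using assms(2) by (simp add: dir_deriv_3 sum_3 eval3_add[where \<rho> = \<sigma>] eval3_const_mult
        converges3_add converges3_const_mult c assms(4))
qed

lemma higher_deriv_on_line:
  assumes F: "converges3 \<rho> F" and \<sigma>: "0 < \<sigma>" "\<sigma> < \<rho>" and T: "open T" "\<And>t. t \<in> T \<Longrightarrow> z + t *s v \<in> polydisc \<sigma>"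
    and "t \<in> T"
  shows "(deriv ^^ n) (\<lambda>t. eval3 F (z + t *s v)) t = eval3 ((dir_deriv v ^^ n) F) (z + t *s v)"
  using assms(6)
proof (induction n arbitrary: t)
  case (Suc n)
  let ?F = "(dir_deriv v ^^ n) F"
  obtain \<tau> where \<tau>: "\<sigma> < \<tau>" "\<tau> < \<rho>" using dense \<sigma>(2) by blast
  have c: "converges3 \<tau> ?F" using \<tau> \<sigma> by (intro dir_deriv_power_converges[OF F]) auto
  have c': "converges3 \<sigma> ?F" by (rule dir_deriv_power_converges[OF F \<sigma>])
  have "((\<lambda>t. eval3 ?F (z + t *s v)) has_field_derivative eval3 ((dir_deriv v ^^ Suc n) F) (z + t *s v)) (at t)"
    using eval3_line_deriv[OF c' \<sigma>(1) T(2)[OF Suc.prems]] dir_deriv_eval3[OF c \<sigma>(1) \<tau>(1) T(2)[OF Suc.prems]]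
    by simp
  then have "((deriv ^^ n) (\<lambda>t. eval3 F (z + t *s v)) has_field_derivative eval3 ((dir_deriv v ^^ Suc n) F) (z + t *s v)) (at t)"
    by (rule has_field_derivative_transform_within_open[OF _ T(1) Suc.prems]) (simp add: Suc.IH)
  then show ?case by (simp add: DERIV_imp_deriv)
qed simp

text \<open>
  Where the derivative along \<open>v\<close> is nonzero, the zero set is a submanifold that meets each line in
  direction \<open>v\<close> at most once: it is a graph over a transversal plane.
\<close>

lemma hypersurface_graph:
  assumes F: "converges3 \<rho> F" and \<sigma>: "0 < \<sigma>" "\<sigma> < \<rho>" and q: "q \<in> polydisc \<sigma>"
    and "eval3 (dir_deriv v F) q \<noteq> 0"
  shows "\<exists>U. open U \<and> q \<in> U \<and> U \<subseteq> polydisc \<sigma> \<and>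
     (\<forall>T. open T \<longrightarrow> complex_submanifold 2 {x \<in> U. eval3 F x = 0 \<and> x \<in> T}) \<and>
     (\<forall>x\<in>U. \<forall>y\<in>U. \<forall>t. eval3 F x = eval3 F y \<longrightarrow> x = y + t *s v \<longrightarrow> x = y)"
proof -
  have nz: "(\<Sum>j\<in>UNIV. v $ j * eval3 (fps3_deriv j F) q) \<noteq> 0"
    using assms(5) by (simp add: dir_deriv_eval3[OF F \<sigma> q])
  then obtain k where k: "v $ k \<noteq> 0" by (metis (no_types, lifting) mult_zero_left sum.neutral)
  have cF: "converges3 \<sigma> F" using converges3_mono[OF F] \<sigma> by simp
  have d: "((\<lambda>t. eval3 F (x + t *s u)) has_field_derivative (\<Sum>j\<in>UNIV. u $ j * eval3 (fps3_deriv j F) x)) (at 0)"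
    if "x \<in> polydisc \<sigma>" for x u
    using eval3_line_deriv[OF cF \<sigma>(1), of x 0 u] that by simp
  have c: "continuous_on (polydisc \<sigma>) (eval3 (fps3_deriv j F))" for j
    by (rule eval3_continuous[OF converges3_deriv[OF F \<sigma>]])
  let ?\<phi> = "\<lambda>q. q - (q $ k / v $ k) *s v + eval3 F q *s axis k 1"
  obtain U V \<psi> where UV: "open U" "q \<in> U" "U \<subseteq> polydisc \<sigma>" "open V" "?\<phi> ` U = V" "\<psi> ` V = U"
    "\<And>z. z \<in> U \<Longrightarrow> \<psi> (?\<phi> z) = z" "\<And>w. w \<in> V \<Longrightarrow> ?\<phi> (\<psi> w) = w"
    "\<And>i. holomorphic3_on U (\<lambda>z. ?\<phi> z $ i)" "\<And>i. holomorphic3_on V (\<lambda>w. \<psi> w $ i)"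
    "continuous_on V \<psi>"
    by (rule hypersurface_chart[OF open_polydisc q d c k nz], assumption, rule that)
  have "complex_submanifold 2 {x \<in> U. eval3 F x = 0 \<and> x \<in> T}" if "open T" for T
    by (rule complex_submanifold_hypersurface[OF UV(1,4,5,6,7,8,9,10,11) _ that, where k = k])
       (use k in \<open>simp_all add: axis_def\<close>)
  moreover have "x = y" if "x \<in> U" "y \<in> U" "eval3 F x = eval3 F y" "x = y + t *s v" for x y t
  proof -
    have eq: "?\<phi> x = ?\<phi> y"
      using that(3) k unfolding that(4) by (simp add: vec_eq_iff field_simps)
    have "x = \<psi> (?\<phi> x)" by (rule UV(7)[OF that(1), symmetric])
    also have "\<dots> = \<psi> (?\<phi> y)" by (simp only: eq)
    also have "\<dots> = y" by (rule UV(7)[OF that(2)])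
    finally show ?thesis .
  qed
  ultimately show ?thesis using UV(1-3) by blast
qed

lemma countable_compact_cover_interior:
  fixes Y :: "'a \<Rightarrow> 'b::euclidean_space set"
  assumes "countable I" "\<And>i. i \<in> I \<Longrightarrow> closed (Y i)" "open B" "B \<noteq> {}" "B \<subseteq> (\<Union>i\<in>I. Y i)"
  shows "\<exists>i\<in>I. interior (Y i) \<noteq> {}"
proof (rule ccontr)
  assume "\<not> ?thesis"
  then have e: "interior (Y i) = {}" if "i \<in> I" for i using that by blast
  have "UNIV \<subseteq> closure (\<Inter>((\<lambda>i. - Y i) ` I))"
  proof (rule Baire)
    fix T assume "T \<in> (\<lambda>i. - Y i) ` I"
    then obtain i where i: "i \<in> I" "T = - Y i" by blast
    have "closure T = UNIV" using e[OF i(1)] by (simp add: i(2) closure_complement)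
    moreover have "open T" using assms(2)[OF i(1)] i(2) by auto
    ultimately show "openin (top_of_set UNIV) T \<and> UNIV \<subseteq> closure T" by simp
  qed (use assms(1) in auto)
  moreover obtain b where "b \<in> B" using assms(4) by blast
  ultimately have "B \<inter> (\<Inter>((\<lambda>i. - Y i) ` I)) \<noteq> {}"
    using open_Int_closure_eq_empty[OF assms(3)] by blast
  then show False using assms(5) by auto
qed

text \<open>
  A common zero \<open>x\<close> is an isolated zero of finite order of \<open>W\<^sub>i\<close> on its line in direction \<open>v\<close>, so it is a
  simple zero of some iterated derivative \<open>F m\<close> along \<open>v\<close>, and the zero set of \<open>F m\<close> is a graph near \<open>x\<close>.
  Countably many of these graphs cover all common zeros. Projecting along \<open>v\<close>, Baire's theorem gives one
  graph on which the common zeros project onto a set with interior; the part of the graph above this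
  interior consists of common zeros and has dimension two.
\<close>

theorem formal_factor_imp_codim_1:
  assumes hol: "holomorphic_at \<omega> 0" and W: "taylor \<omega> = G *s \<eta>" and G0: "coeff3 G 0 = 0"
  shows "\<not> codim_at_least 2 (Sing \<omega>) 0"
proof
  assume "codim_at_least 2 (Sing \<omega>) 0"
  then obtain Wd where Wd: "open Wd" "0 \<in> Wd"
    "\<And>k M. complex_submanifold k M \<Longrightarrow> M \<noteq> {} \<Longrightarrow> M \<subseteq> Sing \<omega> \<inter> Wd \<Longrightarrow> k + 2 \<le> 3"
    unfolding codim_at_least_def by blast
  let ?W = "taylor \<omega>"
  obtain \<rho> where \<rho>: "\<rho> > 0" "\<And>i. converges3 \<rho> (?W $ i)" "\<And>i z. z \<in> polydisc \<rho> \<Longrightarrow> \<omega> z $ i = eval3 (?W $ i) z"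
    using taylor_eval3[OF hol] by blast
  obtain e0 where e0: "e0 > 0" "ball 0 e0 \<subseteq> Wd" using Wd(1,2) open_contains_ball by metis
  define e where "e = min e0 (\<rho> / 2)"
  have e: "e > 0" "ball 0 e \<subseteq> Wd" "e \<le> \<rho> / 2" using e0 \<rho>(1) by (auto simp: e_def)
  have in_pd: "x \<in> polydisc (\<rho> / 2)" "x \<in> polydisc \<rho>" if "norm x < e" for x
    using that e(3) \<rho>(1) by (auto intro!: norm_less_imp_polydisc)
  have sing: "x \<in> Sing \<omega> \<inter> Wd" if "norm x < e" "\<And>j. eval3 (?W $ j) x = 0" for x
    using \<rho>(3)[OF in_pd(2)[OF that(1)]] that e(2) by (auto simp: Sing_def vec_eq_iff)
  show False
  proof (cases "?W = 0")
    case True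
    have "eval3 0 x = 0" for x by (simp add: eval3_def)
    then have "ball 0 e \<subseteq> Sing \<omega> \<inter> Wd" using sing True by auto
    from Wd(3)[OF complex_submanifold_open[OF open_ball] _ this] e(1) show False by simp
  next
    case False
    have Wj: "?W $ j = G * \<eta> $ j" for j unfolding W by simp
    obtain i v r \<delta> where r: "0 < r" "0 < \<delta>"
      and near: "\<And>z u. norm z < \<delta> \<Longrightarrow> norm u \<le> r \<Longrightarrow> norm (z + u *s v) < e"
      and nz: "\<And>z u. norm z < \<delta> \<Longrightarrow> norm u = r \<Longrightarrow> eval3 (?W $ i) (z + u *s v) \<noteq> 0"
      and root: "\<And>z. norm z < \<delta> \<Longrightarrow> \<exists>u. norm u < r \<and> (\<forall>j. eval3 (?W $ j) (z + u *s v) = 0)"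
      using common_zeros_on_lines[OF \<rho>(1,2) Wj G0 False e(1)] by metis
    define F where "F m = (dir_deriv v ^^ m) (?W $ i)" for m
    have convF: "converges3 (3 * \<rho> / 4) (F m)" for m
      unfolding F_def using \<rho>(1) by (intro dir_deriv_power_converges[OF \<rho>(2)]) auto
    \<comment> \<open>the common zeros that are simple zeros of the \<open>m\<close>-th derivative of \<open>W\<^sub>i\<close> along \<open>v\<close>\<close>
    define Z where "Z m = {x. norm x < e \<and> (\<forall>j. eval3 (?W $ j) x = 0) \<and> eval3 (F m) x = 0 \<and> eval3 (F (Suc m)) x \<noteq> 0}" for m
    have some_order: "\<exists>m. x \<in> Z m" if x: "x = z + u *s v" "norm z < \<delta>" "norm u < r" "\<And>j. eval3 (?W $ j) x = 0" for x z u
    proof -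
      let ?T = "(\<lambda>t. z + t *s v) -` ball 0 e"
      let ?B = "\<lambda>t. eval3 (?W $ i) (z + t *s v)"
      have T: "open ?T" by (rule open_vimage[OF open_ball continuous_on_line])
      have convT: "convex ?T"
      proof (rule convexI)
        fix s t :: complex and a b :: real assume st: "s \<in> ?T" "t \<in> ?T" "0 \<le> a" "0 \<le> b" "a + b = 1"
        have "z + (a *\<^sub>R s + b *\<^sub>R t) *s v = (a + b) *\<^sub>R z + (a *\<^sub>R s + b *\<^sub>R t) *s v" using st(5) by simp
        also have "\<dots> = a *\<^sub>R (z + s *s v) + b *\<^sub>R (z + t *s v)"
          unfolding vec_eq_iff vector_add_component vector_scaleR_component vector_smult_component
          by (simp add: scaleR_conv_of_real algebra_simps)
        also have "\<dots> \<in> ball 0 e" using st by (intro convexD[OF convex_ball]) auto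
        finally show "a *\<^sub>R s + b *\<^sub>R t \<in> ?T" by simp
      qed
      have inT: "t \<in> ?T" if "norm t \<le> r" for t using near[OF x(2) that] by simp
      have Tpd: "z + t *s v \<in> polydisc (\<rho> / 2)" if "t \<in> ?T" for t using that by (intro in_pd) simp
      have Bh: "?B holomorphic_on ?T"
        by (rule holomorphic_on_line[OF \<rho>(2,1)]) (use in_pd in auto)
      have uT: "u \<in> ?T" using inT x(3) by simp
      have hd: "(deriv ^^ n) ?B u = eval3 (F n) x" for n
        unfolding F_def x(1) using \<rho>(1) by (intro higher_deriv_on_line[OF \<rho>(2) _ _ T Tpd uT]) auto
      have "\<exists>n. eval3 (F n) x \<noteq> 0"
      proof (rule ccontr)
        assume "\<not> ?thesis"
        then have "(deriv ^^ n) ?B u = 0" for n using hd by simp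
        moreover have rT: "of_real r \<in> ?T" using inT r(1) by simp
        ultimately have "?B (of_real r) = 0"
          using holomorphic_fun_eq_0_on_connected[OF Bh T convex_connected[OF convT] _ uT] by blast
        then show False using nz[OF x(2), of "of_real r"] r(1) by simp
      qed
      moreover define n where "n = (LEAST n. eval3 (F n) x \<noteq> 0)"
      ultimately have n: "eval3 (F n) x \<noteq> 0" "\<And>m. m < n \<Longrightarrow> eval3 (F m) x = 0"
        by (metis (mono_tags, lifting) LeastI, metis (mono_tags, lifting) not_less_Least)
      have "eval3 (F 0) x = 0" using x(4) by (simp add: F_def)
      then obtain m where "n = Suc m" using n(1) by (cases n) auto
      then have "x \<in> Z m" using n x near[OF x(2), of u] by (simp add: Z_def)
      then show ?thesis by blast
    qed
    define good where "good m x U \<epsilon> \<longleftrightarrow> open U \<and> U \<subseteq> polydisc (\<rho> / 2) \<and> \<epsilon> > 0 \<and> cball x \<epsilon> \<subseteq> U \<inter> ball 0 e \<and>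
       (\<forall>T. open T \<longrightarrow> complex_submanifold 2 {y \<in> U. eval3 (F m) y = 0 \<and> y \<in> T}) \<and>
       (\<forall>y\<in>U. \<forall>y'\<in>U. \<forall>t. eval3 (F m) y = eval3 (F m) y' \<longrightarrow> y = y' + t *s v \<longrightarrow> y = y')" for m x U \<epsilon>
    have chart: "\<exists>U \<epsilon>. good m x U \<epsilon>"
      if x: "x \<in> Z m" for m x
    proof -
      have xe: "norm x < e" and "eval3 (dir_deriv v (F m)) x \<noteq> 0" using x by (auto simp: Z_def F_def)
      from hypersurface_graph[OF convF _ _ in_pd(1)[OF xe] this(2)] \<rho>(1)
      obtain U where U: "open U" "x \<in> U" "U \<subseteq> polydisc (\<rho> / 2)"
        "\<forall>T. open T \<longrightarrow> complex_submanifold 2 {y \<in> U. eval3 (F m) y = 0 \<and> y \<in> T}"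
        "\<forall>y\<in>U. \<forall>y'\<in>U. \<forall>t. eval3 (F m) y = eval3 (F m) y' \<longrightarrow> y = y' + t *s v \<longrightarrow> y = y'" by auto
      have "open (U \<inter> ball 0 e)" "x \<in> U \<inter> ball 0 e" using U xe by auto
      then obtain \<epsilon> where "\<epsilon> > 0" "cball x \<epsilon> \<subseteq> U \<inter> ball 0 e" using open_contains_cball by metis
      then show ?thesis using U unfolding good_def by blast
    qed
    define U where "U m x = fst (SOME p. good m x (fst p) (snd p))" for m x
    define \<epsilon> where "\<epsilon> m x = snd (SOME p. good m x (fst p) (snd p))" for m x
    have good: "good m x (U m x) (\<epsilon> m x)" if x: "x \<in> Z m" for m x
    proof -
      obtain U0 \<epsilon>0 where "good m x U0 \<epsilon>0" using chart[OF x] by blast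
      then have "good m x (fst (U0, \<epsilon>0)) (snd (U0, \<epsilon>0))" by simp
      then show ?thesis unfolding U_def \<epsilon>_def by (rule someI)
    qed
    have U: "\<And>m x. x \<in> Z m \<Longrightarrow> U m x \<subseteq> polydisc (\<rho> / 2)"
       "\<And>m x. x \<in> Z m \<Longrightarrow> \<epsilon> m x > 0" "\<And>m x. x \<in> Z m \<Longrightarrow> cball x (\<epsilon> m x) \<subseteq> U m x \<inter> ball 0 e"
       "\<And>m x T. x \<in> Z m \<Longrightarrow> open T \<Longrightarrow> complex_submanifold 2 {y \<in> U m x. eval3 (F m) y = 0 \<and> y \<in> T}"
       "\<And>m x y y' t. x \<in> Z m \<Longrightarrow> y \<in> U m x \<Longrightarrow> y' \<in> U m x \<Longrightarrow> eval3 (F m) y = eval3 (F m) y' \<Longrightarrow> y = y' + t *s v \<Longrightarrow> y = y'"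
      using good unfolding good_def by blast+
    \<comment> \<open>Lindeloef: countably many of the balls around the points of \<open>Z m\<close> suffice.\<close>
    have "\<exists>Q. countable Q \<and> Q \<subseteq> Z m \<and> Z m \<subseteq> (\<Union>x\<in>Q. ball x (\<epsilon> m x))" for m
    proof -
      obtain \<F> where \<F>: "\<F> \<subseteq> (\<lambda>x. ball x (\<epsilon> m x)) ` Z m" "countable \<F>" "\<Union>\<F> = (\<Union>x\<in>Z m. ball x (\<epsilon> m x))"
        using Lindelof[of "(\<lambda>x. ball x (\<epsilon> m x)) ` Z m"] by blast
      have "\<exists>Q. countable Q \<and> Q \<subseteq> Z m \<and> \<F> = (\<lambda>x. ball x (\<epsilon> m x)) ` Q"
        by (rule countable_subset_image[THEN iffD1]) (intro conjI \<F>(1,2))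
      then obtain Q where Q: "countable Q" "Q \<subseteq> Z m" "\<F> = (\<lambda>x. ball x (\<epsilon> m x)) ` Q" by blast
      have "Z m \<subseteq> (\<Union>x\<in>Z m. ball x (\<epsilon> m x))" using U(2) by auto
      also have "\<dots> = \<Union>\<F>" by (rule \<F>(3)[symmetric])
      also have "\<dots> = (\<Union>x\<in>Q. ball x (\<epsilon> m x))" by (simp only: Q(3))
      finally show ?thesis using Q(1,2) by (intro exI[of _ Q] conjI)
    qed
    then have "\<forall>m. \<exists>Q. countable Q \<and> Q \<subseteq> Z m \<and> Z m \<subseteq> (\<Union>x\<in>Q. ball x (\<epsilon> m x))" by (rule allI)
    then have "\<exists>Q. \<forall>m. countable (Q m) \<and> Q m \<subseteq> Z m \<and> Z m \<subseteq> (\<Union>x\<in>Q m. ball x (\<epsilon> m x))" by (rule choice)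
    then obtain Q where Q0: "\<forall>m. countable (Q m) \<and> Q m \<subseteq> Z m \<and> Z m \<subseteq> (\<Union>x\<in>Q m. ball x (\<epsilon> m x))" by (rule exE)
    note Q = spec[OF Q0, THEN conjunct1] spec[OF Q0, THEN conjunct2, THEN conjunct1]
      spec[OF Q0, THEN conjunct2, THEN conjunct2]
    define S where "S m x = {y \<in> cball x (\<epsilon> m x). eval3 (F m) y = 0 \<and> (\<forall>j. eval3 (?W $ j) y = 0)}" for m x
    \<comment> \<open>The projection of the common zeros on one graph: all base points \<open>z\<close> of lines that meet \<open>S m x\<close> with a
      parameter of modulus at most \<open>r\<close>.\<close>
    define Y where "Y m x = (\<lambda>p. fst p - snd p *s v) ` (S m x \<times> cball 0 r)" for m x
    have compY: "compact (Y m x)" if x: "x \<in> Z m" for m x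
    proof -
      have sub: "cball x (\<epsilon> m x) \<subseteq> polydisc (\<rho> / 2)" using U(1,3)[OF x] by blast
      have cF: "continuous_on (cball x (\<epsilon> m x)) (eval3 (F m))"
        using converges3_mono[OF convF, of "\<rho> / 2"] \<rho>(1) by (intro continuous_on_subset[OF eval3_continuous sub]) auto
      have cW: "continuous_on (cball x (\<epsilon> m x)) (eval3 (?W $ j))" for j
        using converges3_mono[OF \<rho>(2), of "\<rho> / 2"] \<rho>(1) by (intro continuous_on_subset[OF eval3_continuous sub]) auto
      have clos: "closed {y \<in> cball x (\<epsilon> m x). f y = 0}" if "continuous_on (cball x (\<epsilon> m x)) f" for f :: "complex^3 \<Rightarrow> complex"
        using continuous_closed_preimage_constant[OF that closed_cball, of 0] by simp
      have "S m x = cball x (\<epsilon> m x) \<inter> ({y \<in> cball x (\<epsilon> m x). eval3 (F m) y = 0} \<inter> (\<Inter>j. {y \<in> cball x (\<epsilon> m x). eval3 (?W $ j) y = 0}))"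
        by (auto simp: S_def)
      moreover have "compact \<dots>"
        by (intro compact_Int_closed compact_cball closed_Int closed_INT ballI clos cF cW)
      ultimately have "compact (S m x \<times> cball (0::complex) r)" by (intro compact_Times) auto
      moreover have "continuous_on (S m x \<times> cball 0 r) (\<lambda>p. fst p - snd p *s v)"
      proof -
        have "(\<lambda>p. fst p - snd p *s v) = (\<lambda>p. \<chi> i. fst p $ i - snd p * v $ i)" by (auto simp: vec_eq_iff)
        then show ?thesis by (simp only:) (intro continuous_on_vec_lambda continuous_intros)
      qed
      ultimately show ?thesis unfolding Y_def by (intro compact_continuous_image)
    qed
    let ?I = "SIGMA m : UNIV. Q m"
    have "ball 0 \<delta> \<subseteq> (\<Union>p\<in>?I. Y (fst p) (snd p))"
    proof
      fix z :: "complex^3" assume "z \<in> ball 0 \<delta>"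
      then have z: "norm z < \<delta>" by simp
      obtain u where u: "norm u < r" "\<And>j. eval3 (?W $ j) (z + u *s v) = 0" using root[OF z] by blast
      obtain m where m: "z + u *s v \<in> Z m" using some_order[OF refl z u] by blast
      then obtain x where x: "x \<in> Q m" "z + u *s v \<in> ball x (\<epsilon> m x)" using Q(3)[of m] by blast
      then have "z + u *s v \<in> S m x" using m by (auto simp: S_def Z_def)
      then have "z \<in> Y m x" unfolding Y_def using u(1)
        by (intro image_eqI[of _ _ "(z + u *s v, u)"]) auto
      then show "z \<in> (\<Union>p\<in>?I. Y (fst p) (snd p))" using x(1) by force
    qed
    moreover have "countable ?I" using Q(1) by (intro countable_SIGMA) auto
    moreover have "closed (Y (fst p) (snd p))" if "p \<in> ?I" for p
    proof (intro compact_imp_closed compY)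
      show "snd p \<in> Z (fst p)" by (rule subsetD[OF Q(2)]) (use that in auto)
    qed
    ultimately have "\<exists>p\<in>?I. interior (Y (fst p) (snd p)) \<noteq> {}"
      using r(2) by (intro countable_compact_cover_interior[of ?I _ "ball 0 \<delta>"]) auto
    then obtain m x where "x \<in> Q m" and int: "interior (Y m x) \<noteq> {}" by auto
    then have x: "x \<in> Z m" using subsetD[OF Q(2)] by simp
    \<comment> \<open>The points of the graph whose lines meet the interior of the projection form an open part of the graph.
      Each such line meets the graph only once, namely in a common zero.\<close>
    define O' where "O' = interior (Y m x)"
    define T where "T = ball 0 e \<inter> (\<Union>t. (\<lambda>y. y - t *s v) -` O')"
    have "open ((\<lambda>y. y - t *s v) -` O')" for t
      by (rule open_vimage) (auto simp: O'_def intro!: continuous_intros)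
    then have T: "open T" unfolding T_def by (intro open_Int open_ball open_UN) auto
    let ?M = "{y \<in> U m x. eval3 (F m) y = 0 \<and> y \<in> T}"
    have M: "?M \<subseteq> Sing \<omega> \<inter> Wd"
    proof
      fix y assume y: "y \<in> ?M"
      then obtain t where t: "y - t *s v \<in> O'" and ye: "norm y < e" by (auto simp: T_def)
      then have "y - t *s v \<in> Y m x" using interior_subset by (auto simp: O'_def)
      then obtain p where p: "y - t *s v = fst p - snd p *s v" "p \<in> S m x \<times> cball 0 r"
        unfolding Y_def by (rule imageE)
      define y' t' where "y' = fst p" and "t' = snd p"
      have y': "y' \<in> S m x" "y - t *s v = y' - t' *s v"
        using p by (auto simp only: y'_def t'_def mem_Times_iff)
      have "y = (y - t *s v) + t *s v" by simp
      also have "\<dots> = y' + (t - t') *s v" unfolding y'(2) by (simp add: vec_eq_iff algebra_simps)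
      finally have "y = y' + (t - t') *s v" .
      moreover have "y' \<in> U m x" "eval3 (F m) y' = 0" using y'(1) U(3)[OF x] by (auto simp: S_def)
      moreover have "y \<in> U m x" "eval3 (F m) y = 0" using y by simp_all
      ultimately have "y = y'" using U(5)[OF x, of y y' "t - t'"] by metis
      then show "y \<in> Sing \<omega> \<inter> Wd" using y'(1) ye by (intro sing) (auto simp: S_def)
    qed
    obtain b where b: "b \<in> O'" using int by (auto simp: O'_def)
    then have "b \<in> Y m x" using interior_subset by (auto simp: O'_def)
    then obtain p where p: "b = fst p - snd p *s v" "p \<in> S m x \<times> cball 0 r"
      unfolding Y_def by (rule imageE)
    define y t where "y = fst p" and "t = snd p"
    have y: "y \<in> S m x" "b = y - t *s v" using p by (auto simp only: y_def t_def mem_Times_iff)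
    have "y \<in> ?M" using y b U(3)[OF x] by (auto simp: S_def T_def)
    then have "?M \<noteq> {}" by blast
    from Wd(3)[OF U(4)[OF x T] this M] show False by simp
  qed
qed

section \<open>From germs to formal series\<close>

lemma linear_part_taylor:
  assumes "holomorphic_at X 0"
  shows "linear_part X = (\<chi> i j. coeff3 (fps3_deriv j (taylor X $ i)) 0)"
proof -
  obtain \<rho> where \<rho>: "\<rho> > 0" "\<And>i. converges3 \<rho> (taylor X $ i)"
    "\<And>i z. z \<in> polydisc \<rho> \<Longrightarrow> X z $ i = eval3 (taylor X $ i) z"
    using taylor_eval3[OF assms] by blast
  have "partial j (\<lambda>z. X z $ i) 0 = coeff3 (fps3_deriv j (taylor X $ i)) 0" for i j
    using partial_eq_eval3[OF \<rho>(2,1) \<rho>(3) zero_in_polydisc[OF \<rho>(1)]] by (simp add: eval3_0)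
  then show ?thesis by (simp add: linear_part_def vec_eq_iff)
qed

lemma taylor_at_0: "holomorphic_at X 0 \<Longrightarrow> coeff3 (taylor X $ i) 0 = X 0 $ i"
  using taylor_eval3[of X] zero_in_polydisc by (metis eval3_0)

lemma contract_taylor_eq_0:
  assumes "holomorphic_at \<omega> 0" "holomorphic_at X 0" "invariant_by \<omega> X"
  shows "contract (taylor \<omega>) (taylor X) = 0"
proof -
  obtain a where a: "a > 0" "\<And>i. converges3 a (taylor \<omega> $ i)"
    "\<And>i z. z \<in> polydisc a \<Longrightarrow> \<omega> z $ i = eval3 (taylor \<omega> $ i) z"
    using taylor_eval3[OF assms(1)] by blast
  obtain b where b: "b > 0" "\<And>i. converges3 b (taylor X $ i)"
    "\<And>i z. z \<in> polydisc b \<Longrightarrow> X z $ i = eval3 (taylor X $ i) z"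
    using taylor_eval3[OF assms(2)] by blast
  obtain c where c: "c > 0" "\<And>z. z \<in> polydisc c \<Longrightarrow> (\<Sum>i\<in>UNIV. \<omega> z $ i * X z $ i) = 0"
    using eventually_nhds_0_polydisc[OF assms(3)[unfolded invariant_by_def]] by blast
  define \<rho> where "\<rho> = min a (min b c)"
  have \<rho>: "\<rho> > 0" "\<rho> \<le> a" "\<rho> \<le> b" "\<rho> \<le> c" using a(1) b(1) c(1) by (auto simp: \<rho>_def)
  have W: "converges3 \<rho> (taylor \<omega> $ i)" for i using converges3_mono[OF a(2)] \<rho> by simp
  have X: "converges3 \<rho> (taylor X $ i)" for i using converges3_mono[OF b(2)] \<rho> by simp
  have p: "converges3 \<rho> (taylor \<omega> $ i * taylor X $ i)" for i
    using \<rho>(1) by (intro converges3_mult W X) simp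
  show ?thesis
  proof (rule eval3_eq_0_imp_0[OF _ \<rho>(1)])
    show "converges3 \<rho> (contract (taylor \<omega>) (taylor X))"
      unfolding contract_def sum_3 using \<rho>(1) by (intro converges3_add p) auto
    fix z assume z: "z \<in> polydisc \<rho>"
    then have za: "z \<in> polydisc a" and zb: "z \<in> polydisc b" and zc: "z \<in> polydisc c"
      using polydisc_mono[OF \<rho>(2)] polydisc_mono[OF \<rho>(3)] polydisc_mono[OF \<rho>(4)] by auto
    have "eval3 (contract (taylor \<omega>) (taylor X)) z = (\<Sum>i\<in>UNIV. eval3 (taylor \<omega> $ i * taylor X $ i) z)"
      unfolding contract_def sum_3 using \<rho>(1)
      by (simp add: eval3_add[OF converges3_add[OF p p] p z] eval3_add[OF p p z])
    also have "\<dots> = (\<Sum>i\<in>UNIV. \<omega> z $ i * X z $ i)"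
      by (simp add: eval3_mult[OF W X z] a(3)[OF za] b(3)[OF zb])
    finally show "eval3 (contract (taylor \<omega>) (taylor X)) z = 0" using c(2)[OF zc] by simp
  qed
qed

lemma integrable_taylor:
  assumes "holomorphic_at \<omega> 0" "integrable_form \<omega>"
  defines "W \<equiv> taylor \<omega>"
  shows "W $ 1 * curl3 W 2 3 + W $ 2 * curl3 W 3 1 + W $ 3 * curl3 W 1 2 = 0"
proof -
  obtain a where a: "a > 0" "\<And>i. converges3 a (W $ i)"
    "\<And>i z. z \<in> polydisc a \<Longrightarrow> \<omega> z $ i = eval3 (W $ i) z"
    unfolding W_def using taylor_eval3[OF assms(1)] by blast
  obtain c where c: "c > 0"
    "\<And>z. z \<in> polydisc c \<Longrightarrow> \<forall>i j k. wedge12 (\<omega> z) (ext_deriv \<omega> z) i j k = 0"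
    using eventually_nhds_0_polydisc[OF assms(2)[unfolded integrable_form_def]] by blast
  define \<rho> where "\<rho> = min (a / 2) c"
  have \<rho>: "\<rho> > 0" "\<rho> < a" "\<rho> \<le> c" using a(1) c(1) by (auto simp: \<rho>_def)
  have W: "converges3 \<rho> (W $ i)" for i using converges3_mono[OF a(2)] \<rho> by simp
  have dW: "converges3 \<rho> (fps3_deriv j (W $ i))" for i j using \<rho> by (intro converges3_deriv[OF a(2)]) auto
  have cu: "converges3 \<rho> (curl3 W i j)" for i j unfolding curl3_def using \<rho>(1) by (intro converges3_diff dW) simp
  have p: "converges3 \<rho> (W $ i * curl3 W j k)" for i j k using \<rho>(1) by (intro converges3_mult W cu) simp
  show ?thesis
  proof (rule eval3_eq_0_imp_0[OF _ \<rho>(1)])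
    show "converges3 \<rho> (W $ 1 * curl3 W 2 3 + W $ 2 * curl3 W 3 1 + W $ 3 * curl3 W 1 2)"
      using \<rho>(1) by (intro converges3_add p) auto
    fix z assume z: "z \<in> polydisc \<rho>"
    then have za: "z \<in> polydisc a" and zc: "z \<in> polydisc c"
      using polydisc_mono[of \<rho> a] polydisc_mono[OF \<rho>(3)] \<rho>(2) by auto
    have "ext_deriv \<omega> z i j = eval3 (curl3 W i j) z" for i j
      unfolding ext_deriv_def curl3_def eval3_diff[OF dW dW z]
      by (simp add: partial_eq_eval3[OF a(2,1) a(3) za])
    then have "eval3 (W $ i * curl3 W j k) z = \<omega> z $ i * ext_deriv \<omega> z j k" for i j k
      by (simp add: eval3_mult[OF W cu z] a(3)[OF za])
    then have "eval3 (W $ 1 * curl3 W 2 3 + W $ 2 * curl3 W 3 1 + W $ 3 * curl3 W 1 2) z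
        = wedge12 (\<omega> z) (ext_deriv \<omega> z) 1 2 3"
      using \<rho>(1) by (simp add: eval3_add[OF converges3_add[OF p p] p z] eval3_add[OF p p z] wedge12_def)
    then show "eval3 (W $ 1 * curl3 W 2 3 + W $ 2 * curl3 W 3 1 + W $ 3 * curl3 W 1 2) z = 0"
      using c(2)[OF zc] by simp
  qed
qed

text \<open>
  The eigenvalues form the zero multiset of one polynomial, so the two lists agree up to a permutation
  of the indices.
\<close>

lemma nonresonant_eigenvalues:
  assumes "eigenvalues_of A \<alpha>" "eigenvalues_of A \<beta>" "nonresonant \<alpha>"
  shows "nonresonant \<beta>"
proof -
  have eq: "(\<Prod>i\<in>UNIV. (t - \<alpha> $ i)) = (\<Prod>i\<in>UNIV. (t - \<beta> $ i))" for t
    using assms(1,2) by (metis eigenvalues_of_def)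
  have "\<exists>j. \<beta> $ j = \<alpha> $ i" for i
    using eq[of "\<alpha> $ i"] by (metis (no_types, lifting) eq_iff_diff_eq_0 finite prod_zero_iff UNIV_I)
  then obtain \<pi> where \<pi>: "\<And>i. \<beta> $ \<pi> i = \<alpha> $ i" by metis
  have "inj \<pi>"
    by (rule injI, rule nonresonant_inj[OF assms(3)]) (metis \<pi>)
  then have bij: "bij \<pi>" by (simp add: bij_def finite_UNIV_inj_surj)
  show ?thesis unfolding nonresonant_def
  proof (intro allI impI)
    fix l :: "int^3" assume "(\<Sum>i\<in>UNIV. of_int (l $ i) * \<beta> $ i) = 0"
    then have "(\<Sum>i\<in>UNIV. of_int (l $ \<pi> i) * \<alpha> $ i) = 0"
      using sum.reindex_bij_betw[OF bij, of "\<lambda>i. of_int (l $ i) * \<beta> $ i"] by (simp add: \<pi>)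
    then have "(\<chi> i. l $ \<pi> i) = 0" using assms(3) by (auto simp: nonresonant_def)
    then show "l = 0" using bij_is_surj[OF bij] by (simp add: vec_eq_iff) (metis surjD)
  qed
qed

lemma unit_common_factor:
  assumes "holomorphic_at \<omega> 0" "codim_at_least 2 (Sing \<omega>) 0" "taylor \<omega> = G *s \<eta>"
  shows "coeff3 G 0 \<noteq> 0"
  using formal_factor_imp_codim_1[OF assms(1,3)] assms(2) by blast

text \<open>
  The coordinates with nonzero coefficient are placed first; if there are two of them, the third
  coordinate does not occur in the form.
\<close>

lemma log_form_ordered:
  fixes b :: "complex^3"
  assumes "card {i. b $ i \<noteq> 0} \<ge> 2"
  shows "\<exists>\<sigma> c. \<sigma> permutes (UNIV :: 3 set) \<and>
    (c $ 1 \<noteq> 0 \<and> c $ 2 \<noteq> 0 \<and> log_form {i. b $ i \<noteq> 0} b x = log_form {1, 2} c (\<chi> i. x $ \<sigma> i) \<or>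
     c $ 1 \<noteq> 0 \<and> c $ 2 \<noteq> 0 \<and> c $ 3 \<noteq> 0 \<and>
     log_form {i. b $ i \<noteq> 0} b x = log_form {1, 2, 3} c (\<chi> i. x $ \<sigma> i))"
proof (cases "{i. b $ i \<noteq> 0} = UNIV")
  case True
  then have "b $ i \<noteq> 0" for i by blast
  moreover have "log_form {i. b $ i \<noteq> 0} b x = log_form {1, 2, 3} b (\<chi> i. x $ id i)"
    unfolding True UNIV_3 id_apply vec_lambda_eta by (rule refl)
  ultimately show ?thesis using permutes_id[of "UNIV :: 3 set"] by blast
next
  case False
  then obtain t where t: "b $ t = 0" by auto
  have "card {i. b $ i \<noteq> 0} < card (UNIV :: 3 set)" using False by (intro psubset_card_mono) auto
  then have "card {i. b $ i \<noteq> 0} = 2" using assms by simp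
  then obtain p q where pq: "{i. b $ i \<noteq> 0} = {p, q}" "p \<noteq> q" by (auto simp: card_2_iff)
  have b: "b $ p \<noteq> 0" "b $ q \<noteq> 0" using pq(1) by auto
  have n: "(1::3) \<noteq> 2" "(2::3) \<noteq> 1" by simp_all
  have t': "t \<noteq> p" "t \<noteq> q" using b t by auto
  define \<sigma> where "\<sigma> i = (if i = 1 then p else if i = 2 then q else t)" for i :: 3
  have s: "\<sigma> 1 = p" "\<sigma> 2 = q" "\<sigma> 3 = t" by (simp_all add: \<sigma>_def)
  have "inj \<sigma>"
  proof (rule injI)
    fix i j assume "\<sigma> i = \<sigma> j"
    then show "i = j" using exhaust_3[of i] exhaust_3[of j] pq(2) t' s by metis
  qed
  then have "\<sigma> permutes UNIV"
    by (intro bij_imp_permutes) (auto simp: bij_def finite_UNIV_inj_surj)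
  moreover have "log_form {p, q} b x = log_form {1, 2} (\<chi> i. b $ \<sigma> i) (\<chi> i. x $ \<sigma> i)"
  proof -
    have "{p, q} - {p} = {q}" "{p, q} - {q} = {p}" "{1, 2} - {1::3} = {2}" "{1, 2} - {2::3} = {1}"
      using pq(2) n by blast+
    then show ?thesis unfolding log_form_def using pq(2) s n by simp
  qed
  ultimately show ?thesis using b s pq(1)
    by (intro exI[of _ \<sigma>] exI[of _ "\<chi> i. b $ \<sigma> i"]) simp
qed

theorem proposition3p5:
  fixes \<omega> X :: "complex^3 \<Rightarrow> complex^3"
  assumes "holomorphic_at \<omega> 0"
    and "integrable_form \<omega>"
    and "codim_at_least 2 (Sing \<omega>) 0"
    and "strongly_diagonalizable X"
    and "invariant_by \<omega> X"
  shows "(\<exists>x. diagonalizing_coordinates X x) \<and>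
    (\<forall>x. diagonalizing_coordinates X x \<longrightarrow>
       (\<exists>\<sigma> u b. \<sigma> permutes (UNIV :: 3 set) \<and> u dvd 1 \<and>
          ((b $ 1 \<noteq> 0 \<and> b $ 2 \<noteq> 0 \<and>
            u *s taylor \<omega> = log_form {1, 2} b (\<chi> i. x $ \<sigma> i)) \<or>
           (b $ 1 \<noteq> 0 \<and> b $ 2 \<noteq> 0 \<and> b $ 3 \<noteq> 0 \<and>
            u *s taylor \<omega> = log_form {1, 2, 3} b (\<chi> i. x $ \<sigma> i)))))"
proof (intro conjI allI impI)
  let ?A = "linear_part X" and ?\<xi> = "taylor X"
  have X: "holomorphic_at X 0" "X 0 = 0" using assms(4) by (auto simp: strongly_diagonalizable_def)
  obtain \<alpha> where \<alpha>: "eigenvalues_of ?A \<alpha>" "nonresonant \<alpha>"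
    using assms(4) by (auto simp: strongly_diagonalizable_def nonresonant_def)
  have \<xi>0: "coeff3 (?\<xi> $ j) 0 = 0" for j using taylor_at_0[OF X(1)] X(2) by simp
  obtain x where x: "formal_coordinates x" "\<And>i. vderiv ?\<xi> (x $ i) = const3 (\<alpha> $ i) * x $ i"
    using formal_linearisation[OF \<xi>0 \<alpha>(1)[unfolded linear_part_taylor[OF X(1)]] \<alpha>(2)] by blast
  obtain e where e: "coordinate_frame x e" using coordinate_frame_exists[OF x(1)] by blast
  have d: "contract (e i) (differential (x $ j)) = (if i = j then 1 else 0)" for i j
    using e by (simp add: coordinate_frame_def)
  have "?\<xi> - (\<Sum>i\<in>UNIV. (const3 (\<alpha> $ i) * x $ i) *s e i) = 0"
    by (rule coframe_contract_eq_0[OF e])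
      (simp add: contract_diff_left contract_sum_left contract_smult_left d x(2)[unfolded vderiv_def]
        if_distrib cong: if_cong)
  then have "?\<xi> = (\<Sum>i\<in>UNIV. (const3 (\<alpha> $ i) * x $ i) *s e i)" by simp
  then show "\<exists>x. diagonalizing_coordinates X x"
    using x(1) \<alpha>(1) e unfolding diagonalizing_coordinates_def by blast
next
  fix x assume "diagonalizing_coordinates X x"
  then obtain \<beta> e where x: "formal_coordinates x" "eigenvalues_of (linear_part X) \<beta>" "coordinate_frame x e"
    "taylor X = (\<Sum>i\<in>UNIV. (const3 (\<beta> $ i) * x $ i) *s e i)"
    unfolding diagonalizing_coordinates_def by blast
  have X: "holomorphic_at X 0" using assms(4) by (auto simp: strongly_diagonalizable_def)
  obtain \<alpha> where "eigenvalues_of (linear_part X) \<alpha>" "nonresonant \<alpha>"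
    using assms(4) by (auto simp: strongly_diagonalizable_def nonresonant_def)
  then have nr: "nonresonant \<beta>" using nonresonant_eigenvalues x(2) by blast
  have "taylor \<omega> \<noteq> 0"
    using unit_common_factor[OF assms(1,3), of 0 0] by (auto simp: eval3_0[symmetric] eval3_def)
  from formal_normal_form[OF nr x(1,3,4) contract_taylor_eq_0[OF assms(1) X assms(5)]
      integrable_taylor[OF assms(1,2)] this]
  obtain G b where b: "card {i. b $ i \<noteq> 0} \<ge> 2" and W: "taylor \<omega> = G *s log_form {i. b $ i \<noteq> 0} b x"
    by blast
  have "G dvd 1" by (rule unit_fps3[OF unit_common_factor[OF assms(1,3) W]])
  then obtain u where u: "G * u = 1" by (metis dvdE)
  then have "u dvd 1" by (metis dvd_triv_right)
  moreover have "u *s taylor \<omega> = log_form {i. b $ i \<noteq> 0} b x"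
    using u unfolding W by (simp add: vector_smult_assoc mult.commute[of u])
  ultimately show "\<exists>\<sigma> u b. \<sigma> permutes (UNIV :: 3 set) \<and> u dvd 1 \<and>
          ((b $ 1 \<noteq> 0 \<and> b $ 2 \<noteq> 0 \<and>
            u *s taylor \<omega> = log_form {1, 2} b (\<chi> i. x $ \<sigma> i)) \<or>
           (b $ 1 \<noteq> 0 \<and> b $ 2 \<noteq> 0 \<and> b $ 3 \<noteq> 0 \<and>
            u *s taylor \<omega> = log_form {1, 2, 3} b (\<chi> i. x $ \<sigma> i)))"
    using log_form_ordered[OF b, of x] by metis
qed

end
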